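(* Starting from the empty graph, the total time spent by the Renumbering Algorithm (described in the context) to process $\ell$ updates, each an insertion of an isolated vertex or of an edge between two existing vertices, while keeping the weighted simplification $G_s$ of the current graph $G$ up to date, is $O(\ell\log\ell)$.
   Context: Let $G=(V,E,\lambda)$ be a finite undirected graph without self-loops, with edge weights $\lambda:E\to\mathbb{R}^+$. A vertex is regular if it is incident to exactly two edges, and singular otherwise. A regular path is a path between two singular vertices all of whose internal vertices are regular. It is assumed that $G$ never has a cycle consisting only of regular vertices. The simplification $G_s=(V_s,E_s,\lambda_s)$ is the multigraph (possibly with self-loops) whose vertices are the singular vertices of $G$, whose edges ("topological edges") are the regular paths of $G$, and where the weight of a topological edge is the sum of the weights of the edges of $G$ on its regular path. Maintaining $G_s$ under an edge insertion $\{x,y\}$ requires, besides local changes, inserting a new topological edge, extending a topological edge (when an endpoint has degree one), merging two topological edges (when both endpoints are singular of degree one), or splitting the topological edge whose regular path passes through a regular endpoint $x$ into two, computing the weights of the two parts. The Renumbering Algorithm (with $\ell$, the maximal number of updates, known in advance) maintains: (i) an integer number for every regular vertex so that regular vertices on a regular path receive consecutive integers and different regular paths receive disjoint intervals; the $k$-th newly created regular path gets the number $2k\ell$ on one of its regular vertices, extensions continue the interval, and on a merge of two topological edges the regular vertices of the shorter of the two regular paths are renumbered; (ii) a dictionary keyed by the minimum number of each interval (balanced search structure, predecessor lookups in $O(\log N)$ time), whose item stores the topological edge, the number of regular vertices on its path, and the vertex carrying the minimal number; (iii) a weight $\lambda^*(v)$ for every regular vertex such that for consecutive regular vertices $v,w$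 one has $\lambda(\{v,w\})=|\lambda^*(v)-\lambda^*(w)|$, updated in constant time on extensions, unchanged on splits, and recomputed for the vertices of the shorter path on merges. To split at a regular vertex $x$, the dictionary is queried with the number of $x$ to find the topological edge, and the weights of the two new topological edges are computed from the vertex weights. Time is measured in the unit-cost RAM model; insertion of an isolated vertex is counted as free. *)

theory Defs
  imports Complex_Main "HOL-Library.Landau_Symbols" "HOL-Library.Monad_Syntax"
begin

section \<open>Weighted graphs and their simplification\<close>

record 'v wgraph =
  verts :: "'v set"
  edges :: "'v set set"
  weight :: "'v set \<Rightarrow> real"

definition degree :: "'v wgraph \<Rightarrow> 'v \<Rightarrow> nat" where
  "degree G v = card {e \<in> edges G. v \<in> e}"

definition regular :: "'v wgraph \<Rightarrow> 'v \<Rightarrow> bool" where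
  "regular G v \<longleftrightarrow> v \<in> verts G \<and> degree G v = 2"

definition singular :: "'v wgraph \<Rightarrow> 'v \<Rightarrow> bool" where
  "singular G v \<longleftrightarrow> v \<in> verts G \<and> degree G v \<noteq> 2"

definition path_edges :: "'v list \<Rightarrow> 'v set list" where
  "path_edges p = map (\<lambda>(u, v). {u, v}) (zip p (tl p))"

text \<open>
  A regular path is given by its list of vertices and has at least one edge. Its two end points
  may coincide, which yields a self-loop of the simplification. No edge is used twice; this
  excludes lists such as \<open>[s, v, s]\<close>.
\<close>

definition regular_path :: "'v wgraph \<Rightarrow> 'v list \<Rightarrow> bool" where
  "regular_path G p \<longleftrightarrow>
     2 \<le> length p \<and> set (path_edges p) \<subseteq> edges G \<and> distinct (path_edges p) \<and>
     singular G (hd p) \<and> singular G (last p) \<and>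
     distinct (butlast (tl p)) \<and> (\<forall>v \<in> set (butlast (tl p)). regular G v)"

definition regular_cycle :: "'v wgraph \<Rightarrow> 'v list \<Rightarrow> bool" where
  "regular_cycle G c \<longleftrightarrow>
     3 \<le> length c \<and> distinct c \<and> set (path_edges (c @ [hd c])) \<subseteq> edges G \<and>
     (\<forall>v \<in> set c. regular G v)"

record ('v, 'e) wmultigraph =
  mverts :: "'v set"
  medges :: "'e set"
  mends :: "'e \<Rightarrow> 'v set"
  mweight :: "'e \<Rightarrow> real"

text \<open>
  A regular path and its reversal are the same topological edge, so a topological edge is
  represented by the set of edges of \<open>G\<close> on the path. The end points of the path are its only
  singular vertices.
\<close>

definition simplification :: "'v wgraph \<Rightarrow> ('v, 'v set set) wmultigraph" where
  "simplification G =
     \<lparr> mverts = {v. singular G v},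
       medges = {set (path_edges p) | p. regular_path G p},
       mends = (\<lambda>T. {v \<in> \<Union>T. singular G v}),
       mweight = (\<lambda>T. \<Sum>e\<in>T. weight G e) \<rparr>"

text \<open>Equality of multigraphs up to the names of their edges.\<close>

definition same_multigraph ::
    "('v, 'e) wmultigraph \<Rightarrow> ('v, 'f) wmultigraph \<Rightarrow> bool" where
  "same_multigraph M N \<longleftrightarrow>
     mverts M = mverts N \<and>
     (\<exists>f. bij_betw f (medges M) (medges N) \<and>
          (\<forall>e \<in> medges M. mends N (f e) = mends M e \<and> mweight N (f e) = mweight M e))"


section \<open>Update sequences\<close>

datatype 'v update = Ins_Vertex 'v | Ins_Edge 'v 'v real

definition empty_graph :: "'v wgraph" where
  "empty_graph = \<lparr> verts = {}, edges = {}, weight = (\<lambda>_. 0) \<rparr>"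

fun apply_update :: "'v wgraph \<Rightarrow> 'v update \<Rightarrow> 'v wgraph" where
  "apply_update G (Ins_Vertex v) = G\<lparr> verts := insert v (verts G) \<rparr>"
| "apply_update G (Ins_Edge x y w) =
     G\<lparr> edges := insert {x, y} (edges G), weight := (weight G)({x, y} := w) \<rparr>"

fun admissible :: "'v wgraph \<Rightarrow> 'v update \<Rightarrow> bool" where
  "admissible G (Ins_Vertex v) \<longleftrightarrow> v \<notin> verts G"
| "admissible G (Ins_Edge x y w) \<longleftrightarrow>
     x \<in> verts G \<and> y \<in> verts G \<and> x \<noteq> y \<and> {x, y} \<notin> edges G \<and> 0 < w"

definition graph_after :: "'v update list \<Rightarrow> 'v wgraph" where
  "graph_after us = foldl apply_update empty_graph us"

definition valid_updates :: "'v update list \<Rightarrow> bool" where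
  "valid_updates us \<longleftrightarrow>
     (\<forall>i < length us. admissible (graph_after (take i us)) (us ! i) \<and>
        (\<nexists>c. regular_cycle (graph_after (take (Suc i) us)) c))"


section \<open>Memory and cost model\<close>

text \<open>
  All components are arrays or single cells, apart from the dictionary \<open>dict\<close>, which maps the
  minimal number of an interval to the topological edge, the number of regular vertices on its
  path, and the vertex carrying the minimal number.
  The simplification is stored in \<open>sing\<close> (flags of the singular vertices) and \<open>tedge\<close> (end points
  and weight of every topological edge, indexed by edge identifiers). The entry \<open>tinc v\<close> is only
  meaningful for a vertex \<open>v\<close> of degree one; it is the topological edge incident to \<open>v\<close>.
\<close>

record 'v mem =
  deg :: "'v \<Rightarrow> nat"
  adj :: "'v \<Rightarrow> nat \<Rightarrow> 'v \<times> real"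
  sing :: "'v \<Rightarrow> bool"
  tedge :: "nat \<Rightarrow> ('v \<times> 'v \<times> real) option"
  tinc :: "'v \<Rightarrow> nat"
  next_id :: nat
  num :: "'v \<Rightarrow> int"
  lam :: "'v \<Rightarrow> real"
  created :: nat
  dict :: "int \<Rightarrow> (nat \<times> nat \<times> 'v) option"

definition init_mem :: "'v mem" where
  "init_mem =
     \<lparr> deg = (\<lambda>_. 0), adj = (\<lambda>_ _. undefined), sing = (\<lambda>_. False), tedge = (\<lambda>_. None),
       tinc = (\<lambda>_. 0), next_id = 0, num = (\<lambda>_. 0), lam = (\<lambda>_. 0), created = 0,
       dict = (\<lambda>_. None) \<rparr>"

definition stored_simplification :: "'v mem \<Rightarrow> ('v, nat) wmultigraph" where
  "stored_simplification m =
     \<lparr> mverts = {v. sing m v},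
       medges = dom (tedge m),
       mends = (\<lambda>e. case the (tedge m e) of (s, t, _) \<Rightarrow> {s, t}),
       mweight = (\<lambda>e. case the (tedge m e) of (_, _, w) \<Rightarrow> w) \<rparr>"

text \<open>
  A program yields a result, a new memory and the time used. Programs are composed from the basic
  instructions below. An instruction costs one unit and comprises at most one memory access,
  besides arithmetic and comparisons on a bounded number of values; only the three dictionary
  operations have a different cost: \<open>D N\<close>, where \<open>N\<close> is the number of items.
\<close>

type_synonym ('v, 'a) ram = "'v mem \<Rightarrow> 'a \<times> 'v mem \<times> nat"

definition bind_ram :: "('v, 'a) ram \<Rightarrow> ('a \<Rightarrow> ('v, 'b) ram) \<Rightarrow> ('v, 'b) ram" where
  "bind_ram p q = (\<lambda>m. let (a, m', c) = p m; (b, m'', c') = q a m' in (b, m'', c + c'))"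

adhoc_overloading Monad_Syntax.bind \<rightleftharpoons> bind_ram

definition return :: "'a \<Rightarrow> ('v, 'a) ram" where
  "return a = (\<lambda>m. (a, m, 1))"

definition get_deg :: "'v \<Rightarrow> ('v, nat) ram" where
  "get_deg v = (\<lambda>m. (deg m v, m, 1))"

definition set_deg :: "'v \<Rightarrow> nat \<Rightarrow> ('v, unit) ram" where
  "set_deg v d = (\<lambda>m. ((), m\<lparr> deg := (deg m)(v := d) \<rparr>, 1))"

definition get_adj :: "'v \<Rightarrow> nat \<Rightarrow> ('v, 'v \<times> real) ram" where
  "get_adj v i = (\<lambda>m. (adj m v i, m, 1))"

definition set_adj :: "'v \<Rightarrow> nat \<Rightarrow> 'v \<times> real \<Rightarrow> ('v, unit) ram" where
  "set_adj v i a = (\<lambda>m. ((), m\<lparr> adj := (adj m)(v := (adj m v)(i := a)) \<rparr>, 1))"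

definition get_sing :: "'v \<Rightarrow> ('v, bool) ram" where
  "get_sing v = (\<lambda>m. (sing m v, m, 1))"

definition set_sing :: "'v \<Rightarrow> bool \<Rightarrow> ('v, unit) ram" where
  "set_sing v b = (\<lambda>m. ((), m\<lparr> sing := (sing m)(v := b) \<rparr>, 1))"

definition get_tedge :: "nat \<Rightarrow> ('v, 'v \<times> 'v \<times> real) ram" where
  "get_tedge e = (\<lambda>m. (the (tedge m e), m, 1))"

definition set_tedge :: "nat \<Rightarrow> 'v \<Rightarrow> 'v \<Rightarrow> real \<Rightarrow> ('v, unit) ram" where
  "set_tedge e s t w = (\<lambda>m. ((), m\<lparr> tedge := (tedge m)(e \<mapsto> (s, t, w)) \<rparr>, 1))"

definition del_tedge :: "nat \<Rightarrow> ('v, unit) ram" where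
  "del_tedge e = (\<lambda>m. ((), m\<lparr> tedge := (tedge m)(e := None) \<rparr>, 1))"

definition new_tedge :: "('v, nat) ram" where
  "new_tedge = (\<lambda>m. (next_id m, m\<lparr> next_id := Suc (next_id m) \<rparr>, 1))"

definition get_tinc :: "'v \<Rightarrow> ('v, nat) ram" where
  "get_tinc v = (\<lambda>m. (tinc m v, m, 1))"

definition set_tinc :: "'v \<Rightarrow> nat \<Rightarrow> ('v, unit) ram" where
  "set_tinc v e = (\<lambda>m. ((), m\<lparr> tinc := (tinc m)(v := e) \<rparr>, 1))"

definition get_num :: "'v \<Rightarrow> ('v, int) ram" where
  "get_num v = (\<lambda>m. (num m v, m, 1))"

definition set_num :: "'v \<Rightarrow> int \<Rightarrow> ('v, unit) ram" where
  "set_num v k = (\<lambda>m. ((), m\<lparr> num := (num m)(v := k) \<rparr>, 1))"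

definition get_lam :: "'v \<Rightarrow> ('v, real) ram" where
  "get_lam v = (\<lambda>m. (lam m v, m, 1))"

definition set_lam :: "'v \<Rightarrow> real \<Rightarrow> ('v, unit) ram" where
  "set_lam v r = (\<lambda>m. ((), m\<lparr> lam := (lam m)(v := r) \<rparr>, 1))"

definition new_created :: "('v, nat) ram" where
  "new_created = (\<lambda>m. (Suc (created m), m\<lparr> created := Suc (created m) \<rparr>, 1))"

definition dict_size :: "'v mem \<Rightarrow> nat" where
  "dict_size m = card (dom (dict m))"

definition dict_pred :: "(nat \<Rightarrow> nat) \<Rightarrow> int \<Rightarrow> ('v, int \<times> nat \<times> nat \<times> 'v) ram" where
  "dict_pred D q =
     (\<lambda>m. let k = Max {k \<in> dom (dict m). k \<le> q} in ((k, the (dict m k)), m, D (dict_size m)))"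

definition dict_insert :: "(nat \<Rightarrow> nat) \<Rightarrow> int \<Rightarrow> nat \<times> nat \<times> 'v \<Rightarrow> ('v, unit) ram" where
  "dict_insert D k i = (\<lambda>m. ((), m\<lparr> dict := (dict m)(k \<mapsto> i) \<rparr>, D (dict_size m)))"

definition dict_delete :: "(nat \<Rightarrow> nat) \<Rightarrow> int \<Rightarrow> ('v, unit) ram" where
  "dict_delete D k = (\<lambda>m. ((), m\<lparr> dict := (dict m)(k := None) \<rparr>, D (dict_size m)))"


section \<open>The Renumbering Algorithm\<close>

definition other_end :: "'v \<times> 'v \<times> real \<Rightarrow> 'v \<Rightarrow> 'v" where
  "other_end T x = (case T of (s, t, _) \<Rightarrow> if s = x then t else s)"

text \<open>
  For a vertex \<open>c\<close> with exactly two neighbours, one of which is \<open>p\<close>: the weight of the edge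
  \<open>{p, c}\<close> and the neighbour other than \<open>p\<close>.
\<close>

definition link :: "'v \<Rightarrow> 'v \<Rightarrow> ('v, real \<times> 'v) ram" where
  "link c p = do {
     (u0, w0) \<leftarrow> get_adj c 0;
     (u1, w1) \<leftarrow> get_adj c 1;
     return (if u0 = p then (w0, u1) else (w1, u0)) }"

text \<open>
  Starting with \<open>c\<close> and moving away from the numbered vertex \<open>p\<close>, (re)number \<open>n\<close> vertices upwards
  (\<open>d = 1\<close>) or downwards (\<open>d = -1\<close>) and recompute their vertex weights; the result is the last
  vertex that was numbered. Vertex weights increase with the numbers along a path.
\<close>

primrec walk :: "nat \<Rightarrow> int \<Rightarrow> 'v \<Rightarrow> 'v \<Rightarrow> ('v, 'v) ram" where
  "walk 0 d p c = return p"
| "walk (Suc n) d p c = do {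
     k \<leftarrow> get_num p;
     r \<leftarrow> get_lam p;
     (w, c') \<leftarrow> link c p;
     set_num c (k + d);
     set_lam c (r + of_int d * w);
     walk n d c c' }"

context
  fixes D :: "nat \<Rightarrow> nat"
    and L :: nat  \<comment> \<open>the maximal number of updates\<close>
begin

text \<open>
  Give numbers to \<open>n\<close> vertices, the first of which is \<open>x\<close>, that continue the path of the
  topological edge \<open>e\<close> beyond \<open>u\<close>. If \<open>u\<close> is singular, the path had no regular vertex so far and
  a new interval is created. Otherwise the interval of \<open>u\<close> is continued.
  If \<open>u\<close> is the only vertex in its interval, both directions are conceivable. The slot above \<open>u\<close>
  must not be used if it belonged to a vertex at which the path has been split, since the numbers
  beyond it may be in use. A vertex keeps its number in \<open>num\<close> when it becomes singular, so this
  vertex is recognised as the other neighbour \<open>z\<close> of \<open>u\<close>.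
\<close>

definition grow :: "nat \<Rightarrow> 'v \<Rightarrow> 'v \<Rightarrow> nat \<Rightarrow> ('v, unit) ram" where
  "grow e x u n = do {
     b \<leftarrow> get_sing u;
     if b then do {
       k \<leftarrow> new_created;
       let a = 2 * int k * int L;
       set_num x a;
       set_lam x 0;
       (_, y) \<leftarrow> link x u;
       walk (n - 1) 1 x y;
       dict_insert D a (e, n, x)
     } else do {
       k \<leftarrow> get_num u;
       (a, _, i, v) \<leftarrow> dict_pred D k;
       (_, z) \<leftarrow> link u x;
       kz \<leftarrow> get_num z;
       if k = a + int i - 1 \<and> (1 < i \<or> kz \<noteq> k + 1) then do {
         walk n 1 u x;
         dict_insert D a (e, i + n, v)
       } else do {
         v' \<leftarrow> walk n (- 1) u x;
         dict_delete D a;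
         dict_insert D (a - int n) (e, i + n, v')
       }
     } }"

text \<open>
  Split the topological edge through the regular vertex \<open>x\<close>. Its identifier \<open>e\<close> is kept for the
  part containing the smaller numbers.
\<close>

definition split :: "'v \<Rightarrow> ('v, unit) ram" where
  "split x = do {
     k \<leftarrow> get_num x;
     (a, e, i, v) \<leftarrow> dict_pred D k;
     (s, t, W) \<leftarrow> get_tedge e;
     (u0, w0) \<leftarrow> get_adj v 0;
     (u1, w1) \<leftarrow> get_adj v 1;
     b \<leftarrow> get_sing u0;
     let (s_low, w_low) = (if b then (u0, w0) else (u1, w1));
     let s_high = other_end (s, t, W) s_low;
     rx \<leftarrow> get_lam x;
     rv \<leftarrow> get_lam v;
     let W_low = w_low + \<bar>rx - rv\<bar>;
     e' \<leftarrow> new_tedge;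
     set_tedge e s_low x W_low;
     set_tedge e' x s_high (W - W_low);
     set_tinc s_high e';
     set_sing x True;
     (if a < k then dict_insert D a (e, nat (k - a), v) else dict_delete D a);
     if k < a + int i - 1 then do {
       (y0, _) \<leftarrow> get_adj x 0;
       (y1, _) \<leftarrow> get_adj x 1;
       b0 \<leftarrow> get_sing y0;
       k0 \<leftarrow> get_num y0;
       dict_insert D (k + 1)
         (e', nat (a + int i - 1 - k), if \<not> b0 \<and> k0 = k + 1 then y0 else y1)
     } else return () }"

definition insert_tedge :: "'v \<Rightarrow> 'v \<Rightarrow> real \<Rightarrow> ('v, unit) ram" where
  "insert_tedge x y w = do {
     e \<leftarrow> new_tedge;
     set_tedge e x y w;
     set_tinc x e;
     set_tinc y e }"

text \<open>
  In \<open>extend\<close>, \<open>path_size\<close>, \<open>absorb\<close> and \<open>merge\<close>, the vertex \<open>x\<close> (and \<open>y\<close> in the latter two) had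
  degree one before the edge \<open>{x, y}\<close> was inserted; its neighbour at that time is in slot 0.
\<close>

definition extend :: "'v \<Rightarrow> 'v \<Rightarrow> real \<Rightarrow> ('v, unit) ram" where
  "extend x y w = do {
     (u, _) \<leftarrow> get_adj x 0;
     e \<leftarrow> get_tinc x;
     (s, t, W) \<leftarrow> get_tedge e;
     set_tedge e (other_end (s, t, W) x) y (W + w);
     set_tinc y e;
     set_sing x False;
     grow e x u 1 }"

definition path_size :: "'v \<Rightarrow> ('v, nat) ram" where
  "path_size x = do {
     (u, _) \<leftarrow> get_adj x 0;
     b \<leftarrow> get_sing u;
     if b then return 0
     else do {
       k \<leftarrow> get_num u;
       (_, _, i, _) \<leftarrow> dict_pred D k;
       return i
     } }"

text \<open>
  Merge the topological edges ending in \<open>x\<close> and in \<open>y\<close>, renumbering the \<open>n\<close> regular vertices of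
  the latter.
\<close>

definition absorb :: "'v \<Rightarrow> 'v \<Rightarrow> real \<Rightarrow> nat \<Rightarrow> ('v, unit) ram" where
  "absorb x y w n = do {
     (u, _) \<leftarrow> get_adj x 0;
     (v, _) \<leftarrow> get_adj y 0;
     e \<leftarrow> get_tinc x;
     f \<leftarrow> get_tinc y;
     (s, t, W) \<leftarrow> get_tedge e;
     (s', t', W') \<leftarrow> get_tedge f;
     let q = other_end (s', t', W') y;
     set_tedge e (other_end (s, t, W) x) q (W + w + W');
     del_tedge f;
     set_tinc q e;
     set_sing x False;
     set_sing y False;
     (if 0 < n then do {
       k \<leftarrow> get_num v;
       (a, _) \<leftarrow> dict_pred D k;
       dict_delete D a
     } else return ());
     grow e x u (n + 2) }"

definition merge :: "'v \<Rightarrow> 'v \<Rightarrow> real \<Rightarrow> ('v, unit) ram" where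
  "merge x y w = do {
     nx \<leftarrow> path_size x;
     ny \<leftarrow> path_size y;
     if ny \<le> nx then absorb x y w ny else absorb y x w nx }"

definition insert_edge :: "'v \<Rightarrow> 'v \<Rightarrow> real \<Rightarrow> ('v, unit) ram" where
  "insert_edge x y w = do {
     dx \<leftarrow> get_deg x;
     dy \<leftarrow> get_deg y;
     (if dx = 2 then split x else return ());
     (if dy = 2 then split y else return ());
     set_adj x dx (y, w);
     set_adj y dy (x, w);
     set_deg x (dx + 1);
     set_deg y (dy + 1);
     if dx = 1 \<and> dy = 1 then merge x y w
     else if dx = 1 then extend x y w
     else if dy = 1 then extend y x w
     else insert_tedge x y w }"

text \<open>The insertion of an isolated vertex is free of charge.\<close>

fun process :: "'v update \<Rightarrow> ('v, unit) ram" where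
  "process (Ins_Vertex v) = (\<lambda>m. ((), m\<lparr> sing := (sing m)(v := True) \<rparr>, 0))"
| "process (Ins_Edge x y w) = insert_edge x y w"

primrec run :: "'v update list \<Rightarrow> 'v mem \<Rightarrow> 'v mem \<times> nat" where
  "run [] m = (m, 0)"
| "run (u # us) m =
     (let (_, m', c) = process u m; (m'', c') = run us m' in (m'', c + c'))"

definition memory_after :: "'v update list \<Rightarrow> 'v mem" where
  "memory_after us = fst (run us init_mem)"

definition total_time :: "'v update list \<Rightarrow> nat" where
  "total_time us = snd (run us init_mem)"

end

end

theory Submission
  imports Defs
begin

text \<open>
  The memory is related to a ghost decomposition of the edge set into the regular paths, one for
  each topological edge. An edge insertion first splits the paths through regular end points and
  then either adds a path of length one or appends to a path ending in a vertex of degree one the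
  new edge, possibly followed by another path of this kind.

  Numbers never clash because a vertex at which a path has been split has degree at least three
  from then on. So a path can only grow at an end that has never been next to a split, and there
  the interval is outermost among those with the same centre \<open>2 k L\<close>. It remains within distance
  \<open>L\<close> of the centre, since at most two slots can be charged to each vertex of degree at least two,
  and the number of these is at most half the number of updates.

  For the running time, paths with two ends of degree one never contain vertices that have taken
  part in a split, so renumbering the shorter of two such paths costs \<open>O(l log l)\<close> in total. Any
  other merge destroys an end of degree one for all vertices of a path that is at least as long as
  the renumbered one, which can happen only twice to each vertex.
\<close>

section \<open>Paths\<close>

text \<open>Ghost paths are directed lists, whereas topological edges have no direction. The
  invariant is therefore stable under reversing a single list, and each update first turns the lists
  so that it acts at the end of a list or along ascending numbers. During an edge insertion the set
  \<open>S\<close> of flagged vertices runs ahead of the degrees: a split end point is flagged while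
  its degree is still two. So degree two is required only of the vertices outside \<open>S\<close>.

  The length of a path does not bound how far its interval reaches from the centre, because pieces
  may have been split off. This bound is supplied by \<open>room\<close>. It leaves out the vertices
  of other paths with two ends of degree one, so that appending such a path raises
  \<open>room\<close> by the number of slots used. After appending any other path, nothing can grow
  beyond its far end.

  In the potential, \<open>A\<close> is \<open>log 2 L + 2\<close>: the logarithm pays for union by
  size, the 2 for the later loss of both ends of degree one. The factor 7 in front of the potential
  is the cost of one step of \<open>walk\<close>.\<close>

definition inner :: "'v list \<Rightarrow> 'v list" where
  "inner p = butlast (tl p)"

lemma path_edges_simps [simp]:
  "path_edges [] = []" "path_edges [u] = []"
  "path_edges (u # v # p) = {u, v} # path_edges (v # p)"
  by (auto simp: path_edges_def)

lemma path_edges_append: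
  "p \<noteq> [] \<Longrightarrow> q \<noteq> [] \<Longrightarrow> path_edges (p @ q) = path_edges p @ {last p, hd q} # path_edges q"
proof (induction p rule: induct_list012)
  case (2 x)
  then show ?case by (cases q) auto
qed auto

lemma path_edges_rev [simp]: "path_edges (rev p) = rev (path_edges p)"
proof (induction p rule: induct_list012)
  case (3 x y zs)
  then show ?case using path_edges_append[of "rev zs @ [y]" "[x]"] by (simp add: insert_commute)
qed auto

lemma path_ends:
  assumes "2 \<le> length p"
  shows "p = hd p # inner p @ [last p]"
proof (cases p)
  case (Cons a list)
  with assms have "list \<noteq> []" by auto
  with Cons show ?thesis by (simp add: inner_def)
qed (use assms in simp)

lemma inner_Cons_snoc [simp]: "inner (s # vs @ [t]) = vs"
  by (simp add: inner_def)

lemma inner_pair [simp]: "inner [s, t] = []"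
  by (simp add: inner_def)

lemma inner_rev [simp]: "inner (rev p) = rev (inner p)"
proof (cases "2 \<le> length p")
  case True
  have "rev p = last p # rev (inner p) @ [hd p]" using arg_cong[OF path_ends[OF True], of rev] by
      simp
  then show ?thesis by (metis inner_Cons_snoc)
next
  case False
  then show ?thesis by (cases p; cases "tl p") (auto simp: inner_def)
qed

lemma inner_append:
  assumes "2 \<le> length p" "q \<noteq> []"
  shows "inner (p @ q) = inner p @ last p # butlast q"
proof -
  have "p @ q = hd p # (inner p @ [last p]) @ q" using path_ends[OF assms(1)] by simp
  then have "inner (p @ q) = butlast ((inner p @ [last p]) @ q)" by (metis inner_def list.sel(3))
  with assms(2) show ?thesis by (simp add: butlast_append)
qed

lemma Union_path_edges: "2 \<le> length p \<Longrightarrow> \<Union> (set (path_edges p)) = set p"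
proof (induction p rule: induct_list012)
  case (3 x y zs)
  then show ?case by (cases zs) auto
qed auto

lemma set_path:
  assumes "2 \<le> length p"
  shows "set p = insert (hd p) (insert (last p) (set (inner p)))"
proof -
  have "set p = set (hd p # inner p @ [last p])" using path_ends[OF assms] by simp
  then show ?thesis by auto
qed

lemma inner_split:
  assumes "v \<in> set (inner p)" "2 \<le> length p"
  obtains xs a b ys where "p = xs @ a # v # b # ys"
proof -
  obtain ys zs where "inner p = ys @ v # zs" using assms(1) by (meson split_list)
  then have p: "p = (hd p # ys) @ v # (zs @ [last p])" using path_ends[OF assms(2)] by simp
  obtain xs a where "hd p # ys = xs @ [a]" by (metis list.distinct(1) rev_exhaust)
  moreover obtain b ws where "zs @ [last p] = b # ws" by (cases zs) auto
  ultimately show ?thesis using that[of xs a b ws] p by simp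
qed

lemma path_edges_mid:
  "path_edges (xs @ a # v # b # ys) = path_edges (xs @ [a]) @ {a, v} # {v, b} # path_edges (b # ys)"
  using path_edges_append[of "xs @ [a]" "v # b # ys"] by simp

text \<open>\<open>regular_path\<close> relative to a set \<open>S\<close> in place of the singular
  vertices. Between the split at an end point and the insertion of the edge, the flagged vertices,
  for which \<open>S\<close> stands, are not exactly the singular ones.\<close>

definition rpath :: "'v set set \<Rightarrow> 'v set \<Rightarrow> 'v list \<Rightarrow> bool" where
  "rpath E S p \<longleftrightarrow> 2 \<le> length p \<and> set (path_edges p) \<subseteq> E \<and> distinct (path_edges p) \<and>
     hd p \<in> S \<and> last p \<in> S \<and> distinct (inner p) \<and> set (inner p) \<inter> S = {}"

lemma rpath_rev [simp]: fixes p :: "'v list" shows "rpath E S (rev p) \<longleftrightarrow> rpath E S p"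
proof -
  have "rpath E S (rev p)" if "rpath E S p" for p :: "'v list"
  proof -
    from that have "p \<noteq> []" by (auto simp: rpath_def)
    with that show ?thesis by (auto simp: rpath_def hd_rev last_rev)
  qed
  from this[of p] this[of "rev p"] show ?thesis by auto
qed

text \<open>Consecutive edges meet in an inner vertex, so a relation between any two edges at an
  inner vertex holds along the whole edge list.\<close>

lemma successively_path_edges:
  assumes "set (path_edges p) \<subseteq> E"
    and "\<And>v e f. v \<in> set (inner p) \<Longrightarrow> e \<in> E \<Longrightarrow> f \<in> E \<Longrightarrow> v \<in> e \<Longrightarrow> v \<in> f \<Longrightarrow> R e f"
  shows "successively R (path_edges p)"
  using assms
proof (induction p rule: induct_list012)
  case (3 a b p)
  show ?case
  proof (cases p)
    case (Cons c r)
    have "inner (a # b # p) = b # inner (b # p)" by (simp add: Cons inner_def)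
    then have sub: "set (inner (b # p)) \<subseteq> set (inner (a # b # p))" "b \<in> set (inner (a # b # p))"
      by auto
    have "successively R (path_edges (b # p))"
    proof (rule "3.IH"(2))
      show "set (path_edges (b # p)) \<subseteq> E" using "3.prems"(1) by simp
      show "R e f" if "v \<in> set (inner (b # p))" "e \<in> E" "f \<in> E" "v \<in> e" "v \<in> f" for v e f
        by (rule "3.prems"(2)[of v]) (use that sub in auto)
    qed
    moreover have "R {a, b} {b, c}"
      by (rule "3.prems"(2)[of b]) (use "3.prems"(1) Cons sub in auto)
    ultimately show ?thesis by (simp add: Cons)
  qed simp
qed auto

lemma successively_iff_all:
  assumes "successively (\<lambda>a b. Q a \<longleftrightarrow> Q b) xs" "x \<in> set xs" "y \<in> set xs" "Q x"
  shows "Q y"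
proof -
  have "Q z \<longleftrightarrow> Q (hd xs)" if "z \<in> set xs" for z
    using assms(1) that
  proof (induction xs rule: induct_list012)
    case (3 x y zs)
    then show ?case by (cases "z = x") auto
  qed auto
  with assms show ?thesis by blast
qed

lemma path_edges_nonempty: "2 \<le> length p \<Longrightarrow> path_edges p \<noteq> []"
  by (cases p; cases "tl p") auto

section \<open>Decompositions into regular paths\<close>

text \<open>\<open>two_edges\<close> concerns only the vertices outside \<open>S\<close>; a vertex
  of degree two may belong to \<open>S\<close>, as it does right after a split. The keys of
  \<open>P\<close> are the identifiers of the stored topological edges.\<close>

locale decomposition =
  fixes V :: "'v set" and E :: "'v set set" and S :: "'v set" and P :: "nat \<Rightarrow> 'v list option"
  assumes finite_V: "finite V"
    and edge: "\<And>ed. ed \<in> E \<Longrightarrow> \<exists>u v. ed = {u, v} \<and> u \<noteq> v \<and> u \<in> V \<and> v \<in> V"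
    and S_subset: "S \<subseteq> V"
    and two_edges: "\<And>v. v \<in> V - S \<Longrightarrow> card {ed \<in> E. v \<in> ed} = 2"
    and finite_dom: "finite (dom P)"
    and path: "\<And>e p. P e = Some p \<Longrightarrow> rpath E S p"
    and disjoint: "\<And>e f p q. P e = Some p \<Longrightarrow> P f = Some q \<Longrightarrow> e \<noteq> f \<Longrightarrow>
      set (path_edges p) \<inter> set (path_edges q) = {}"
    and cover: "\<And>ed. ed \<in> E \<Longrightarrow> \<exists>e p. P e = Some p \<and> ed \<in> set (path_edges p)"
begin

lemma finite_E: "finite E"
proof -
  have "E \<subseteq> Pow V" using edge by blast
  then show ?thesis using finite_V finite_subset by blast
qed

lemma length_path: "rpath E S p \<Longrightarrow> 2 \<le> length p"
  by (simp add: rpath_def)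

lemma path_subset:
  assumes "rpath E S p" shows "set p \<subseteq> V"
proof -
  have "\<Union> (set (path_edges p)) \<subseteq> V" using assms edge by (fastforce simp: rpath_def)
  then show ?thesis using Union_path_edges[of p] assms by (simp add: rpath_def)
qed

lemma inner_subset:
  assumes "rpath E S p" shows "set (inner p) \<subseteq> V - S"
  using path_subset[OF assms] assms set_path[of p] by (auto simp: rpath_def)

text \<open>The list enters and leaves \<open>v\<close> by two different edges, since no edge is
  used twice; a vertex of degree two has no further ones.\<close>

lemma inner_edges:
  assumes "rpath E S p" "v \<in> set (inner p)"
  obtains a b xs ys where "p = xs @ a # v # b # ys" "{ed \<in> E. v \<in> ed} = {{a, v}, {v, b}}" "a \<noteq> b"
proof -
  obtain xs a b ys where p: "p = xs @ a # v # b # ys"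
    using inner_split[OF assms(2) length_path[OF assms(1)]] .
  then have d: "{a, v} \<noteq> {v, b}" "{{a, v}, {v, b}} \<subseteq> {ed \<in> E. v \<in> ed}"
    using assms(1) by (auto simp: rpath_def path_edges_mid)
  have "card {ed \<in> E. v \<in> ed} = 2" using two_edges inner_subset assms by blast
  moreover have "card {{a, v}, {v, b}} = 2" using d by simp
  moreover have "finite {ed \<in> E. v \<in> ed}" using finite_E by simp
  ultimately have "{ed \<in> E. v \<in> ed} = {{a, v}, {v, b}}"
    using d(2) by (metis card_subset_eq)
  moreover have "a \<noteq> b" using d(1) by auto
  ultimately show ?thesis using that p by blast
qed

lemma edges_at_inner:
  assumes "rpath E S p" "v \<in> set (inner p)" "ed \<in> E" "v \<in> ed"
  shows "ed \<in> set (path_edges p)"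
proof -
  obtain a b xs ys where "p = xs @ a # v # b # ys" "{ed \<in> E. v \<in> ed} = {{a, v}, {v, b}}"
    using inner_edges[OF assms(1,2)] .
  with assms(3,4) show ?thesis by (auto simp: path_edges_mid)
qed

lemma path_edge_inner:
  assumes "rpath E S p" "ed \<in> set (path_edges p)" "v \<in> ed" "v \<notin> S"
  shows "v \<in> set (inner p)"
proof -
  have "v \<in> set p" using assms Union_path_edges[of p] by (auto simp: rpath_def)
  with assms show ?thesis using set_path[of p] by (auto simp: rpath_def)
qed

lemma path_edge_end:
  assumes "rpath E S p" "ed \<in> set (path_edges p)" "v \<in> ed" "v \<in> S"
  shows "v = hd p \<or> v = last p"
proof -
  have "v \<in> set p" using assms Union_path_edges[of p] by (auto simp: rpath_def)
  with assms show ?thesis using set_path[of p] by (auto simp: rpath_def)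
qed

lemma inner_unique:
  assumes "P e = Some p" "P f = Some q" "v \<in> set (inner p)" "v \<in> set (inner q)"
  shows "e = f"
proof (rule ccontr)
  assume "e \<noteq> f"
  obtain a b xs ys where p: "p = xs @ a # v # b # ys"
    using inner_split[OF assms(3) length_path[OF path[OF assms(1)]]] .
  then have "{a, v} \<in> set (path_edges p)" by (simp add: path_edges_mid)
  moreover have "{a, v} \<in> E" using calculation path[OF assms(1)] by (auto simp: rpath_def)
  then have "{a, v} \<in> set (path_edges q)" using edges_at_inner[OF path[OF assms(2)] assms(4)] by
      simp
  ultimately show False using disjoint assms(1,2) \<open>e \<noteq> f\<close> by blast
qed

lemma inner_cover:
  assumes "v \<in> V - S"
  obtains e p where "P e = Some p" "v \<in> set (inner p)"
proof -
  have "{ed \<in> E. v \<in> ed} \<noteq> {}" using two_edges[OF assms] by force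
  then obtain ed where "ed \<in> E" "v \<in> ed" by blast
  then show ?thesis using cover path path_edge_inner assms that by (metis Diff_iff)
qed

text \<open>A closed list would leave and re-enter its common end by two different edges, or be a
  self-loop, which \<open>edge\<close> excludes.\<close>

lemma ends_distinct:
  assumes "rpath E S p" "card {ed \<in> E. last p \<in> ed} = 1"
  shows "hd p \<noteq> last p"
proof
  assume eq: "hd p = last p"
  have p: "p = hd p # inner p @ [last p]" using path_ends length_path assms(1) by metis
  obtain c where c: "{ed \<in> E. last p \<in> ed} = {c}" using assms(2) card_1_singletonE by blast
  have "set (path_edges p) \<subseteq> E" "distinct (path_edges p)" using assms(1) by (auto simp: rpath_def)
  show False
  proof (cases "inner p")
    case Nil
    with p eq have "path_edges p = [{last p, last p}]" by (metis append_Nil path_edges_simps(2,3))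
    then show False using \<open>set (path_edges p) \<subseteq> E\<close> edge by fastforce
  next
    case (Cons a as)
    have "path_edges (hd p # inner p @ [last p])
        = {hd p, a} # path_edges (a # as) @ [{last (a # as), last p}]"
      using Cons path_edges_append[of "a # as" "[last p]"] by simp
    then have "path_edges p = {hd p, a} # path_edges (a # as) @ [{last (a # as), last p}]"
      using p by metis
    moreover from this have "{hd p, a} \<in> {ed \<in> E. last p \<in> ed}"
      "{last (a # as), last p} \<in> {ed \<in> E. last p \<in> ed}"
      using \<open>set (path_edges p) \<subseteq> E\<close> eq by auto
    then have "{hd p, a} = {last (a # as), last p}" unfolding c by blast
    ultimately show False using \<open>distinct (path_edges p)\<close> by auto
  qed
qed

text \<open>Membership in \<open>q\<close> is passed on from one edge of \<open>p\<close> to the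
  next: an edge of \<open>q\<close> at an inner vertex of \<open>p\<close> makes this vertex inner
  to \<open>q\<close> as well, so both its edges lie on \<open>q\<close>.\<close>

lemma shared_edge:
  assumes "rpath E S p" "rpath E S q" "ed \<in> set (path_edges p)" "ed \<in> set (path_edges q)"
  shows "set (path_edges p) \<subseteq> set (path_edges q)"
proof -
  have "successively (\<lambda>a b. a \<in> set (path_edges q) \<longleftrightarrow> b \<in> set (path_edges q)) (path_edges p)"
  proof (rule successively_path_edges)
    show "set (path_edges p) \<subseteq> E" using assms(1) by (simp add: rpath_def)
    show "e \<in> set (path_edges q) \<longleftrightarrow> f \<in> set (path_edges q)"
      if "v \<in> set (inner p)" "e \<in> E" "f \<in> E" "v \<in> e" "v \<in> f" for v e f
    proof -
      have "v \<notin> S" using that(1) inner_subset[OF assms(1)] by blast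
      with that show ?thesis
        using edges_at_inner[OF assms(2)] path_edge_inner[OF assms(2)] by blast
    qed
  qed
  then show ?thesis using successively_iff_all[of "\<lambda>e. e \<in> set (path_edges q)"] assms(3,4) by blast
qed

text \<open>Every regular path occurs in the decomposition as an edge set, so \<open>P\<close>
  misses no topological edge.\<close>

lemma path_unique:
  assumes "rpath E S q"
  obtains e p where "P e = Some p" "set (path_edges p) = set (path_edges q)"
proof -
  have "path_edges q \<noteq> []" using path_edges_nonempty length_path assms by blast
  then obtain ed where ed: "ed \<in> set (path_edges q)" by (meson last_in_set)
  then obtain e p where "P e = Some p" "ed \<in> set (path_edges p)"
    using cover assms by (meson rpath_def subsetD)
  then show ?thesis using that shared_edge assms path ed by (metis subset_antisym)
qed

lemma path_edges_inj:
  assumes "P e = Some p" "P f = Some q" "set (path_edges p) = set (path_edges q)"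
  shows "e = f"
proof (rule ccontr)
  assume "e \<noteq> f"
  then have "set (path_edges p) = {}" using disjoint[OF assms(1,2)] assms(3) by simp
  then show False using path_edges_nonempty length_path path[OF assms(1)] by force
qed

text \<open>Lets later arguments choose the direction of a ghost list, which the memory does not
  record.\<close>

lemma flip:
  assumes "P e = Some p"
  shows "decomposition V E S (P(e \<mapsto> rev p))"
proof
  show "finite V" "S \<subseteq> V" "finite (dom (P(e \<mapsto> rev p)))"
    using finite_V S_subset finite_dom by auto
  show "card {ed \<in> E. v \<in> ed} = 2" if "v \<in> V - S" for v using two_edges that .
  show "\<exists>u v. ed = {u, v} \<and> u \<noteq> v \<and> u \<in> V \<and> v \<in> V" if "ed \<in> E" for ed using edge that .
  show "rpath E S q" if "(P(e \<mapsto> rev p)) f = Some q" for f q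
    using path that assms by (auto split: if_splits)
  show "set (path_edges q) \<inter> set (path_edges r) = {}"
    if "(P(e \<mapsto> rev p)) f = Some q" "(P(e \<mapsto> rev p)) g = Some r" "f \<noteq> g" for f g q r
  proof -
    have "\<exists>q'. P f = Some q' \<and> set (path_edges q) = set (path_edges q')"
      "\<exists>r'. P g = Some r' \<and> set (path_edges r) = set (path_edges r')"
      using that assms by (auto split: if_splits)
    then show ?thesis using disjoint that(3) by metis
  qed
  show "\<exists>f q. (P(e \<mapsto> rev p)) f = Some q \<and> ed \<in> set (path_edges q)" if ed: "ed \<in> E" for ed
  proof -
    obtain f q where "P f = Some q" "ed \<in> set (path_edges q)" using cover[OF ed] by blast
    then show ?thesis using assms by (cases "f = e") (auto intro!: exI[of _ f])
  qed
qed

text \<open>\<open>E\<close> stays the same, so \<open>x\<close> joins \<open>S\<close> while it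
  still has degree two; the new edge at \<open>x\<close> is added only afterwards.\<close>

lemma split_at:
  assumes "P e = Some (a @ x # b)" "a \<noteq> []" "b \<noteq> []" "e' \<notin> dom P"
  shows "decomposition V E (insert x S) (P(e \<mapsto> a @ [x], e' \<mapsto> x # b))"
proof
  have r: "rpath E S (a @ x # b)" using path assms by blast
  have i: "inner (a @ x # b) = inner (a @ [x]) @ x # inner (x # b)"
    using assms(2,3) by (cases a) (auto simp: inner_def butlast_append)
  have pe: "path_edges (a @ x # b) = path_edges (a @ [x]) @ path_edges (x # b)"
    using path_edges_append[of a "[x]"] path_edges_append[of a "x # b"] assms(2) by simp
  have xV: "x \<in> V - S" using inner_subset[OF r] i by auto
  let ?P = "P(e \<mapsto> a @ [x], e' \<mapsto> x # b)"
  show "finite V" "insert x S \<subseteq> V" "finite (dom ?P)"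
    using finite_V S_subset finite_dom xV by auto
  show "card {ed \<in> E. v \<in> ed} = 2" if "v \<in> V - insert x S" for v using two_edges that by blast
  show "\<exists>u v. ed = {u, v} \<and> u \<noteq> v \<and> u \<in> V \<and> v \<in> V" if "ed \<in> E" for ed using edge that .
  have ne: "e \<noteq> e'" using assms by auto
  have old: "P e' = None" using assms by auto
  have r1: "rpath E (insert x S) (a @ [x])"
    using r assms(2,3) pe i by (cases a) (auto simp: rpath_def)
  have r2: "rpath E (insert x S) (x # b)"
    using r assms(2,3) pe i by (cases b) (auto simp: rpath_def)
  show "rpath E (insert x S) q" if "?P f = Some q" for f q
  proof (cases "f = e \<or> f = e'")
    case True
    then show ?thesis using r1 r2 that ne by auto
  next
    case False
    then have q: "P f = Some q" using that by auto
    have "x \<notin> set (inner q)" using inner_unique[OF assms(1) q, of x] i False by auto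
    then show ?thesis using path[OF q] by (auto simp: rpath_def)
  qed
  show "set (path_edges q) \<inter> set (path_edges s) = {}"
    if "?P f = Some q" "?P g = Some s" "f \<noteq> g" for f g q s
  proof -
    have d: "distinct (path_edges (a @ [x]) @ path_edges (x # b))" using r pe by (simp add:
        rpath_def)
    have d': "P h = Some t \<Longrightarrow> h \<noteq> e \<Longrightarrow>
      set (path_edges t) \<inter> (set (path_edges (a @ [x])) \<union> set (path_edges (x # b))) = {}" for h t
      using disjoint[OF _ assms(1)] pe by (metis set_append)
    consider "f = e \<or> f = e'" "g = e \<or> g = e'" | "f = e \<or> f = e'" "g \<noteq> e" "g \<noteq> e'"
      | "f \<noteq> e" "f \<noteq> e'" "g = e \<or> g = e'" | "f \<noteq> e" "f \<noteq> e'" "g \<noteq> e" "g \<noteq> e'" by blast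
    then show ?thesis
    proof cases
      case 1
      then show ?thesis using that d ne by auto
    next
      case 2
      then show ?thesis using that d'[of g s] ne by auto
    next
      case 3
      then show ?thesis using that d'[of f q] ne by auto
    next
      case 4
      then show ?thesis using that disjoint[of f q g s] by auto
    qed
  qed
  show "\<exists>f q. ?P f = Some q \<and> ed \<in> set (path_edges q)" if ed: "ed \<in> E" for ed
  proof -
    obtain f q where f: "P f = Some q" "ed \<in> set (path_edges q)" using cover[OF ed] by blast
    show ?thesis
    proof (cases "f = e")
      case True
      then have "ed \<in> set (path_edges (a @ [x])) \<union> set (path_edges (x # b))"
        using f assms(1) pe by (metis option.inject set_append)
      then show ?thesis using ne by auto
    next
      case False
      then show ?thesis using f old by (intro exI[of _ f]) auto
    qed
  qed
qed

end

section \<open>Decompositions under edge insertion\<close>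

lemma card_edges_insert:
  assumes "finite E" "{x, y} \<notin> E"
  shows "card {ed \<in> insert {x, y} E. v \<in> ed} = card {ed \<in> E. v \<in> ed} + (if v = x \<or> v = y then 1
      else 0)"
proof -
  have "{ed \<in> insert {x, y} E. v \<in> ed}
      = (if v = x \<or> v = y then insert {x, y} {ed \<in> E. v \<in> ed} else {ed \<in> E. v \<in> ed})" by auto
  then show ?thesis using assms by simp
qed

context decomposition
begin

lemma rpath_insert_edge: "rpath E S p \<Longrightarrow> rpath (insert ed E) S p"
  by (auto simp: rpath_def)

lemma add_path:
  assumes "x \<in> S" "y \<in> S" "x \<noteq> y" "{x, y} \<notin> E" "e \<notin> dom P"
  shows "decomposition V (insert {x, y} E) S (P(e \<mapsto> [x, y]))"
proof
  have old: "P e = None" using assms by auto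
  show "finite V" "S \<subseteq> V" "finite (dom (P(e \<mapsto> [x, y])))"
    using finite_V S_subset finite_dom by auto
  show "\<exists>u v. ed = {u, v} \<and> u \<noteq> v \<and> u \<in> V \<and> v \<in> V" if "ed \<in> insert {x, y} E" for ed
    using edge that assms S_subset by blast
  show "card {ed \<in> insert {x, y} E. v \<in> ed} = 2" if "v \<in> V - S" for v
    using two_edges[OF that] card_edges_insert[OF finite_E assms(4)] that assms by auto
  show "rpath (insert {x, y} E) S q" if "(P(e \<mapsto> [x, y])) f = Some q" for f q
    using that path assms by (cases "f = e") (auto intro: rpath_insert_edge simp: rpath_def)
  show "set (path_edges q) \<inter> set (path_edges r) = {}"
    if "(P(e \<mapsto> [x, y])) f = Some q" "(P(e \<mapsto> [x, y])) g = Some r" "f \<noteq> g" for f g q r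
  proof -
    have "{x, y} \<notin> set (path_edges t)" if "P h = Some t" for h t
      using path[OF that] assms(4) by (auto simp: rpath_def)
    then show ?thesis using that disjoint by (auto split: if_splits)
  qed
  show "\<exists>f q. (P(e \<mapsto> [x, y])) f = Some q \<and> ed \<in> set (path_edges q)" if "ed \<in> insert {x, y} E" for ed
  proof (cases "ed = {x, y}")
    case True
    then show ?thesis by (intro exI[of _ e]) auto
  next
    case False
    then obtain f q where "P f = Some q" "ed \<in> set (path_edges q)" using cover \<open>ed \<in> insert {x, y}
        E\<close> by blast
    then show ?thesis using old by (intro exI[of _ f]) auto
  qed
qed

text \<open>
  The path at \<open>x\<close> is continued by the edge \<open>{x, y}\<close> and a list \<open>q\<close> that starts with \<open>y\<close>: either
  \<open>[y]\<close> alone or another path, whose identifier is in \<open>F\<close>, traversed from its end \<open>y\<close>.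
\<close>

definition continuation :: "nat set \<Rightarrow> 'v \<Rightarrow> 'v list \<Rightarrow> bool" where
  "continuation F y q \<longleftrightarrow> F = {} \<and> q = [y] \<and> card {ed \<in> E. y \<in> ed} \<noteq> 1 \<and> y \<in> S \<or>
     (\<exists>f. F = {f} \<and> P f = Some q \<and> hd q = y \<and> card {ed \<in> E. y \<in> ed} = 1)"

text \<open>The single edge at \<open>x\<close> lies on only one path by disjointness.\<close>

lemma end_unique:
  assumes "card {ed \<in> E. x \<in> ed} = 1" "P e = Some p" "P f = Some q"
    "x = hd p \<or> x = last p" "x = hd q \<or> x = last q"
  shows "e = f"
proof (rule ccontr)
  assume "e \<noteq> f"
  have at: "\<exists>ed \<in> set (path_edges r). x \<in> ed" if "P g = Some r" "x = hd r \<or> x = last r" for g r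
  proof -
    have "x \<in> set r" using that length_path[OF path[OF that(1)]] by (cases r) auto
    then show ?thesis using Union_path_edges[of r] length_path[OF path[OF that(1)]] by blast
  qed
  obtain c d where "c \<in> set (path_edges p)" "x \<in> c" "d \<in> set (path_edges q)" "x \<in> d"
    using at[OF assms(2,4)] at[OF assms(3,5)] by blast
  moreover from this have "c \<in> E" "d \<in> E" using path assms(2,3) by (auto simp: rpath_def)
  moreover obtain a where "{ed \<in> E. x \<in> ed} = {a}" using assms(1) card_1_singletonE by blast
  ultimately have "c \<in> {a}" "d \<in> {a}" by blast+
  then have "c = d" by simp
  then show False using disjoint[OF assms(2,3) \<open>e \<noteq> f\<close>] \<open>c \<in> set (path_edges p)\<close> \<open>d \<in> set
      (path_edges q)\<close> by blast
qed

text \<open>\<open>e \<notin> F\<close> says that the path is not joined to itself, which would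
  close a cycle of regular vertices. It makes the far end \<open>last q\<close> differ from all
  vertices that become inner, so that it remains in the new \<open>S\<close>.\<close>

lemma continuation_props:
  assumes "P e = Some p" "last p = x" "card {ed \<in> E. x \<in> ed} = 1" "x \<noteq> y" "{x, y} \<notin> E"
    "continuation F y q" "e \<notin> F"
  shows "q \<noteq> []" "hd q = y" "set (path_edges q) \<subseteq> E" "distinct (path_edges q)"
    "set (path_edges p) \<inter> set (path_edges q) = {}" "last q \<in> S - set (x # butlast q)"
    "distinct (inner p @ x # butlast q)" "set (butlast q) \<subseteq> V" "y \<in> S"
    "set (butlast q) \<inter> S = (if F = {} then {} else {y})"
    "F = {} \<Longrightarrow> q = [y]" "\<And>f. f \<in> F \<Longrightarrow> P f = Some q \<and> F = {f} \<and> q = y # inner q @ [last q]"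
    "F = {} \<longleftrightarrow> card {ed \<in> E. y \<in> ed} \<noteq> 1"
proof -
  have xS: "x \<in> S" using assms path by (auto simp: rpath_def)
  have "q \<noteq> [] \<and> hd q = y \<and> set (path_edges q) \<subseteq> E \<and> distinct (path_edges q) \<and>
    set (path_edges p) \<inter> set (path_edges q) = {} \<and> last q \<in> S - set (x # butlast q) \<and>
    distinct (inner p @ x # butlast q) \<and> set (butlast q) \<subseteq> V \<and> y \<in> S \<and>
    set (butlast q) \<inter> S = (if F = {} then {} else {y}) \<and> (F = {} \<longrightarrow> q = [y]) \<and>
    (\<forall>f. f \<in> F \<longrightarrow> P f = Some q \<and> F = {f} \<and> q = y # inner q @ [last q]) \<and>
    (F = {} \<longleftrightarrow> card {ed \<in> E. y \<in> ed} \<noteq> 1)"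
    using assms(6) unfolding continuation_def
  proof (elim disjE exE conjE)
    assume "F = {}" "q = [y]" "y \<in> S" "card {ed \<in> E. y \<in> ed} \<noteq> 1"
    then show ?thesis using assms path[OF assms(1)] xS by (auto simp: rpath_def)
  next
    fix f assume f: "F = {f}" "P f = Some q" "hd q = y" "card {ed \<in> E. y \<in> ed} = 1"
    have r: "rpath E S p" "rpath E S q" using path assms(1) f(2) by auto
    have ef: "e \<noteq> f" using assms(7) f(1) by auto
    have q: "q = y # inner q @ [last q]" using path_ends length_path r(2) f(3) by metis
    have bq: "butlast q = y # inner q" using arg_cong[OF q, of butlast] by simp
    \<comment> \<open>\<open>ends_distinct\<close> speaks about a list that ends in the vertex of
      degree one, whereas \<open>q\<close> starts there.\<close>
    have "last (rev q) \<noteq> hd (rev q)"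
      using ends_distinct[of "rev q"] r(2) f(3,4) q by (metis last_rev rpath_rev)
    then have "last q \<noteq> y" using f(3) q by (metis hd_rev last_rev)
    moreover have "last q \<noteq> x" using end_unique[OF assms(3,1) f(2)] assms(2) ef by metis
    moreover have "set (inner p) \<inter> set (inner q) = {}" using inner_unique assms(1) f(2) ef by blast
    moreover have "y \<notin> set (inner p)" "y \<in> S" using r f(3) by (auto simp: rpath_def)
    moreover have "set (path_edges p) \<inter> set (path_edges q) = {}" using disjoint assms(1) f(2) ef
        by blast
    ultimately show ?thesis
      using r f assms xS q inner_subset[OF r(2)] S_subset by (auto simp: rpath_def bq)
  qed
  then show "q \<noteq> []" "hd q = y" "set (path_edges q) \<subseteq> E" "distinct (path_edges q)"
    "set (path_edges p) \<inter> set (path_edges q) = {}" "last q \<in> S - set (x # butlast q)"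
    "distinct (inner p @ x # butlast q)" "set (butlast q) \<subseteq> V" "y \<in> S"
    "set (butlast q) \<inter> S = (if F = {} then {} else {y})"
    "F = {} \<Longrightarrow> q = [y]" "\<And>f. f \<in> F \<Longrightarrow> P f = Some q \<and> F = {f} \<and> q = y # inner q @ [last q]"
    "F = {} \<longleftrightarrow> card {ed \<in> E. y \<in> ed} \<noteq> 1"
    by blast+
qed

text \<open>Covers extensions and merges alike. The vertices that leave \<open>S\<close> had degree
  one, and the new edge gives each of them degree two.\<close>

lemma join:
  assumes "P e = Some p" "last p = x" "card {ed \<in> E. x \<in> ed} = 1" "x \<noteq> y" "{x, y} \<notin> E"
    "continuation F y q" "e \<notin> F"
  shows "decomposition V (insert {x, y} E) (S - set (x # butlast q)) ((P |` (- F))(e \<mapsto> p @ q))"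
proof
  note c = continuation_props[OF assms]
  let ?S = "S - set (x # butlast q)" and ?E = "insert {x, y} E" and ?P = "(P |` (- F))(e \<mapsto> p @ q)"
  have rp: "rpath E S p" using path assms(1) .
  have xS: "x \<in> S" using rp assms(2) by (auto simp: rpath_def)
  have p2: "2 \<le> length p" using length_path rp .
  have S': "?S = S - (if F = {} then {x} else {x, y})"
  proof -
    have "?S = S - {x} - (set (butlast q) \<inter> S)" by auto
    also have "\<dots> = S - (if F = {} then {x} else {x, y})" unfolding c(10) by auto
    finally show ?thesis .
  qed
  have pe: "path_edges (p @ q) = path_edges p @ {x, y} # path_edges q"
    using path_edges_append[of p q] c(1,2) assms(2) p2 by fastforce
  have ip: "inner (p @ q) = inner p @ x # butlast q" using inner_append[OF p2 c(1)] assms(2) by simp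
  show "finite V" "?S \<subseteq> V" "finite (dom ?P)"
    using finite_V S_subset finite_dom by auto
  show "\<exists>u v. ed = {u, v} \<and> u \<noteq> v \<and> u \<in> V \<and> v \<in> V" if "ed \<in> ?E" for ed
    using edge[of ed] that assms(4) S_subset xS c(9) by blast
  show "card {ed \<in> ?E. v \<in> ed} = 2" if v: "v \<in> V - ?S" for v
  proof (cases "v \<in> S")
    case True
    then have "v = x \<or> F \<noteq> {} \<and> v = y" using v S' by (auto split: if_splits)
    then have "card {ed \<in> E. v \<in> ed} = 1" using assms(3) c(13) by auto
    then show ?thesis using card_edges_insert[OF finite_E assms(5)] \<open>v = x \<or> _\<close> by auto
  next
    case False
    then have "v \<noteq> x" "v \<noteq> y" using xS c(9) by auto
    then show ?thesis using card_edges_insert[OF finite_E assms(5)] two_edges[of v] v False by auto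
  qed
  have pE: "set (path_edges p) \<subseteq> E" "distinct (path_edges p)" "hd p \<in> S" "set (inner p) \<inter> S = {}"
    using rp by (auto simp: rpath_def)
  have "hd p \<noteq> x" using ends_distinct[OF rp] assms(2,3) by simp
  \<comment> \<open>If \<open>p\<close> started in \<open>y\<close>, then \<open>p\<close> and
    \<open>q\<close> would share an end of degree one and hence be the same path.\<close>
  moreover have "hd p \<noteq> y" if F: "F \<noteq> {}"
  proof -
    obtain f where f: "f \<in> F" using F by blast
    have qf: "P f = Some q" using c(12)[OF f] by blast
    have "card {ed \<in> E. y \<in> ed} = 1" using c(13) F by blast
    from end_unique[OF this assms(1) qf] show ?thesis using c(2) assms(7) f by metis
  qed
  ultimately have hd: "hd p \<in> ?S" using S' pE(3) by auto
  have new: "rpath ?E ?S (p @ q)"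
    unfolding rpath_def pe ip
    using c(1,3-7,10) p2 pE assms(5) hd by (auto simp: hd_append)
  have other: "rpath ?E ?S r" if r: "P g = Some r" "g \<noteq> e" "g \<notin> F" for g r
  proof -
    have rr: "rpath E S r" using path r by blast
    have "hd r \<noteq> x" "last r \<noteq> x" using end_unique[OF assms(3,1) r(1)] assms(2) r(2) by auto
    moreover have "hd r \<noteq> y" "last r \<noteq> y" if F: "F \<noteq> {}"
    proof -
      obtain f where f: "f \<in> F" using F by blast
      have qf: "P f = Some q" using c(12)[OF f] by blast
      have "card {ed \<in> E. y \<in> ed} = 1" using c(13) F by blast
      from end_unique[OF this qf r(1)] show "hd r \<noteq> y" "last r \<noteq> y" using c(2) r(3) f by metis+
    qed
    ultimately show ?thesis using rr S' by (auto simp: rpath_def)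
  qed
  show "rpath ?E ?S r" if "?P g = Some r" for g r
    using that new other by (auto split: if_splits simp: restrict_map_def)
  have un: "set (path_edges r) \<inter> set (path_edges (p @ q)) = {}"
    if "P g = Some r" "g \<noteq> e" "g \<notin> F" for g r
  proof -
    have "{x, y} \<notin> set (path_edges r)" using path[OF that(1)] assms(5) by (auto simp: rpath_def)
    moreover have "set (path_edges r) \<inter> set (path_edges p) = {}" using disjoint that assms(1) by
        blast
    moreover have "set (path_edges r) \<inter> set (path_edges q) = {}"
    proof (cases "F = {}")
      case True
      then show ?thesis using c(11) by simp
    next
      case False
      then obtain f where "f \<in> F" by blast
      then show ?thesis using disjoint[OF that(1), of f q] c(12) that by blast
    qed
    ultimately show ?thesis by (auto simp: pe)
  qed
  show "set (path_edges r) \<inter> set (path_edges s) = {}"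
    if "?P g = Some r" "?P h = Some s" and gh: "g \<noteq> h" for g h r s
  proof -
    consider "g = e" "h \<noteq> e" | "g \<noteq> e" "h = e" | "g \<noteq> e" "h \<noteq> e" using gh by blast
    then show ?thesis
    proof cases
      case 1
      then show ?thesis using that un[of h s] by (auto simp: restrict_map_def split: if_splits)
    next
      case 2
      then show ?thesis using that un[of g r] by (auto simp: restrict_map_def split: if_splits)
    next
      case 3
      then show ?thesis using that disjoint[of g r h s] by (auto simp: restrict_map_def split:
          if_splits)
    qed
  qed
  show "\<exists>g r. ?P g = Some r \<and> ed \<in> set (path_edges r)" if ed: "ed \<in> ?E" for ed
  proof (cases "ed \<in> set (path_edges (p @ q))")
    case True
    then show ?thesis by (intro exI[of _ e]) auto
  next
    case False
    then have "ed \<in> E" using ed pe by auto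
    then obtain g r where g: "P g = Some r" "ed \<in> set (path_edges r)" using cover by blast
    have "g \<noteq> e" using g False assms(1) pe by auto
    moreover have "g \<notin> F" using g False c(12)[of g] pe by auto
    ultimately show ?thesis using g by (intro exI[of _ g]) auto
  qed
qed

end

section \<open>Topological edges\<close>

text \<open>The ends are stored in no particular order. \<open>tinc\<close> is constrained only at
  ends of degree one, where a single path ends; elsewhere it may be out of date.\<close>

definition tedges_ok ::
    "('v set \<Rightarrow> real) \<Rightarrow> ('v \<Rightarrow> nat) \<Rightarrow> (nat \<Rightarrow> 'v list option) \<Rightarrow> (nat \<Rightarrow> ('v \<times> 'v \<times> real) option) \<Rightarrow>
     ('v \<Rightarrow> nat) \<Rightarrow> nat \<Rightarrow> bool" where
  "tedges_ok wt dg P te ti nid \<longleftrightarrow>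
     dom te = dom P \<and> (\<forall>e \<in> dom P. e < nid) \<and>
     (\<forall>e p. P e = Some p \<longrightarrow>
        (te e = Some (hd p, last p, sum_list (map wt (path_edges p))) \<or>
         te e = Some (last p, hd p, sum_list (map wt (path_edges p)))) \<and>
        (dg (hd p) = 1 \<longrightarrow> ti (hd p) = e) \<and> (dg (last p) = 1 \<longrightarrow> ti (last p) = e))"

lemma tedges_okD:
  assumes "tedges_ok wt dg P te ti nid" "P e = Some p"
  shows "te e = Some (hd p, last p, sum_list (map wt (path_edges p))) \<or>
         te e = Some (last p, hd p, sum_list (map wt (path_edges p)))"
    "dg (hd p) = 1 \<Longrightarrow> ti (hd p) = e" "dg (last p) = 1 \<Longrightarrow> ti (last p) = e" "e < nid"
  using assms by (auto simp: tedges_ok_def)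

lemma tedges_ok_flip:
  assumes "tedges_ok wt dg P te ti nid" "P e = Some p" "p \<noteq> []"
  shows "tedges_ok wt dg (P(e \<mapsto> rev p)) te ti nid"
proof -
  have "dom (P(e \<mapsto> rev p)) = dom P" using assms(2) by auto
  moreover have "sum_list (map wt (path_edges (rev p))) = sum_list (map wt (path_edges p))"
    by (simp add: rev_map[symmetric] sum_list_rev)
  ultimately show ?thesis
    using assms by (auto simp: tedges_ok_def hd_rev last_rev)
qed

lemma (in decomposition) regular_path_iff:
  assumes "V = verts G" "E = edges G" "S = {v. singular G v}"
  shows "regular_path G p \<longleftrightarrow> rpath E S p"
proof
  assume "regular_path G p"
  then show "rpath E S p"
    by (auto simp: regular_path_def rpath_def assms inner_def regular_def singular_def)
next
  assume r: "rpath E S p"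
  have "set (inner p) \<subseteq> V - S" using inner_subset[OF r] .
  then show "regular_path G p"
    using r by (auto simp: regular_path_def rpath_def assms inner_def regular_def singular_def)
qed

text \<open>The bijection sends an identifier to the edge set of its path: injective because paths
  are nonempty and disjoint, surjective by \<open>path_unique\<close>.\<close>

lemma (in decomposition) same_multigraph:
  assumes "V = verts G" "E = edges G" "S = {v. singular G v}" "S = {v. sing m v}"
    and te: "tedges_ok (weight G) dg P (tedge m) ti nid"
  shows "same_multigraph (stored_simplification m) (simplification G)"
proof -
  define f where "f e = set (path_edges (the (P e)))" for e
  have dom: "dom (tedge m) = dom P" using te by (simp add: tedges_ok_def)
  have "bij_betw f (dom P) {set (path_edges p) | p. regular_path G p}"
    unfolding bij_betw_def
  proof
    show "inj_on f (dom P)" using path_edges_inj by (auto simp: inj_on_def f_def)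
    show "f ` dom P = {set (path_edges p) | p. regular_path G p}"
    proof (intro equalityI subsetI)
      fix T assume "T \<in> f ` dom P"
      then obtain e p where "P e = Some p" "T = set (path_edges p)" by (auto simp: f_def)
      then show "T \<in> {set (path_edges p) | p. regular_path G p}"
        using path regular_path_iff[OF assms(1-3)] by blast
    next
      fix T assume "T \<in> {set (path_edges p) | p. regular_path G p}"
      then obtain q where q: "rpath E S q" "T = set (path_edges q)"
        using regular_path_iff[OF assms(1-3)] by blast
      obtain e p where "P e = Some p" "set (path_edges p) = set (path_edges q)"
        using path_unique[OF q(1)] .
      then show "T \<in> f ` dom P" using q(2) by (intro image_eqI[of _ _ e]) (simp_all add: f_def domI)
    qed
  qed
  moreover have "mends (simplification G) (f e) = mends (stored_simplification m) e \<and>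
      mweight (simplification G) (f e) = mweight (stored_simplification m) e" if e: "e \<in> dom P"
          for e
  proof -
    obtain p where p: "P e = Some p" using e by blast
    have r: "rpath E S p" using path[OF p] .
    have "\<Union> (f e) = set p" using Union_path_edges[of p] r p by (simp add: f_def rpath_def)
    moreover have "{v \<in> set p. v \<in> S} = {hd p, last p}" using r set_path[of p] by (auto simp:
        rpath_def)
    ultimately have "{v \<in> \<Union> (f e). singular G v} = {hd p, last p}" using assms(3) by auto
    moreover have "(\<Sum>ed\<in>f e. weight G ed) = sum_list (map (weight G) (path_edges p))"
      using r p by (simp add: f_def rpath_def sum_list_distinct_conv_sum_set)
    ultimately show ?thesis
      using tedges_okD(1)[OF te p] by (auto simp: simplification_def stored_simplification_def)
  qed
  moreover have "mverts (stored_simplification m) = mverts (simplification G)"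
    "medges (stored_simplification m) = dom P"
    "medges (simplification G) = {set (path_edges p) | p. regular_path G p}"
    using assms(3,4) dom by (simp_all add: simplification_def stored_simplification_def)
  ultimately show ?thesis
    unfolding same_multigraph_def by (intro conjI exI[of _ f]) auto
qed

section \<open>Adjacency lists\<close>

text \<open>A bijection, so that the first \<open>dg v\<close> slots contain no repetition and
  \<open>dg v\<close> is the degree; later slots are unconstrained.\<close>

definition adj_ok ::
    "'v set set \<Rightarrow> ('v set \<Rightarrow> real) \<Rightarrow> ('v \<Rightarrow> nat) \<Rightarrow> ('v \<Rightarrow> nat \<Rightarrow> 'v \<times> real) \<Rightarrow> bool" where
  "adj_ok E wt dg ad \<longleftrightarrow>
     (\<forall>v. bij_betw (\<lambda>i. fst (ad v i)) {..<dg v} {u. {v, u} \<in> E} \<and>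
          (\<forall>i<dg v. snd (ad v i) = wt {v, fst (ad v i)}))"

lemma (in decomposition) adj_ok_degree:
  assumes "adj_ok E wt dg ad"
  shows "card {ed \<in> E. v \<in> ed} = dg v"
proof -
  have "bij_betw (\<lambda>u. {v, u}) {u. {v, u} \<in> E} {ed \<in> E. v \<in> ed}"
    unfolding bij_betw_def
  proof
    show "inj_on (\<lambda>u. {v, u}) {u. {v, u} \<in> E}" by (auto simp: inj_on_def doubleton_eq_iff)
    show "(\<lambda>u. {v, u}) ` {u. {v, u} \<in> E} = {ed \<in> E. v \<in> ed}"
    proof (intro equalityI subsetI)
      fix ed assume "ed \<in> {ed \<in> E. v \<in> ed}"
      then obtain u where "ed = {v, u}" "ed \<in> E" using edge[of ed] by (smt (verit) insert_commute
          insertE mem_Collect_eq singletonD)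
      then show "ed \<in> (\<lambda>u. {v, u}) ` {u. {v, u} \<in> E}" by blast
    qed auto
  qed
  then have "card {ed \<in> E. v \<in> ed} = card {u. {v, u} \<in> E}" by (rule bij_betw_same_card[symmetric])
  also have "\<dots> = dg v" using assms[unfolded adj_ok_def, rule_format, of v] bij_betw_same_card by
      fastforce
  finally show ?thesis .
qed

lemma adj_ok_insert:
  assumes "adj_ok E wt dg ad" "x \<noteq> y" "{x, y} \<notin> E"
  shows "adj_ok (insert {x, y} E) (wt({x, y} := w)) (dg(x := dg x + 1, y := dg y + 1))
    (ad(x := (ad x)(dg x := (y, w)), y := (ad y)(dg y := (x, w))))"
proof -
  let ?ad = "ad(x := (ad x)(dg x := (y, w)), y := (ad y)(dg y := (x, w)))"
  have new: "bij_betw (\<lambda>i. fst (((ad a)(dg a := (b, w))) i)) {..<Suc (dg a)} {u. {a, u} \<in> insert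
      {x, y} E} \<and>
     (\<forall>i<Suc (dg a). snd (((ad a)(dg a := (b, w))) i) = (wt({x, y} := w)) {a, fst (((ad a)(dg a :=
         (b, w))) i)})"
    if ab: "{a, b} = {x, y}" "a \<noteq> b" for a b
  proof
    have o: "bij_betw (\<lambda>i. fst (ad a i)) {..<dg a} {u. {a, u} \<in> E}"
      "\<forall>i<dg a. snd (ad a i) = wt {a, fst (ad a i)}"
      using assms(1) by (auto simp: adj_ok_def)
    have s: "{u. {a, u} \<in> insert {x, y} E} = {u. {a, u} \<in> E} \<union> {b}" "b \<notin> {u. {a, u} \<in> E}"
      using ab assms(3) by (auto simp: doubleton_eq_iff insert_commute)
    have "bij_betw (\<lambda>i. fst (((ad a)(dg a := (b, w))) i)) {..<dg a} {u. {a, u} \<in> E}"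
      using o(1) by (subst bij_betw_cong[where g = "\<lambda>i. fst (ad a i)"]) auto
    then have "bij_betw (\<lambda>i. fst (((ad a)(dg a := (b, w))) i)) ({..<dg a} \<union> {dg a}) ({u. {a, u} \<in>
        E} \<union> {b})"
      using notIn_Un_bij_betw[of "dg a" "{..<dg a}" "\<lambda>i. fst (((ad a)(dg a := (b, w))) i)"] s(2)
      by simp
    then show "bij_betw (\<lambda>i. fst (((ad a)(dg a := (b, w))) i)) {..<Suc (dg a)} {u. {a, u} \<in> insert
        {x, y} E}"
      unfolding s(1) by (simp add: lessThan_Suc insert_is_Un[symmetric])
    have "{a, fst (ad a i)} \<noteq> {x, y}" if "i < dg a" for i
    proof -
      have "{a, fst (ad a i)} \<in> E" using bij_betwE[OF o(1)] that by simp
      with assms(3) show ?thesis by metis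
    qed
    then show "\<forall>i<Suc (dg a). snd (((ad a)(dg a := (b, w))) i) =
        (wt({x, y} := w)) {a, fst (((ad a)(dg a := (b, w))) i)}"
      using o(2) ab(1) by (auto simp: less_Suc_eq)
  qed
  have old: "{u. {v, u} \<in> insert {x, y} E} = {u. {v, u} \<in> E}" if "v \<noteq> x" "v \<noteq> y" for v
    using that by (auto simp: doubleton_eq_iff)
  show ?thesis
    unfolding adj_ok_def
  proof (rule allI)
    fix v
    consider "v = x" | "v = y" | "v \<noteq> x" "v \<noteq> y" by blast
    then show "bij_betw (\<lambda>i. fst (?ad v i)) {..<(dg(x := dg x + 1, y := dg y + 1)) v} {u. {v, u} \<in>
        insert {x, y} E} \<and>
       (\<forall>i<(dg(x := dg x + 1, y := dg y + 1)) v. snd (?ad v i) = (wt({x, y} := w)) {v, fst (?ad v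
           i)})"
    proof cases
      case 1
      have "?ad x = (ad x)(dg x := (y, w))" "(dg(x := dg x + 1, y := dg y + 1)) x = Suc (dg x)"
        using assms(2) by auto
      then show ?thesis using new[of x y] assms(2) unfolding 1 by (simp only:) blast
    next
      case 2
      have "?ad y = (ad y)(dg y := (x, w))" "(dg(x := dg x + 1, y := dg y + 1)) y = Suc (dg y)"
        using assms(2) by auto
      then show ?thesis using new[OF insert_commute assms(2)[symmetric]] unfolding 2 by (simp
          only:) blast
    next
      case 3
      have "{v, u} \<noteq> {x, y}" for u using 3 by (auto simp: doubleton_eq_iff)
      then show ?thesis using 3 assms(1) old[OF 3] by (auto simp: adj_ok_def)
    qed
  qed
qed

text \<open>The order of the two slots is unknown. \<open>a \<noteq> c\<close> is what lets
  \<open>link\<close> recognise the slot of \<open>a\<close>.\<close>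

definition nbrs :: "('v \<Rightarrow> nat \<Rightarrow> 'v \<times> real) \<Rightarrow> ('v set \<Rightarrow> real) \<Rightarrow> 'v \<Rightarrow> 'v \<Rightarrow> 'v \<Rightarrow> bool" where
  "nbrs ad wt b a c \<longleftrightarrow> a \<noteq> c \<and>
     (ad b 0 = (a, wt {a, b}) \<and> ad b 1 = (c, wt {b, c}) \<or> ad b 0 = (c, wt {b, c}) \<and> ad b 1 = (a,
         wt {a, b}))"

lemma nbrs_sym: "nbrs ad wt b a c \<Longrightarrow> nbrs ad wt b c a"
  by (auto simp: nbrs_def insert_commute)

definition linked :: "('v \<Rightarrow> nat \<Rightarrow> 'v \<times> real) \<Rightarrow> ('v set \<Rightarrow> real) \<Rightarrow> 'v list \<Rightarrow> bool" where
  "linked ad wt p \<longleftrightarrow> (\<forall>xs a v b ys. p = xs @ a # v # b # ys \<longrightarrow> nbrs ad wt v a b)"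

lemma linked_append: "linked ad wt (xs @ p) \<Longrightarrow> linked ad wt p"
  unfolding linked_def by (metis append_assoc)

lemma linked_Cons: "linked ad wt (x # p) \<Longrightarrow> linked ad wt p"
  using linked_append[of ad wt "[x]" p] by simp

lemma linkedD: "linked ad wt (a # v # b # ys) \<Longrightarrow> nbrs ad wt v a b"
  unfolding linked_def by (metis append_Nil)

text \<open>Inner vertices have degree two, so their two neighbours on the list fill slots 0 and 1.
  This is what \<open>walk\<close> needs in order to follow the path.\<close>

lemma (in decomposition) linked_path:
  assumes "adj_ok E wt dg ad" "rpath E S p"
  shows "linked ad wt p"
  unfolding linked_def
proof (intro allI impI)
  fix xs a v b ys assume p: "p = xs @ a # v # b # ys"
  have "v \<in> set (inner p)" unfolding p inner_def by (cases xs) (auto simp: butlast_append)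
  then have v: "v \<in> V - S" using inner_subset assms(2) by blast
  have d: "dg v = 2" using two_edges[OF v] adj_ok_degree[OF assms(1)] by simp
  have "{a, v} \<in> E" "{v, b} \<in> E" "{a, v} \<noteq> {v, b}"
    using assms(2) by (auto simp: rpath_def p path_edges_mid)
  then have ab: "a \<noteq> b" "{v, a} \<in> E" "{v, b} \<in> E" by (auto simp: insert_commute)
  have bij: "bij_betw (\<lambda>i. fst (ad v i)) {..<2} {u. {v, u} \<in> E}"
    and w: "\<forall>i<2. snd (ad v i) = wt {v, fst (ad v i)}"
    using assms(1)[unfolded adj_ok_def, rule_format, of v] d by auto
  have "{..<2} = {0, 1 :: nat}" by auto
  then have im: "{fst (ad v 0), fst (ad v 1)} = {u. {v, u} \<in> E}"
    using bij by (auto simp: bij_betw_def)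
  then have "{a, b} \<subseteq> {fst (ad v 0), fst (ad v 1)}" using ab by auto
  then have "fst (ad v 0) = a \<and> fst (ad v 1) = b \<or> fst (ad v 0) = b \<and> fst (ad v 1) = a"
    using ab(1) by auto
  moreover have "snd (ad v 0) = wt {v, fst (ad v 0)}" "snd (ad v 1) = wt {v, fst (ad v 1)}"
    using w by auto
  ultimately show "nbrs ad wt v a b"
    unfolding nbrs_def using ab(1) by (metis insert_commute prod.collapse)
qed

lemma (in decomposition) single_neighbour:
  assumes "adj_ok E wt dg ad" "dg x = 1" "{x, u} \<in> E"
  shows "ad x 0 = (u, wt {x, u})"
proof -
  have "{..<1} = {0 :: nat}" by auto
  then have "{fst (ad x 0)} = {u. {x, u} \<in> E}" "snd (ad x 0) = wt {x, fst (ad x 0)}"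
    using assms(1,2) unfolding adj_ok_def bij_betw_def by (metis image_empty image_insert, simp)
  then show ?thesis using assms(3) by (metis mem_Collect_eq prod.collapse singletonD)
qed

section \<open>Renumbering\<close>

lemmas ram_simps = bind_ram_def return_def get_deg_def set_deg_def get_adj_def set_adj_def
  get_sing_def set_sing_def get_tedge_def set_tedge_def del_tedge_def new_tedge_def
  get_tinc_def set_tinc_def get_num_def set_num_def get_lam_def set_lam_def new_created_def
  dict_insert_def dict_delete_def

lemma link_exec:
  assumes "nbrs (adj m) wt b a c"
  shows "link b a m = ((wt {a, b}, c), m, 3)"
  using assms by (auto simp: link_def ram_simps nbrs_def)

text \<open>For both signs \<open>lm\<close> is an arc length that increases with the numbers, so
  one formula serves walks in either direction.\<close>

definition chain :: "('v \<Rightarrow> int) \<Rightarrow> ('v \<Rightarrow> real) \<Rightarrow> ('v set \<Rightarrow> real) \<Rightarrow> int \<Rightarrow> 'v list \<Rightarrow> bool" where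
  "chain nm lm wt \<sigma> vs \<longleftrightarrow>
     successively (\<lambda>a b. nm b = nm a + \<sigma> \<and> lm b = lm a + of_int \<sigma> * wt {a, b}) vs"

lemma chain_simps [simp]: "chain nm lm wt \<sigma> []" "chain nm lm wt \<sigma> [v]"
  "chain nm lm wt \<sigma> (a # b # vs) \<longleftrightarrow>
     nm b = nm a + \<sigma> \<and> lm b = lm a + of_int \<sigma> * wt {a, b} \<and> chain nm lm wt \<sigma> (b # vs)"
  by (auto simp: chain_def)

lemma chain_append:
  "chain nm lm wt \<sigma> (vs @ x # ws) \<longleftrightarrow> chain nm lm wt \<sigma> (vs @ [x]) \<and> chain nm lm wt \<sigma> (x # ws)"
  by (induction vs rule: induct_list012) (auto simp: chain_def successively_Cons)

lemma chain_cong: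
  assumes "\<And>v. v \<in> set vs \<Longrightarrow> nm v = nm' v" "\<And>v. v \<in> set vs \<Longrightarrow> lm v = lm' v"
    "\<And>ed. ed \<in> set (path_edges vs) \<Longrightarrow> wt ed = wt' ed"
  shows "chain nm lm wt \<sigma> vs \<longleftrightarrow> chain nm' lm' wt' \<sigma> vs"
  using assms by (induction vs rule: induct_list012) auto

lemma chain_rev: "chain nm lm wt (- \<sigma>) (rev vs) \<longleftrightarrow> chain nm lm wt \<sigma> vs"
  unfolding chain_def successively_rev by (intro successively_cong) (auto simp: insert_commute)

lemma chain_nth: "chain nm lm wt \<sigma> vs \<Longrightarrow> i < length vs \<Longrightarrow> nm (vs ! i) = nm (hd vs) + \<sigma> * int i"
proof (induction vs arbitrary: i rule: induct_list012)
  case (3 x y zs)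
  then show ?case by (cases i) (auto simp: algebra_simps)
qed auto

lemma chain_last: "chain nm lm wt \<sigma> vs \<Longrightarrow> vs \<noteq> [] \<Longrightarrow> nm (last vs) = nm (hd vs) + \<sigma> * int (length vs
    - 1)"
  using chain_nth[of nm lm wt \<sigma> vs "length vs - 1"] by (simp add: last_conv_nth)

lemma chain_lam:
  "chain nm lm wt \<sigma> vs \<Longrightarrow> vs \<noteq> [] \<Longrightarrow>
   lm (last vs) = lm (hd vs) + of_int \<sigma> * sum_list (map wt (path_edges vs))"
  by (induction vs rule: induct_list012) (auto simp: algebra_simps)

text \<open>\<open>z\<close> is the neighbour beyond the last renumbered vertex. Each step costs 7:
  two reads, two writes and 3 for \<open>link\<close>; the additional 1 is the final
  \<open>return\<close>.\<close>

lemma walk_exec: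
  assumes "linked (adj m) wt (p # cs @ [z])" "distinct (p # cs)"
  shows "\<exists>nm lm. walk (length cs) d p (hd (cs @ [z])) m
      = (last (p # cs), m\<lparr>num := nm, lam := lm\<rparr>, 7 * length cs + 1) \<and>
      (\<forall>v. v \<notin> set cs \<longrightarrow> nm v = num m v \<and> lm v = lam m v) \<and> chain nm lm wt d (p # cs)"
  using assms
proof (induction cs arbitrary: p m)
  case Nil
  show ?case by (intro exI[of _ "num m"] exI[of _ "lam m"]) (auto simp: ram_simps)
next
  case (Cons c cs)
  define m' where "m' = m\<lparr>num := (num m)(c := num m p + d), lam := (lam m)(c := lam m p + of_int d
      * wt {p, c})\<rparr>"
  have n: "nbrs (adj m) wt c p (hd (cs @ [z]))"
    using Cons.prems(1) linkedD[of "adj m" wt p c "hd (cs @ [z])" "tl (cs @ [z])"] by simp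
  have "linked (adj m') wt (c # cs @ [z])" "distinct (c # cs)"
    using Cons.prems linked_Cons by (auto simp: m'_def)
  from Cons.IH[OF this] obtain nm lm where IH:
    "walk (length cs) d c (hd (cs @ [z])) m' = (last (c # cs), m'\<lparr>num := nm, lam := lm\<rparr>, 7 *
        length cs + 1)"
    "\<forall>v. v \<notin> set cs \<longrightarrow> nm v = num m' v \<and> lm v = lam m' v" "chain nm lm wt d (c # cs)"
    by blast
  have "walk (length (c # cs)) d p (hd ((c # cs) @ [z])) m =
      (last (c # cs), m'\<lparr>num := nm, lam := lm\<rparr>, 7 * length (c # cs) + 1)"
    using IH(1) link_exec[OF n] by (simp add: ram_simps m'_def)
  moreover have "m'\<lparr>num := nm, lam := lm\<rparr> = m\<lparr>num := nm, lam := lm\<rparr>" by (simp add: m'_def)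
  moreover have "nm v = num m v \<and> lm v = lam m v" if "v \<notin> set (c # cs)" for v
    using IH(2) that by (auto simp: m'_def)
  moreover have "nm p = num m p" "lm p = lam m p" "nm c = num m p + d" "lm c = lam m p + of_int d
      * wt {p, c}"
    using IH(2) Cons.prems(2) by (auto simp: m'_def)
  ultimately show ?case using IH(3)
    by (intro exI[of _ nm] exI[of _ lm]) simp
qed

section \<open>Intervals of numbers\<close>

text \<open>
  The interval created as the \<open>j\<close>-th one stays within distance less than \<open>L\<close> of its centre
  \<open>2 j L\<close>. A path with an end of degree one can still grow there, upwards for \<open>\<sigma> = 1\<close> and
  downwards for \<open>\<sigma> = -1\<close>. The predicate says that from the outermost number \<open>k\<close> on all slots in
  this direction are free, and that \<open>k\<close> is still at distance less than \<open>C\<close> from the centre.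
\<close>

definition open_end ::
    "nat \<Rightarrow> nat \<Rightarrow> 'v set \<Rightarrow> ('v \<Rightarrow> int) \<Rightarrow> nat \<Rightarrow> int \<Rightarrow> int \<Rightarrow> bool" where
  "open_end L cr N nm C \<sigma> k \<longleftrightarrow>
     (\<exists>j \<in> {1..cr}. \<bar>k - 2 * int j * int L\<bar> < int L \<and>
        (\<forall>v \<in> N. \<sigma> * nm v \<le> \<sigma> * k \<or> \<sigma> * (2 * int j * int L) + int L \<le> \<sigma> * nm v) \<and>
        \<sigma> * (k - 2 * int j * int L) < int C)"

text \<open>
  A path of which both ends have degree one has never been split, and none of its vertices has
  been moved into it from a path with another end. Hence the vertices of degree at least two that
  are not on another path of this kind count the slots that have been used on one side of a centre
  as long as the path \<open>e\<close> can grow there.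
\<close>

definition free_inner :: "('v \<Rightarrow> nat) \<Rightarrow> (nat \<Rightarrow> 'v list option) \<Rightarrow> nat \<Rightarrow> 'v set" where
  "free_inner dg P e =
     \<Union> {set (inner q) | f q. f \<noteq> e \<and> P f = Some q \<and> dg (hd q) = 1 \<and> dg (last q) = 1}"

lemma free_inner_iff:
  "v \<in> free_inner dg P e \<longleftrightarrow>
     (\<exists>f q. f \<noteq> e \<and> P f = Some q \<and> dg (hd q) = 1 \<and> dg (last q) = 1 \<and> v \<in> set (inner q))"
  unfolding free_inner_def by blast

definition room :: "'v set \<Rightarrow> ('v \<Rightarrow> nat) \<Rightarrow> (nat \<Rightarrow> 'v list option) \<Rightarrow> nat \<Rightarrow> nat" where
  "room V dg P e = card ({v \<in> V. 2 \<le> dg v} - free_inner dg P e)"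

text \<open>
  A path with a single regular vertex has no direction of its own. If it can grow on one side only,
  the direction is determined by the number of the other end, as in \<^const>\<open>grow\<close>.
\<close>

definition oriented ::
    "nat \<Rightarrow> nat \<Rightarrow> 'v set \<Rightarrow> ('v \<Rightarrow> int) \<Rightarrow> ('v \<Rightarrow> real) \<Rightarrow> ('v set \<Rightarrow> real) \<Rightarrow> ('v \<Rightarrow> nat) \<Rightarrow> nat \<Rightarrow> int \<Rightarrow>
     'v list \<Rightarrow> bool" where
  "oriented L cr N nm lm wt dg C \<sigma> p \<longleftrightarrow>
     (\<sigma> = 1 \<or> \<sigma> = - 1) \<and> chain nm lm wt \<sigma> (inner p) \<and>
     (dg (last p) = 1 \<longrightarrow> open_end L cr N nm C \<sigma> (nm (last (inner p)))) \<and>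
     (dg (hd p) = 1 \<longrightarrow> open_end L cr N nm C (- \<sigma>) (nm (hd (inner p)))) \<and>
     (length (inner p) = 1 \<longrightarrow>
        (dg (last p) = 1 \<longrightarrow> (nm (hd p) = nm (hd (inner p)) + 1 \<longleftrightarrow> \<sigma> = - 1 \<and> dg (hd p) \<noteq> 1)) \<and>
        (dg (hd p) = 1 \<longrightarrow> (nm (last p) = nm (hd (inner p)) + 1 \<longleftrightarrow> \<sigma> = 1 \<and> dg (last p) \<noteq> 1)))"

text \<open>On a list with consecutive numbers the minimum sits at one of the two ends, whatever the
  direction.\<close>

definition low :: "('v \<Rightarrow> int) \<Rightarrow> 'v list \<Rightarrow> 'v" where
  "low nm vs = (if nm (hd vs) \<le> nm (last vs) then hd vs else last vs)"

text \<open>Injectivity is confined to the regular vertices, because a vertex that became singular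
  keeps a stale number. The upper bound includes stale numbers, so that the window around the next
  centre is free of them; \<open>grow\<close> may read the number of a singular end.\<close>

definition numbering_ok ::
    "nat \<Rightarrow> 'v set \<Rightarrow> 'v set \<Rightarrow> (nat \<Rightarrow> 'v list option) \<Rightarrow> ('v set \<Rightarrow> real) \<Rightarrow> ('v \<Rightarrow> nat) \<Rightarrow>
     ('v \<Rightarrow> int) \<Rightarrow> ('v \<Rightarrow> real) \<Rightarrow> nat \<Rightarrow> (int \<Rightarrow> (nat \<times> nat \<times> 'v) option) \<Rightarrow> bool" where
  "numbering_ok L V S P wt dg nm lm cr dc \<longleftrightarrow>
     inj_on nm (V - S) \<and> (\<forall>v. nm v < 2 * int cr * int L + int L) \<and>
     (\<forall>e p. P e = Some p \<and> inner p \<noteq> [] \<longrightarrow>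
        (\<exists>\<sigma>. oriented L cr (V - S) nm lm wt dg (room V dg P e) \<sigma> p) \<and>
        dc (nm (low nm (inner p))) = Some (e, length (inner p), low nm (inner p))) \<and>
     (\<forall>k \<in> dom dc. \<exists>e p. P e = Some p \<and> inner p \<noteq> [] \<and> k = nm (low nm (inner p)))"

lemma chain_appendD: "chain nm lm wt \<sigma> (vs @ ws) \<Longrightarrow> chain nm lm wt \<sigma> vs \<and> chain nm lm wt \<sigma> ws"
  by (simp add: chain_def successively_append_iff)

lemma low_in: "vs \<noteq> [] \<Longrightarrow> low nm vs \<in> set vs"
  by (auto simp: low_def)

lemma low_up: "chain nm lm wt 1 vs \<Longrightarrow> vs \<noteq> [] \<Longrightarrow> low nm vs = hd vs"
  using chain_last[of nm lm wt 1 vs] by (simp add: low_def)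

lemma low_down:
  assumes "chain nm lm wt (- 1) vs" "vs \<noteq> []"
  shows "low nm vs = last vs"
proof (cases "length vs = 1")
  case True
  then obtain v where "vs = [v]" by (auto simp: length_Suc_conv)
  then show ?thesis by (simp add: low_def)
next
  case False
  then have "0 < length vs - 1" using assms(2) by (cases vs) auto
  then show ?thesis using chain_last[OF assms] by (simp add: low_def)
qed

lemma low_rev:
  assumes "vs \<noteq> []" "nm (hd vs) = nm (last vs) \<Longrightarrow> hd vs = last vs"
  shows "low nm (rev vs) = low nm vs"
  using assms by (auto simp: low_def hd_rev last_rev)

lemma chain_image:
  assumes "chain nm lm wt \<sigma> vs" "vs \<noteq> []" "\<sigma> = 1 \<or> \<sigma> = - 1"
  shows "nm ` set vs = {nm (low nm vs)..nm (low nm vs) + int (length vs) - 1}"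
proof -
  have up: "nm ` set ws = {nm (hd ws)..nm (hd ws) + int (length ws) - 1}"
    if c: "chain nm lm wt 1 ws" "ws \<noteq> []" for ws
  proof (intro equalityI subsetI)
    fix k assume "k \<in> nm ` set ws"
    then obtain i where "i < length ws" "k = nm (ws ! i)" by (auto simp: in_set_conv_nth)
    then show "k \<in> {nm (hd ws)..nm (hd ws) + int (length ws) - 1}" using chain_nth[OF c(1)] by auto
  next
    fix k assume k: "k \<in> {nm (hd ws)..nm (hd ws) + int (length ws) - 1}"
    define i where "i = nat (k - nm (hd ws))"
    have "i < length ws" using k by (auto simp: i_def)
    moreover have "k = nm (ws ! i)" using chain_nth[OF c(1) \<open>i < length ws\<close>] k by (auto simp: i_def)
    ultimately show "k \<in> nm ` set ws" by auto
  qed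
  from assms(3) show ?thesis
  proof
    assume "\<sigma> = 1"
    then show ?thesis using up[of vs] assms low_up by metis
  next
    assume s: "\<sigma> = - 1"
    then have "chain nm lm wt 1 (rev vs)" using assms(1) chain_rev[of nm lm wt 1 "rev vs"] by simp
    then show ?thesis
      using up[of "rev vs"] assms(2) low_down[of nm lm wt vs] assms(1) s by (simp add: hd_rev)
  qed
qed

text \<open>For a single regular vertex, reversal exchanges the two conditions on the numbers of the
  ends.\<close>

lemma oriented_flip:
  assumes "oriented L cr N nm lm wt dg C \<sigma> p" "p \<noteq> []" "inner p \<noteq> []"
  shows "oriented L cr N nm lm wt dg C (- \<sigma>) (rev p)"
proof -
  have "hd (inner p) = last (inner p)" if "length (inner p) = 1"
    using that by (auto simp: length_Suc_conv)
  then show ?thesis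
    using assms by (auto simp: oriented_def chain_rev hd_rev last_rev)
qed

lemma room_flip:
  assumes "P e = Some p" "p \<noteq> []"
  shows "room V dg (P(e \<mapsto> rev p)) g = room V dg P g"
proof -
  have eq: "(\<exists>f r. f \<noteq> g \<and> (P(e \<mapsto> rev p)) f = Some r \<and> dg (hd r) = 1 \<and> dg (last r) = 1 \<and> v \<in> set
      (inner r)) \<longleftrightarrow>
    (\<exists>f r. f \<noteq> g \<and> P f = Some r \<and> dg (hd r) = 1 \<and> dg (last r) = 1 \<and> v \<in> set (inner r))" (is "?l \<longleftrightarrow>
        ?r") for v
  proof
    assume ?l
    then obtain f r where f: "f \<noteq> g" "(P(e \<mapsto> rev p)) f = Some r" "dg (hd r) = 1" "dg (last r) = 1"
        "v \<in> set (inner r)"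
      by blast
    then show ?r using assms
      by (cases "f = e") (auto simp: hd_rev last_rev)
  next
    assume ?r
    then obtain f r where f: "f \<noteq> g" "P f = Some r" "dg (hd r) = 1" "dg (last r) = 1" "v \<in> set
        (inner r)"
      by blast
    then show ?l using assms
      by (cases "f = e") (auto simp: hd_rev last_rev intro!: exI[of _ f])
  qed
  have "free_inner dg (P(e \<mapsto> rev p)) g = free_inner dg P g"
    using eq unfolding set_eq_iff free_inner_iff by blast
  then show ?thesis by (simp add: room_def)
qed

lemma (in decomposition) numbering_ok_flip:
  assumes "numbering_ok L V S P wt dg nm lm cr dc" "P e = Some p"
  shows "numbering_ok L V S (P(e \<mapsto> rev p)) wt dg nm lm cr dc"
proof -
  have r: "rpath E S p" using path assms(2) .
  have pn: "p \<noteq> []" using length_path[OF r] by auto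
  have inj: "inj_on nm (V - S)" using assms(1) by (simp add: numbering_ok_def)
  \<comment> \<open>\<open>low\<close> resolves a tie in favour of the head, so reversal could
    change the vertex only if both ends had equal numbers; by injectivity they then
    coincide.\<close>
  have low: "low nm (rev (inner p)) = low nm (inner p)" if "inner p \<noteq> []"
  proof (rule low_rev[OF that])
    assume "nm (hd (inner p)) = nm (last (inner p))"
    moreover have "hd (inner p) \<in> V - S" "last (inner p) \<in> V - S" 
      using inner_subset[OF r] hd_in_set[OF that] last_in_set[OF that] by blast+
    ultimately show "hd (inner p) = last (inner p)" using inj by (simp add: inj_on_def)
  qed
  show ?thesis
    unfolding numbering_ok_def room_flip[of P e p, OF assms(2) pn]
  proof (intro conjI allI impI ballI)
    show "inj_on nm (V - S)" by (rule inj)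
    show "nm v < 2 * int cr * int L + int L" for v using assms(1) by (simp add: numbering_ok_def)
    fix f q assume f: "(P(e \<mapsto> rev p)) f = Some q \<and> inner q \<noteq> []"
    show "\<exists>\<sigma>. oriented L cr (V - S) nm lm wt dg (room V dg P f) \<sigma> q"
    proof (cases "f = e")
      case True
      then have q: "q = rev p" "inner p \<noteq> []" using f by auto
      obtain \<sigma> where "oriented L cr (V - S) nm lm wt dg (room V dg P e) \<sigma> p"
        using assms q(2) unfolding numbering_ok_def by blast
      from oriented_flip[OF this pn q(2)] show ?thesis using q True by blast
    next
      case False
      then show ?thesis using assms(1) f by (auto simp: numbering_ok_def)
    qed
    show "dc (nm (low nm (inner q))) = Some (f, length (inner q), low nm (inner q))"
    proof (cases "f = e")
      case True
      then show ?thesis using assms f low by (auto simp: numbering_ok_def)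
    next
      case False
      then show ?thesis using assms(1) f by (auto simp: numbering_ok_def)
    qed
  next
    fix k assume "k \<in> dom dc"
    then obtain f q where f: "P f = Some q" "inner q \<noteq> []" "k = nm (low nm (inner q))"
      using assms(1) unfolding numbering_ok_def by blast
    show "\<exists>f q. (P(e \<mapsto> rev p)) f = Some q \<and> inner q \<noteq> [] \<and> k = nm (low nm (inner q))"
      using f low assms(2) by (cases "f = e") (auto intro!: exI[of _ f])
  qed
qed

section \<open>Size of the dictionary and predecessor queries\<close>

lemma (in decomposition) dict_subset:
  assumes "numbering_ok L V S P wt dg nm lm cr dc"
  shows "dom dc \<subseteq> nm ` (V - S)"
proof
  fix k assume "k \<in> dom dc"
  then obtain f q where f: "P f = Some q" "inner q \<noteq> []" "k = nm (low nm (inner q))"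
    using assms unfolding numbering_ok_def by blast
  then show "k \<in> nm ` (V - S)" using low_in inner_subset[OF path[OF f(1)]] by blast
qed

lemma (in decomposition) dict_bounds:
  assumes "numbering_ok L V S P wt dg nm lm cr dc"
  shows "finite (dom dc)" "card (dom dc) \<le> card V"
proof -
  have fin: "finite (V - S)" using finite_V by simp
  then show "finite (dom dc)" using dict_subset[OF assms] by (meson finite_surj)
  have "card (dom dc) \<le> card (nm ` (V - S))" using dict_subset[OF assms] fin by (simp add:
      card_mono)
  also have "\<dots> \<le> card (V - S)" using card_image_le fin by blast
  also have "\<dots> \<le> card V" using finite_V by (simp add: card_mono)
  finally show "card (dom dc) \<le> card V" .
qed

text \<open>The numbers of \<open>p\<close> fill an interval that starts at its key. A larger key up
  to \<open>nm v\<close> would lie in this interval and, by injectivity, belong to a vertex of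
  \<open>p\<close>, so it would be the key of \<open>p\<close> itself.\<close>

lemma (in decomposition) dict_lookup:
  assumes "numbering_ok L V S P wt dg nm lm cr dc" "P e = Some p" "v \<in> set (inner p)"
  shows "Max {k \<in> dom dc. k \<le> nm v} = nm (low nm (inner p))"
    "dc (nm (low nm (inner p))) = Some (e, length (inner p), low nm (inner p))"
proof -
  have ne: "inner p \<noteq> []" using assms(3) by auto
  let ?a = "nm (low nm (inner p))"
  obtain \<sigma> where "oriented L cr (V - S) nm lm wt dg (room V dg P e) \<sigma> p"
    using assms(1,2) ne unfolding numbering_ok_def by blast
  then have im: "nm ` set (inner p) = {?a..?a + int (length (inner p)) - 1}"
    using chain_image[of nm lm wt \<sigma> "inner p"] ne by (simp add: oriented_def)
  show dc: "dc ?a = Some (e, length (inner p), low nm (inner p))"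
    using assms(1,2) ne unfolding numbering_ok_def by blast
  have inj: "inj_on nm (V - S)" using assms(1) by (simp add: numbering_ok_def)
  show "Max {k \<in> dom dc. k \<le> nm v} = ?a"
  proof (rule Max_eqI)
    show "finite {k \<in> dom dc. k \<le> nm v}" using dict_bounds(1)[OF assms(1)] by simp
    have nv: "nm v \<in> {?a..?a + int (length (inner p)) - 1}" using im assms(3) by blast
    then show "?a \<in> {k \<in> dom dc. k \<le> nm v}" using dc by auto
    fix k assume k: "k \<in> {k \<in> dom dc. k \<le> nm v}"
    then obtain f q where f: "P f = Some q" "inner q \<noteq> []" "k = nm (low nm (inner q))"
      using assms(1) unfolding numbering_ok_def by blast
    show "k \<le> ?a"
    proof (rule ccontr)
      assume "\<not> k \<le> ?a"
      then have "k \<in> nm ` set (inner p)" unfolding im using k nv by auto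
      then obtain u where u: "u \<in> set (inner p)" "k = nm u" by blast
      have "low nm (inner q) \<in> set (inner q)" using low_in f(2) by blast
      moreover from this have "u = low nm (inner q)"
        using u f inj inner_subset[OF path[OF f(1)]] inner_subset[OF path[OF assms(2)]]
        by (metis inj_on_def subsetD)
      ultimately have "f = e" using inner_unique[OF f(1) assms(2)] u(1) by blast
      then show False using f assms(2) \<open>\<not> k \<le> ?a\<close> by auto
    qed
  qed
qed

section \<open>The numbering under a split\<close>

lemma open_end_mono:
  assumes "open_end L cr N nm C \<sigma> k" "N' \<subseteq> N" "C \<le> C'"
  shows "open_end L cr N' nm C' \<sigma> k"
  using assms unfolding open_end_def by fastforce

lemma oriented_mono:
  assumes "oriented L cr N nm lm wt dg C \<sigma> p" "N' \<subseteq> N" "C \<le> C'"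
  shows "oriented L cr N' nm lm wt dg C' \<sigma> p"
  using assms open_end_mono[OF _ assms(2,3)] unfolding oriented_def by blast

lemma room_mono:
  assumes "finite V" "free_inner dg' P' g' \<subseteq> free_inner dg P g" "\<And>v. dg v \<le> dg' v"
  shows "room V dg P g \<le> room V dg' P' g'"
  unfolding room_def using assms by (intro card_mono) (auto intro: order_trans)

text \<open>Neither part has an end of degree one at the cut \<open>x\<close>, so each inherits the
  only end at which it may grow. \<open>o\<close> is assumed only for two or more regular vertices:
  a single one leaves two empty parts.\<close>

lemma (in decomposition) numbering_ok_split:
  assumes nok: "numbering_ok L V S P wt dg nm lm cr dc"
    and P: "P e = Some (a @ x # b)" "a \<noteq> []" "b \<noteq> []" "e' \<notin> dom P" "dg x \<noteq> 1"
    and c: "chain nm lm wt 1 (inner (a @ x # b))"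
    and o: "1 < length (inner (a @ x # b)) \<Longrightarrow>
      oriented L cr (V - S) nm lm wt dg (room V dg P e) 1 (a @ x # b)"
  defines "as \<equiv> inner (a @ [x])" and "bs \<equiv> inner (x # b)"
  defines "dc1 \<equiv> (if as \<noteq> [] then dc(nm (hd as) \<mapsto> (e, length as, hd as)) else dc(nm x := None))"
  defines "dc2 \<equiv> (if bs \<noteq> [] then dc1(nm (hd bs) \<mapsto> (e', length bs, hd bs)) else dc1)"
  shows "numbering_ok L V (insert x S) (P(e \<mapsto> a @ [x], e' \<mapsto> x # b)) wt dg nm lm cr dc2"
proof -
  let ?P = "P(e \<mapsto> a @ [x], e' \<mapsto> x # b)"
  have ee: "e \<noteq> e'" "P e' = None" using P by auto
  have i: "inner (a @ x # b) = as @ x # bs"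
    using P(2,3) unfolding as_def bs_def by (cases a) (auto simp: inner_def butlast_append)
  have inj: "inj_on nm (V - S)" using nok by (simp add: numbering_ok_def)
  have sub: "set (as @ x # bs) \<subseteq> V - S" using inner_subset[OF path[OF P(1)]] i by simp
  have dist: "distinct (as @ x # bs)" using path[OF P(1)] i by (simp add: rpath_def)
  have ca: "chain nm lm wt 1 (as @ [x])" and cb: "chain nm lm wt 1 (x # bs)"
    using c chain_append[of nm lm wt 1 as x bs] unfolding i by auto
  have ca': "chain nm lm wt 1 as"
    using chain_appendD[OF ca] by blast
  have cb': "chain nm lm wt 1 bs" using cb by (cases bs) auto
  have lowp: "low nm (inner (a @ x # b)) = hd (as @ [x])"
    using low_up[OF c] i by (cases as) auto
  have la: "as \<noteq> [] \<Longrightarrow> low nm as = hd as" and lb: "bs \<noteq> [] \<Longrightarrow> low nm bs = hd bs"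
    using low_up ca' cb' by blast+
  \<comment> \<open>Neither part enters \<open>free_inner\<close>, as \<open>dg x\<close> is not 1,
    so \<open>room\<close> cannot shrink.\<close>
  have room: "room V dg P g \<le> room V dg ?P g'" if "g' = g \<or> g' = e' \<and> g = e" for g g'
  proof (rule room_mono)
    show "free_inner dg ?P g' \<subseteq> free_inner dg P g"
    proof
      fix v assume "v \<in> free_inner dg ?P g'"
      then obtain f q where f: "f \<noteq> g'" "?P f = Some q" "dg (hd q) = 1" "dg (last q) = 1" "v \<in> set
          (inner q)"
        unfolding free_inner_def by blast
      have "f \<noteq> e" "f \<noteq> e'" using f P(5) ee by (auto split: if_splits)
      then have "f \<noteq> g" "P f = Some q" using f that by auto
      then show "v \<in> free_inner dg P g" using f unfolding free_inner_def by blast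
    qed
  qed (use finite_V in auto)
  have neq: "nm u \<noteq> nm v" if "u \<in> V - S" "v \<in> V - S" "u \<noteq> v" for u v
    using inj that by (auto simp: inj_on_def)
  have hda: "as \<noteq> [] \<Longrightarrow> hd as \<in> set as" and hdb: "bs \<noteq> [] \<Longrightarrow> hd bs \<in> set bs" by auto
  have other: "dc2 (nm v) = dc (nm v)" if v: "v \<in> V - S" "v \<notin> set (as @ x # bs)" for v
  proof -
    have ne: "nm v \<noteq> nm u" if "u \<in> set (as @ x # bs)" for u
      using neq[OF v(1), of u] that v(2) sub by blast
    have "nm v \<noteq> nm x" "as \<noteq> [] \<Longrightarrow> nm v \<noteq> nm (hd as)" "bs \<noteq> [] \<Longrightarrow> nm v \<noteq> nm (hd bs)"
      by (rule ne, simp)+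
    then show ?thesis by (auto simp: dc2_def dc1_def)
  qed
  have N: "V - insert x S \<subseteq> V - S" by blast
  show ?thesis
    unfolding numbering_ok_def
  proof (intro conjI allI impI ballI)
    show "inj_on nm (V - insert x S)" using inj by (rule inj_on_subset) blast
    show "nm v < 2 * int cr * int L + int L" for v using nok by (simp add: numbering_ok_def)
    fix f q assume fq: "?P f = Some q \<and> inner q \<noteq> []"
    consider "f = e" "q = a @ [x]" | "f = e'" "q = x # b" | "f \<noteq> e" "f \<noteq> e'" "P f = Some q"
      using fq ee by (auto split: if_splits)
    note cs = this
    show "\<exists>\<sigma>. oriented L cr (V - insert x S) nm lm wt dg (room V dg ?P f) \<sigma> q"
    proof (cases rule: cs)
      case 1
      then have as: "as \<noteq> []" using fq by (simp add: as_def)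
      have "oriented L cr (V - insert x S) nm lm wt dg (room V dg ?P e) 1 (a @ x # b)"
        using oriented_mono[OF o N room] i as by auto
      then have "dg (hd a) = 1 \<Longrightarrow> open_end L cr (V - insert x S) nm (room V dg ?P e) (- 1) (nm (hd
          as))"
        using P(2) i as by (auto simp: oriented_def)
      \<comment> \<open>The number left behind at \<open>x\<close> lies just above, which is how
        \<open>grow\<close> will know that this part may only grow downwards.\<close>
      moreover have "nm x = nm (hd as) + 1" if "length as = 1"
        using ca that by (auto simp: length_Suc_conv)
      ultimately have "oriented L cr (V - insert x S) nm lm wt dg (room V dg ?P e) 1 (a @ [x])"
        using P(2,5) as_def[symmetric] ca' by (auto simp: oriented_def)
      then show ?thesis using 1 by blast
    next
      case 2
      then have bs: "bs \<noteq> []" using fq by (simp add: bs_def)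
      have "oriented L cr (V - insert x S) nm lm wt dg (room V dg ?P e') 1 (a @ x # b)"
        using oriented_mono[OF o N room] i bs by auto
      then have "dg (last b) = 1 \<Longrightarrow> open_end L cr (V - insert x S) nm (room V dg ?P e') 1 (nm (last
          bs))"
        using P(3) i bs by (auto simp: oriented_def)
      \<comment> \<open>Here the stale number of \<open>x\<close> lies just below, and growth is
        upwards.\<close>
      moreover have "nm x = nm (hd bs) - 1" using cb bs by (cases bs) auto
      ultimately have "oriented L cr (V - insert x S) nm lm wt dg (room V dg ?P e') 1 (x # b)"
        using P(3,5) bs_def[symmetric] cb' by (auto simp: oriented_def)
      then show ?thesis using 2 by blast
    next
      case 3
      then obtain \<sigma> where "oriented L cr (V - S) nm lm wt dg (room V dg P f) \<sigma> q"
        using nok fq unfolding numbering_ok_def by blast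
      then show ?thesis using oriented_mono[OF _ N room] by blast
    qed
    show "dc2 (nm (low nm (inner q))) = Some (f, length (inner q), low nm (inner q))"
    proof (cases rule: cs)
      case 1
      then have as: "as \<noteq> []" "inner q = as" using fq by (auto simp: as_def)
      have "nm (hd bs) \<noteq> nm (hd as)" if "bs \<noteq> []"
      proof (rule neq)
        have "hd bs \<in> set (as @ x # bs)" "hd as \<in> set (as @ x # bs)" using hda hdb as(1) that by
            auto
        then show "hd bs \<in> V - S" "hd as \<in> V - S" using sub by blast+
        show "hd bs \<noteq> hd as" using dist hda[OF as(1)] hdb[OF that] by (auto simp: disjoint_iff)
      qed
      then show ?thesis using la as 1 by (auto simp: dc2_def dc1_def)
    next
      case 2
      then have bs: "bs \<noteq> []" "inner q = bs" using fq by (auto simp: bs_def)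
      then show ?thesis using lb 2 by (auto simp: dc2_def)
    next
      case 3
      have l: "low nm (inner q) \<in> set (inner q)" using low_in fq by blast
      then have "low nm (inner q) \<notin> set (as @ x # bs)" "low nm (inner q) \<in> V - S"
        using inner_unique[OF 3(3) P(1)] i 3(1) inner_subset[OF path[OF 3(3)]] by auto
      from other[OF this(2,1)] show ?thesis using nok fq 3(3) unfolding numbering_ok_def by auto
    qed
  next
    fix k assume k: "k \<in> dom dc2"
    consider "as \<noteq> []" "k = nm (hd as)" | "bs \<noteq> []" "k = nm (hd bs)"
      | "k \<in> dom dc" "as = [] \<Longrightarrow> k \<noteq> nm x" "as \<noteq> [] \<Longrightarrow> k \<noteq> nm (hd as)"
      using k by (auto simp: dc2_def dc1_def split: if_splits)
    then show "\<exists>f q. ?P f = Some q \<and> inner q \<noteq> [] \<and> k = nm (low nm (inner q))"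
    proof cases
      case 1
      then show ?thesis using la ee as_def by (intro exI[of _ e] exI[of _ "a @ [x]"]) auto
    next
      case 2
      then show ?thesis using lb ee bs_def by (intro exI[of _ e'] exI[of _ "x # b"]) auto
    next
      case 3
      then obtain f q where f: "P f = Some q" "inner q \<noteq> []" "k = nm (low nm (inner q))"
        using nok unfolding numbering_ok_def by blast
      have "f \<noteq> e" using f P(1) lowp 3 by (cases as) auto
      moreover have "f \<noteq> e'" using f ee by auto
      ultimately show ?thesis using f by (intro exI[of _ f] exI[of _ q]) auto
    qed
  qed
qed

section \<open>Growing paths\<close>

lemma path_edges_inner: "set (path_edges (inner p)) \<subseteq> set (path_edges p)"
proof (cases "2 \<le> length p \<and> inner p \<noteq> []")
  case True
  then have "p = [hd p] @ inner p @ [last p]" using path_ends[of p] by (metis append_Cons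
      append_Nil)
  then have "path_edges p = path_edges ([hd p] @ inner p @ [last p])" by metis
  also have "\<dots> = {hd p, hd (inner p)} # path_edges (inner p) @ [{last (inner p), last p}]"
    using True by (simp add: path_edges_append del: append.simps)
  finally show ?thesis by auto
next
  case False
  then show ?thesis by (cases p; cases "tl p") (auto simp: inner_def)
qed

lemma centre_mono: "j < j' \<Longrightarrow> 2 * int j * int L + 2 * int L \<le> 2 * int j' * int L"
proof -
  assume "j < j'"
  then have "int j + 1 \<le> int j'" by simp
  then have "(int j + 1) * (2 * int L) \<le> int j' * (2 * int L)" by (intro mult_right_mono) auto
  then show ?thesis by (simp add: algebra_simps)
qed

text \<open>Growth at the end \<open>k0\<close> reaches \<open>k'\<close>, and \<open>k\<close> is
  another open end. Distinct centres are \<open>2 * L\<close> apart, so \<open>k'\<close> cannot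
  enter the window of another centre. With a common centre, equal directions would make both ends
  outermost and hence equal, and with opposite directions \<open>k'\<close> moves away from
  \<open>k\<close>.\<close>

lemma new_number:
  assumes "\<sigma>0 = 1 \<or> \<sigma>0 = - 1" "\<sigma> = 1 \<or> \<sigma> = - 1"
    and "\<bar>k' - 2 * int j0 * int L\<bar> < int L" "\<sigma>0 * k0 < \<sigma>0 * k'" "\<bar>k0 - 2 * int j0 * int L\<bar> < int L"
    and "\<bar>k - 2 * int j * int L\<bar> < int L"
    and "\<sigma>0 * k \<le> \<sigma>0 * k0 \<or> \<sigma>0 * (2 * int j0 * int L) + int L \<le> \<sigma>0 * k"
    and "\<sigma> * k0 \<le> \<sigma> * k \<or> \<sigma> * (2 * int j * int L) + int L \<le> \<sigma> * k0"
    and "k \<noteq> k0 \<or> \<sigma> \<noteq> \<sigma>0"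
  shows "\<sigma> * k' \<le> \<sigma> * k \<or> \<sigma> * (2 * int j * int L) + int L \<le> \<sigma> * k'"
proof -
  define c c0 where "c = 2 * int j * int L" and "c0 = 2 * int j0 * int L"
  have "c + 2 * int L \<le> c0 \<or> c = c0 \<or> c0 + 2 * int L \<le> c"
    using centre_mono[of j j0 L] centre_mono[of j0 j L] unfolding c_def c0_def
    by (cases j j0 rule: linorder_cases) auto
  then show ?thesis using assms unfolding c_def[symmetric] c0_def[symmetric]
    by (elim disjE) auto
qed

section \<open>Joining paths: degrees, free paths and room\<close>

lemma (in decomposition) end_degree:
  assumes r: "P g = Some r"
  shows "card {ed \<in> E. hd r \<in> ed} \<noteq> 0 \<and> card {ed \<in> E. last r \<in> ed} \<noteq> 0"
proof -
  have l: "2 \<le> length r" using length_path[OF path[OF r]] .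
  have "card {ed \<in> E. v \<in> ed} \<noteq> 0" if v: "v \<in> set r" for v
  proof -
    obtain ed where "ed \<in> set (path_edges r)" "v \<in> ed" using v Union_path_edges[OF l] by blast
    then have "ed \<in> {ed \<in> E. v \<in> ed}" using path[OF r] by (auto simp: rpath_def)
    then show ?thesis using finite_E by (auto simp: card_eq_0_iff)
  qed
  then show ?thesis using l by (cases r) auto
qed

text \<open>The list \<open>p\<close> has been turned to end in \<open>x\<close>, and
  \<open>ws\<close> are the vertices to be numbered, in this order. \<open>dg\<close> mirrors the
  degrees before the insertion.\<close>

locale joining = decomposition V E S P
  for V :: "'v set" and E :: "'v set set" and S :: "'v set" and P :: "nat \<Rightarrow> 'v list option" +
  fixes dg :: "'v \<Rightarrow> nat" and e :: nat and p :: "'v list" and x y :: 'v and F :: "nat set" and q ::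
      "'v list"
  assumes dg: "\<And>v. dg v = card {ed \<in> E. v \<in> ed}"
    and Pe: "P e = Some p" and last_p: "last p = x" and dg_x: "dg x = 1" and xy: "x \<noteq> y"
    and new_edge: "{x, y} \<notin> E" and cont: "continuation F y q" and e_F: "e \<notin> F"
begin

abbreviation "E' \<equiv> insert {x, y} E"
abbreviation "P' \<equiv> (P |` (- F))(e \<mapsto> p @ q)"
abbreviation "dg' \<equiv> dg(x := dg x + 1, y := dg y + 1)"
abbreviation "ws \<equiv> x # butlast q"
abbreviation "S' \<equiv> S - set ws"

lemmas props = continuation_props[OF Pe last_p dg_x[unfolded dg] xy new_edge cont e_F]

sublocale j: decomposition V E' S' P'
  by (rule join[OF Pe last_p dg_x[unfolded dg] xy new_edge cont e_F])

lemma x_S: "x \<in> S"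
  using path[OF Pe] last_p by (auto simp: rpath_def)

lemma p_q: "2 \<le> length p" "inner (p @ q) = inner p @ ws" "hd (p @ q) = hd p" "last (p @ q) = last q"
proof -
  show l: "2 \<le> length p" using length_path[OF path[OF Pe]] .
  show "inner (p @ q) = inner p @ ws" using inner_append[OF l props(1)] last_p by simp
  show "hd (p @ q) = hd p" using l by (cases p) auto
  show "last (p @ q) = last q" using props(1) by simp
qed

lemma P'_e: "P' e = Some (p @ q)"
  by simp

lemma other: "P' g = Some r \<Longrightarrow> g \<noteq> e \<Longrightarrow> P g = Some r \<and> g \<notin> F"
  by (auto simp: restrict_map_def split: if_splits)

lemma other': "P g = Some r \<Longrightarrow> g \<noteq> e \<Longrightarrow> g \<notin> F \<Longrightarrow> P' g = Some r"
  by auto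

lemma N': "V - S' = (V - S) \<union> set ws"
  using props(8) x_S S_subset by auto

lemma ws_subset: "set ws \<subseteq> V - S'" "set ws \<inter> set (inner p) = {}"
  using N' props(7) by auto

lemma ws_other:
  assumes "P' g = Some r" "g \<noteq> e"
  shows "set ws \<inter> set (inner r) = {}"
  using j.inner_unique[OF assms(1) P'_e] p_q(2) assms(2) by auto

lemma end_dg: "P g = Some r \<Longrightarrow> dg (hd r) \<noteq> 0 \<and> dg (last r) \<noteq> 0"
  unfolding dg by (rule end_degree)

text \<open>Besides \<open>x\<close>, only \<open>y\<close> changes its degree. If \<open>y\<close>
  stays in \<open>S'\<close>, it did not have degree one; as degree zero is excluded too, it ends up
  with at least three.\<close>

lemma dg'_end: "v \<in> S' \<Longrightarrow> dg v \<noteq> 0 \<Longrightarrow> dg' v = 1 \<longleftrightarrow> dg v = 1"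
proof -
  assume v: "v \<in> S'" "dg v \<noteq> 0"
  have "v \<noteq> x" using v by simp
  moreover have "dg y \<noteq> 1" if "v = y"
  proof -
    have "y \<notin> set (butlast q) \<inter> S" using v \<open>v = y\<close> by auto
    then show ?thesis using props(10,13) unfolding dg by (auto split: if_splits)
  qed
  ultimately show ?thesis using v by auto
qed

lemma ends_S':
  assumes "P' g = Some r"
  shows "hd r \<in> S'" "last r \<in> S'"
  using j.path[OF assms] by (auto simp: rpath_def)

lemma dg'_other:
  assumes "P' g = Some r" "g \<noteq> e"
  shows "dg' (hd r) = 1 \<longleftrightarrow> dg (hd r) = 1" "dg' (last r) = 1 \<longleftrightarrow> dg (last r) = 1"
  using dg'_end ends_S'[OF assms(1)] end_dg other[OF assms] by metis+

lemma dg'_hd: "dg' (hd p) = 1 \<longleftrightarrow> dg (hd p) = 1"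
  using dg'_end ends_S'(1)[OF P'_e] end_dg[OF Pe] p_q(3) by metis

lemma dg'_last: "F \<noteq> {} \<Longrightarrow> dg' (last q) = 1 \<longleftrightarrow> dg (last q) = 1"
proof -
  assume "F \<noteq> {}"
  then obtain f where "f \<in> F" by blast
  then have "P f = Some q" using props(12) by blast
  then show ?thesis using dg'_end ends_S'(2)[OF P'_e] end_dg p_q(4) by metis
qed

lemma dg_y: "F \<noteq> {} \<Longrightarrow> dg y = 1"
  using props(13) unfolding dg by blast

lemma ws_dg': "v \<in> set ws \<Longrightarrow> dg' v = 2"
proof -
  assume "v \<in> set ws"
  then have "v \<in> V - S'" using ws_subset by blast
  then have "card {ed \<in> E'. v \<in> ed} = 2" by (rule j.two_edges)
  then show ?thesis using card_edges_insert[OF finite_E new_edge, of v] dg xy by auto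
qed

lemma ws_cases: "v \<in> set ws \<Longrightarrow> v = x \<or> F \<noteq> {} \<and> (v = y \<or> v \<in> set (inner q))"
proof -
  assume v: "v \<in> set ws"
  show ?thesis
  proof (cases "F = {}")
    case True
    then show ?thesis using props(11) v by simp
  next
    case False
    then obtain f where "f \<in> F" by blast
    then have "butlast q = y # inner q" using props(12)[of f] by (metis butlast.simps(2)
        butlast_snoc append_is_Nil_conv list.distinct(1))
    then show ?thesis using v False by auto
  qed
qed

text \<open>If the joined path has two ends of degree one, then so had \<open>p\<close> and, in a
  merge, \<open>q\<close>. Their inner vertices were already left out, and the former ends
  \<open>x\<close> and \<open>y\<close> are ruled out by \<open>2 \<le> dg v\<close>.\<close>

lemma free_inner':
  assumes "g \<in> dom P'" "g \<noteq> e" "v \<in> free_inner dg' P' g" "2 \<le> dg v"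
  shows "v \<in> free_inner dg P g"
proof -
  obtain h r where h: "h \<noteq> g" "P' h = Some r" "dg' (hd r) = 1" "dg' (last r) = 1" "v \<in> set (inner
      r)"
    using assms(3) unfolding free_inner_iff by blast
  show ?thesis
  proof (cases "h = e")
    case False
    then show ?thesis using h other dg'_other unfolding free_inner_iff by metis
  next
    case True
    then have r: "r = p @ q" using h(2) by simp
    have dp: "dg (hd p) = 1" using h(3) dg'_hd unfolding r p_q(3) by blast
    show ?thesis
    proof (cases "v \<in> set (inner p)")
      case True
      then show ?thesis using Pe dp dg_x last_p assms(2) unfolding free_inner_iff by metis
    next
      case False
      then have "v \<in> set ws" using h(5) unfolding r p_q(2) by auto
      moreover have "v \<noteq> x" "F \<noteq> {} \<Longrightarrow> v \<noteq> y" using assms(4) dg_x dg_y by auto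
      ultimately have F: "F \<noteq> {}" "v \<in> set (inner q)" using ws_cases[of v] by blast+
      then obtain f where f: "f \<in> F" by blast
      then have "P f = Some q" "f \<noteq> g" using props(12) assms(1,2) by auto
      moreover have "dg (last q) = 1" using h(4) dg'_last[OF F(1)] unfolding r p_q(4) by blast
      ultimately show ?thesis using F dg_y props(2) unfolding free_inner_iff by metis
    qed
  qed
qed

lemma free_inner'_e: "free_inner dg' P' e \<subseteq> free_inner dg P e"
  unfolding subset_iff free_inner_iff using other dg'_other by metis

lemma dg_le: "dg v \<le> dg' v"
  by auto

lemma room': "g \<in> dom P' \<Longrightarrow> room V dg P g \<le> room V dg' P' g"
proof -
  assume g: "g \<in> dom P'"
  have "{v \<in> V. 2 \<le> dg v} - free_inner dg P g \<subseteq> {v \<in> V. 2 \<le> dg' v} - free_inner dg' P' g"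
    using free_inner'[OF g] free_inner'_e dg_le by (cases "g = e") (auto intro: order_trans)
  then show ?thesis unfolding room_def using finite_V by (intro card_mono) auto
qed

text \<open>None of \<open>ws\<close> was counted before: \<open>x\<close> and a merged
  \<open>y\<close> had degree one, and the inner vertices of \<open>q\<close> lay on another path
  with two ends of degree one. Now all of them count, which pays for the slots they take.\<close>

lemma room'_e:
  assumes "dg' (last q) = 1"
  shows "room V dg P e + length ws \<le> room V dg' P' e"
proof -
  let ?A = "{v \<in> V. 2 \<le> dg v} - free_inner dg P e" and ?B = "{v \<in> V. 2 \<le> dg' v} - free_inner dg'
      P' e"
  have "set ws \<inter> free_inner dg' P' e = {}" using ws_other unfolding free_inner_def by blast
  then have sub: "?A \<union> set ws \<subseteq> ?B"
    using free_inner'_e dg_le ws_subset(1) ws_dg' by (auto intro: order_trans simp del: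
        fun_upd_apply)
  have disj: "?A \<inter> set ws = {}"
  proof (rule ccontr)
    assume "?A \<inter> set ws \<noteq> {}"
    then obtain v where v: "v \<in> ?A" "v \<in> set ws" by blast
    moreover from v(1) have "v \<noteq> x" "F \<noteq> {} \<Longrightarrow> v \<noteq> y" using dg_x dg_y by auto
    ultimately have F: "F \<noteq> {}" "v \<in> set (inner q)" using ws_cases[of v] by blast+
    then obtain f where f: "f \<in> F" by blast
    then have "P f = Some q" "f \<noteq> e" using props(12) e_F by auto
    moreover have "dg (last q) = 1" using assms dg'_last[OF F(1)] by blast
    ultimately have "v \<in> free_inner dg P e" using F dg_y props(2) unfolding free_inner_iff by metis
    then show False using v(1) by blast
  qed
  have "room V dg P e + length ws = card (?A \<union> set ws)"
    using disj finite_V props(7) distinct_card[of ws] unfolding room_def by (subst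
        card_Un_disjoint) auto
  also have "\<dots> \<le> room V dg' P' e" unfolding room_def using finite_V sub by (intro card_mono) auto
  finally show ?thesis .
qed

text \<open>Together with \<open>length_ws\<close> the origin of the factor 2 in
  \<open>2 * card {v \<in> V. 2 \<le> dg' v} \<le> L\<close>: one share bounds the distance reached
  so far, the other the slots now added.\<close>

lemma room_le: "room V dg P g \<le> card {v \<in> V. 2 \<le> dg' v}"
  unfolding room_def using finite_V dg_le by (intro card_mono) (auto intro: order_trans)

lemma length_ws: "length ws \<le> card {v \<in> V. 2 \<le> dg' v}"
proof -
  have "set ws \<subseteq> {v \<in> V. 2 \<le> dg' v}" using ws_dg' ws_subset(1) by (auto simp del: fun_upd_apply)
  then have "card (set ws) \<le> card {v \<in> V. 2 \<le> dg' v}" using finite_V by (intro card_mono) auto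
  then show ?thesis using distinct_card[of ws] props(7) by simp
qed

text \<open>Starts the distance bound for a fresh interval, whose far end is
  \<open>length (inner r) - 1\<close> away from the centre.\<close>

lemma room'_pos:
  assumes "inner r \<noteq> []" "P' g = Some r"
  shows "length (inner r) \<le> room V dg' P' g"
proof -
  have "set (inner r) \<subseteq> {v \<in> V. 2 \<le> dg' v} - free_inner dg' P' g"
  proof
    fix v assume v: "v \<in> set (inner r)"
    have "v \<in> V - S'" using j.inner_subset[OF j.path[OF assms(2)]] v by blast
    then have "card {ed \<in> E'. v \<in> ed} = 2" by (rule j.two_edges)
    then have "dg' v = 2" using card_edges_insert[OF finite_E new_edge, of v] dg xy by auto
    moreover have "v \<notin> free_inner dg' P' g"
      unfolding free_inner_iff using j.inner_unique[OF assms(2) _ v] by blast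
    ultimately show "v \<in> {v \<in> V. 2 \<le> dg' v} - free_inner dg' P' g" using \<open>v \<in> V - S'\<close> by simp
  qed
  then have "card (set (inner r)) \<le> room V dg' P' g" unfolding room_def using finite_V by (intro
      card_mono) auto
  then show ?thesis using j.path[OF assms(2)] distinct_card[of "inner r"] by (simp add: rpath_def)
qed

text \<open>Common to continuing an interval and opening a new one. \<open>new\<close> demands that
  no fresh number falls on the free side of an open end of another path. \<open>dc1\<close> to
  \<open>dc3\<close> drop the keys of \<open>q\<close> and \<open>p\<close> and enter that of the
  joined path.\<close>

lemma numbering_ok_join:
  assumes nok: "numbering_ok L V S P wt dg nm lm cr dc"
    and nm': "\<And>v. v \<notin> set ws \<Longrightarrow> nm' v = nm v" and lm': "\<And>v. v \<notin> set ws \<Longrightarrow> lm' v = lm v"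
    and wt': "\<And>ed. ed \<in> E \<Longrightarrow> wt' ed = wt ed"
    and cr: "cr \<le> cr'"
    and inj': "inj_on nm' (V - S')" and bound: "\<And>v. nm' v < 2 * int cr' * int L + int L"
    and new: "\<And>w v \<sigma> j. w \<in> set ws \<Longrightarrow> v \<in> V - S \<Longrightarrow> v \<notin> set (inner p) \<Longrightarrow> \<sigma> = 1 \<or> \<sigma> = - 1 \<Longrightarrow> j \<in> {1..cr} \<Longrightarrow>
      \<bar>nm v - 2 * int j * int L\<bar> < int L \<Longrightarrow>
      (\<forall>u \<in> V - S. \<sigma> * nm u \<le> \<sigma> * nm v \<or> \<sigma> * (2 * int j * int L) + int L \<le> \<sigma> * nm u) \<Longrightarrow>
      \<sigma> * nm' w \<le> \<sigma> * nm v \<or> \<sigma> * (2 * int j * int L) + int L \<le> \<sigma> * nm' w"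
    and o': "oriented L cr' (V - S') nm' lm' wt' dg' (room V dg' P' e) \<sigma>' (p @ q)"
    and dc1: "dc1 = (if F \<noteq> {} \<and> inner q \<noteq> [] then dc(nm (low nm (inner q)) := None) else dc)"
    and dc2: "dc2 = (if inner p \<noteq> [] then dc1(nm (low nm (inner p)) := None) else dc1)"
    and dc3: "dc3 = dc2(nm' (low nm' (inner p @ ws)) \<mapsto> (e, length (inner p @ ws), low nm' (inner p
        @ ws)))"
  shows "numbering_ok L V S' P' wt' dg' nm' lm' cr' dc3"
proof -
  have inj: "inj_on nm (V - S)" using nok by (simp add: numbering_ok_def)
  have low': "low nm' (inner r) = low nm (inner r) \<and> nm' (low nm (inner r)) = nm (low nm (inner r))"
    if "P' g = Some r" "g \<noteq> e" "inner r \<noteq> []" for g r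
  proof -
    have "hd (inner r) \<notin> set ws" "last (inner r) \<notin> set ws"
      using ws_other[OF that(1,2)] hd_in_set[OF that(3)] last_in_set[OF that(3)] by (auto simp:
          disjoint_iff)
    then show ?thesis using nm' unfolding low_def by simp
  qed
  have new_low: "low nm' (inner p @ ws) \<in> set (inner p @ ws)" by (rule low_in) simp
  have key: "nm u \<noteq> nm v" if "P g = Some r" "P h = Some s" "g \<noteq> h" "u \<in> set (inner r)" "v \<in> set
      (inner s)" for g h r s u v
  proof -
    have "u \<noteq> v" using inner_unique[OF that(1,2)] that(3-5) by blast
    moreover have "u \<in> V - S" "v \<in> V - S"
      using inner_subset[OF path[OF that(1)]] inner_subset[OF path[OF that(2)]] that(4,5) by blast+
    ultimately show ?thesis using inj by (auto simp: inj_on_def)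
  qed
  show ?thesis
    unfolding numbering_ok_def
  proof (intro conjI allI impI ballI)
    show "inj_on nm' (V - S')" by (rule inj')
    show "nm' v < 2 * int cr' * int L + int L" for v by (rule bound)
    fix g r assume gr: "P' g = Some r \<and> inner r \<noteq> []"
    then have g: "P' g = Some r" and r: "inner r \<noteq> []" by auto
    show "\<exists>\<sigma>. oriented L cr' (V - S') nm' lm' wt' dg' (room V dg' P' g) \<sigma> r"
    proof (cases "g = e")
      case True
      then show ?thesis using o' g by auto
    next
      case False
      have Pg: "P g = Some r" using other[OF g False] by blast
      obtain \<sigma> where \<sigma>: "oriented L cr (V - S) nm lm wt dg (room V dg P g) \<sigma> r"
        using nok Pg r unfolding numbering_ok_def by blast
      have room: "room V dg P g \<le> room V dg' P' g" using room' g by blast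
      \<comment> \<open>The centre and the distance bound carry over; only the numbers given to
        \<open>ws\<close> need \<open>new\<close>.\<close>
      have step: "open_end L cr' (V - S') nm' (room V dg' P' g) \<tau> (nm' v)"
        if o: "open_end L cr (V - S) nm (room V dg P g) \<tau> (nm v)" and v: "v \<in> set (inner r)"
          and \<tau>: "\<tau> = 1 \<or> \<tau> = - 1" for \<tau> v
      proof -
        obtain j where j: "j \<in> {1..cr}" "\<bar>nm v - 2 * int j * int L\<bar> < int L"
          "\<forall>u \<in> V - S. \<tau> * nm u \<le> \<tau> * nm v \<or> \<tau> * (2 * int j * int L) + int L \<le> \<tau> * nm u"
          "\<tau> * (nm v - 2 * int j * int L) < int (room V dg P g)"
          using o unfolding open_end_def by blast
        have vN: "v \<in> V - S" "v \<notin> set (inner p)"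
          using inner_subset[OF path[OF Pg]] v inner_unique[OF Pg Pe v] False by blast+
        have nv: "nm' v = nm v" using nm' ws_other[OF g False] v by blast
        have "\<tau> * nm' u \<le> \<tau> * nm v \<or> \<tau> * (2 * int j * int L) + int L \<le> \<tau> * nm' u" if "u \<in> V - S'"
            for u
        proof (cases "u \<in> set ws")
          case True
          then show ?thesis using new[OF _ vN \<tau> j(1,2,3)] by blast
        next
          case False
          then show ?thesis using j(3) nm'[of u] that N' by auto
        qed
        then show ?thesis
          unfolding open_end_def nv using j(1,2,4) cr room by (intro bexI[of _ j]) auto
      qed
      have "set (path_edges (inner r)) \<subseteq> E" using path_edges_inner[of r] path[OF Pg] by (auto
          simp: rpath_def)
      then have "chain nm' lm' wt' \<sigma> (inner r) \<longleftrightarrow> chain nm lm wt \<sigma> (inner r)"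
        using nm' lm' wt' ws_other[OF g False] by (intro chain_cong) blast+
      moreover have "nm' (hd r) = nm (hd r)" "nm' (last r) = nm (last r)" "nm' (hd (inner r)) = nm
          (hd (inner r))"
        using nm' ends_S'[OF g] ws_other[OF g False] hd_in_set[OF r] by blast+
      moreover have sg: "\<sigma> = 1 \<or> \<sigma> = - 1" "- \<sigma> = 1 \<or> - \<sigma> = - 1" using \<sigma> by (auto simp: oriented_def)
      have "open_end L cr' (V - S') nm' (room V dg' P' g) \<sigma> (nm' (last (inner r)))" if "dg (last
          r) = 1"
        using \<sigma> that unfolding oriented_def by (intro step last_in_set r sg) blast
      moreover have "open_end L cr' (V - S') nm' (room V dg' P' g) (- \<sigma>) (nm' (hd (inner r)))" if
          "dg (hd r) = 1"
        using \<sigma> that unfolding oriented_def by (intro step hd_in_set r sg) blast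
      ultimately have "oriented L cr' (V - S') nm' lm' wt' dg' (room V dg' P' g) \<sigma> r"
        using \<sigma> unfolding oriented_def dg'_other[OF g False] by presburger
      then show ?thesis by blast
    qed
    show "dc3 (nm' (low nm' (inner r))) = Some (g, length (inner r), low nm' (inner r))"
    proof (cases "g = e")
      case True
      then have "r = p @ q" using g by simp
      then show ?thesis using True by (simp add: p_q(2) dc3)
    next
      case False
      have Pg: "P g = Some r" "g \<notin> F" using other[OF g False] by auto
      let ?l = "low nm (inner r)"
      have l: "?l \<in> set (inner r)" using low_in r by blast
      have "nm' ?l \<noteq> nm' (low nm' (inner p @ ws))"
      proof
        assume eq: "nm' ?l = nm' (low nm' (inner p @ ws))"
        have "?l \<in> V - S'" using l j.inner_subset[OF j.path[OF g]] by blast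
        moreover have "low nm' (inner p @ ws) \<in> V - S'"
          using new_low j.inner_subset[OF j.path[OF P'_e]] unfolding p_q(2) by blast
        ultimately have "?l = low nm' (inner p @ ws)" using inj' eq by (auto simp: inj_on_def)
        then have "?l \<in> set (inner (p @ q))" using new_low unfolding p_q(2) by simp
        from j.inner_unique[OF g P'_e l this] show False using False by blast
      qed
      moreover have "nm ?l \<noteq> nm (low nm (inner p))" if "inner p \<noteq> []"
        using key[OF Pg(1) Pe False l low_in[OF that]] .
      moreover have "nm ?l \<noteq> nm (low nm (inner q))" if "F \<noteq> {}" "inner q \<noteq> []"
      proof -
        obtain f where f: "f \<in> F" using \<open>F \<noteq> {}\<close> by blast
        have qf: "P f = Some q" using props(12)[OF f] by blast
        have "g \<noteq> f" using Pg(2) f by blast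
        from key[OF Pg(1) qf this l low_in[OF that(2)]] show ?thesis .
      qed
      moreover have "dc (nm ?l) = Some (g, length (inner r), ?l)"
        using nok Pg(1) r unfolding numbering_ok_def by blast
      ultimately show ?thesis using low'[OF g False r] by (auto simp: dc3 dc2 dc1)
    qed
  next
    fix k assume k: "k \<in> dom dc3"
    show "\<exists>g r. P' g = Some r \<and> inner r \<noteq> [] \<and> k = nm' (low nm' (inner r))"
    proof (cases "k = nm' (low nm' (inner p @ ws))")
      case True
      then show ?thesis using p_q(2) P'_e by (intro exI[of _ e] exI[of _ "p @ q"]) simp
    next
      case False
      then have "k \<in> dom dc2" using k by (simp add: dc3)
      then have kp: "inner p \<noteq> [] \<Longrightarrow> k \<noteq> nm (low nm (inner p))" and "k \<in> dom dc1"
        by (auto simp: dc2 split: if_splits)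
      then have kq: "F \<noteq> {} \<Longrightarrow> inner q \<noteq> [] \<Longrightarrow> k \<noteq> nm (low nm (inner q))" and "k \<in> dom dc"
        by (auto simp: dc1 split: if_splits)
      then obtain g r where g: "P g = Some r" "inner r \<noteq> []" "k = nm (low nm (inner r))"
        using nok unfolding numbering_ok_def by blast
      have "g \<noteq> e" using g Pe kp by auto
      moreover have "g \<notin> F" using g props(12)[of g] kq by auto
      ultimately have "P' g = Some r" using other' g(1) by blast
      then show ?thesis using low'[OF _ \<open>g \<noteq> e\<close> g(2)] g by metis
    qed
  qed
qed

end

section \<open>Numbers of a continued or newly created interval\<close>

lemma chain_number:
  assumes "chain nm lm wt \<sigma> (u # ws)" "w \<in> set ws"
  obtains i where "1 \<le> i" "i \<le> int (length ws)" "nm w = nm u + \<sigma> * i"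
proof -
  obtain k where k: "k < length ws" "w = ws ! k" using assms(2) by (auto simp: in_set_conv_nth)
  have "nm ((u # ws) ! Suc k) = nm u + \<sigma> * int (Suc k)" using chain_nth[OF assms(1), of "Suc k"]
      k(1) by simp
  then show ?thesis using that[of "int (Suc k)"] k by simp
qed

lemma chain_inj_on:
  assumes "chain nm lm wt \<sigma> vs" "\<sigma> = 1 \<or> \<sigma> = - 1"
  shows "inj_on nm (set vs)"
proof
  fix a b assume "a \<in> set vs" "b \<in> set vs" "nm a = nm b"
  then obtain i k where "i < length vs" "a = vs ! i" "k < length vs" "b = vs ! k" by (auto simp:
      in_set_conv_nth)
  then show "a = b" using chain_nth[OF assms(1)] assms(2) \<open>nm a = nm b\<close> by auto
qed

lemma inj_on_update:
  assumes "inj_on f A" "\<And>v. v \<notin> W \<Longrightarrow> f' v = f v" "inj_on f' W"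
    "\<And>v v'. v \<in> W \<Longrightarrow> v' \<in> A \<Longrightarrow> v' \<notin> W \<Longrightarrow> f' v \<noteq> f' v'"
  shows "inj_on f' (A \<union> W)"
proof
  fix a b assume ab: "a \<in> A \<union> W" "b \<in> A \<union> W" "f' a = f' b"
  consider "a \<in> W" "b \<in> W" | "a \<in> W" "b \<notin> W" | "a \<notin> W" "b \<in> W" | "a \<notin> W" "b \<notin> W" by blast
  then show "a = b"
  proof cases
    case 1
    then show ?thesis using assms(3) ab(3) by (simp add: inj_on_def)
  next
    case 2
    then show ?thesis using assms(4)[of a b] ab by blast
  next
    case 3
    then show ?thesis using assms(4)[of b a] ab by auto
  next
    case 4
    then have "f a = f b" "a \<in> A" "b \<in> A" using assms(2) ab by auto
    then show ?thesis using assms(1) by (simp add: inj_on_def)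
  qed
qed

context joining
begin

lemma chain_join:
  assumes nm': "\<And>v. v \<notin> set ws \<Longrightarrow> nm' v = nm v" and lm': "\<And>v. v \<notin> set ws \<Longrightarrow> lm' v = lm v"
    and wt': "\<And>ed. ed \<in> E \<Longrightarrow> wt' ed = wt ed"
    and vs: "inner p \<noteq> []" and c: "chain nm lm wt \<sigma> (inner p)"
    and ch: "chain nm' lm' wt' \<sigma> (last (inner p) # ws)"
  shows "chain nm' lm' wt' \<sigma> (inner p @ ws)"
proof -
  let ?u = "last (inner p)"
  have "set (path_edges (inner p)) \<subseteq> E" using path_edges_inner[of p] path[OF Pe] by (auto simp:
      rpath_def)
  then have "chain nm' lm' wt' \<sigma> (inner p) \<longleftrightarrow> chain nm lm wt \<sigma> (inner p)"
    using nm' lm' wt' ws_subset(2) by (intro chain_cong) blast+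
  then have "chain nm' lm' wt' \<sigma> (butlast (inner p) @ [?u])" using c vs by simp
  then have "chain nm' lm' wt' \<sigma> (butlast (inner p) @ ?u # ws)" using ch by (subst chain_append)
      blast
  then show ?thesis
    using append_butlast_last_id[OF vs] by (metis append.assoc append_Cons append_Nil)
qed

text \<open>The fresh numbers occupy slots that \<open>open_end\<close> declares free at the last
  regular vertex of \<open>p\<close>. An open end at \<open>hd p\<close> looks in the opposite
  direction, so \<open>new_number\<close> protects it in the same way as the ends of other
  paths.\<close>

lemma numbering_ok_grow:
  assumes nok: "numbering_ok L V S P wt dg nm lm cr dc"
    and vs: "inner p \<noteq> []" and o: "oriented L cr (V - S) nm lm wt dg (room V dg P e) \<sigma> p"
    and nm': "\<And>v. v \<notin> set ws \<Longrightarrow> nm' v = nm v" and lm': "\<And>v. v \<notin> set ws \<Longrightarrow> lm' v = lm v"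
    and wt': "\<And>ed. ed \<in> E \<Longrightarrow> wt' ed = wt ed"
    and ch: "chain nm' lm' wt' \<sigma> (last (inner p) # ws)"
    and L: "2 * card {v \<in> V. 2 \<le> dg' v} \<le> L"
    and dc1: "dc1 = (if F \<noteq> {} \<and> inner q \<noteq> [] then dc(nm (low nm (inner q)) := None) else dc)"
    and dc3: "dc3 = (dc1(nm (low nm (inner p)) := None))
      (nm' (low nm' (inner p @ ws)) \<mapsto> (e, length (inner p @ ws), low nm' (inner p @ ws)))"
  shows "numbering_ok L V S' P' wt' dg' nm' lm' cr dc3"
proof -
  let ?u = "last (inner p)" and ?n = "int (length ws)"
  have u: "?u \<in> set (inner p)" "?u \<in> V - S" "?u \<notin> set ws"
    using vs inner_subset[OF path[OF Pe]] last_in_set[OF vs] ws_subset(2) by blast+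
  have sg: "\<sigma> = 1 \<or> \<sigma> = - 1" using o by (simp add: oriented_def)
  have inj: "inj_on nm (V - S)" and bnd: "\<And>v. nm v < 2 * int cr * int L + int L"
    using nok by (auto simp: numbering_ok_def)
  have "open_end L cr (V - S) nm (room V dg P e) \<sigma> (nm ?u)"
    using o dg_x last_p by (simp add: oriented_def)
  then obtain j where j: "j \<in> {1..cr}" "\<bar>nm ?u - 2 * int j * int L\<bar> < int L"
    "\<forall>v \<in> V - S. \<sigma> * nm v \<le> \<sigma> * nm ?u \<or> \<sigma> * (2 * int j * int L) + int L \<le> \<sigma> * nm v"
    "\<sigma> * (nm ?u - 2 * int j * int L) < int (room V dg P e)"
    unfolding open_end_def by blast
  define c where "c = 2 * int j * int L"
  \<comment> \<open>\<open>room\<close> and the number of new slots are each at most half of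
    \<open>L\<close>, so the growing end stays in the window of its centre.\<close>
  have far: "\<sigma> * (nm ?u - c) + ?n < int L"
    using j(4) room_le[of e] length_ws L unfolding c_def by linarith
  have w: "\<sigma> * nm ?u < \<sigma> * nm' v \<and> \<sigma> * nm' v \<le> \<sigma> * nm ?u + ?n \<and> \<bar>nm' v - c\<bar> < int L" if v: "v \<in>
      set ws" for v
  proof -
    obtain i where i: "1 \<le> i" "i \<le> ?n" "nm' v = nm' ?u + \<sigma> * i" using chain_number[OF ch v] by blast
    have "\<bar>nm ?u - c\<bar> < int L" using j(2) unfolding c_def .
    then show ?thesis using i nm'[OF u(3)] far sg by auto
  qed
  have last_ws: "nm' (last ws) = nm ?u + \<sigma> * ?n"
    using chain_last[OF ch] nm'[OF u(3)] by simp
  have old: "\<sigma> * nm' v \<le> \<sigma> * nm ?u \<or> \<sigma> * c + int L \<le> \<sigma> * nm' v" if "v \<in> V - S'" "v \<notin> set ws" for v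
    using j(3) nm' that N' unfolding c_def by auto
  have inj': "inj_on nm' (V - S')"
    unfolding N'
  proof (rule inj_on_update[OF inj nm'])
    show "inj_on nm' (set ws)" using chain_inj_on[OF ch sg] by (rule inj_on_subset) auto
    show "nm' v \<noteq> nm' v'" if "v \<in> set ws" "v' \<in> V - S" "v' \<notin> set ws" for v v'
      using w[OF that(1)] old[of v'] that(2,3) N' sg by auto
  qed
  have bound: "nm' v < 2 * int cr * int L + int L" for v
  proof (cases "v \<in> set ws")
    case True
    have "int j * (2 * int L) \<le> int cr * (2 * int L)" using j(1) by (intro mult_right_mono) auto
    then have "c \<le> 2 * int cr * int L" unfolding c_def by (simp add: algebra_simps)
    then show ?thesis using w[OF True] by linarith
  next
    case False
    then show ?thesis using bnd nm' by simp
  qed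
  have new: "\<tau> * nm' v \<le> \<tau> * nm t \<or> \<tau> * (2 * int i * int L) + int L \<le> \<tau> * nm' v"
    if "v \<in> set ws" "t \<in> V - S" "t \<notin> set (inner p) \<or> \<tau> \<noteq> \<sigma>" "\<tau> = 1 \<or> \<tau> = - 1" "i \<in> {1..cr}"
      "\<bar>nm t - 2 * int i * int L\<bar> < int L"
      "\<forall>u \<in> V - S. \<tau> * nm u \<le> \<tau> * nm t \<or> \<tau> * (2 * int i * int L) + int L \<le> \<tau> * nm u" for v t \<tau> i
  proof (rule new_number[OF sg that(4) _ _ j(2) that(6)])
    show "\<bar>nm' v - 2 * int j * int L\<bar> < int L" "\<sigma> * nm ?u < \<sigma> * nm' v" using w[OF that(1)]
        unfolding c_def by auto
    show "\<sigma> * nm t \<le> \<sigma> * nm ?u \<or> \<sigma> * (2 * int j * int L) + int L \<le> \<sigma> * nm t" using j(3) that(2) by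
        blast
    show "\<tau> * nm ?u \<le> \<tau> * nm t \<or> \<tau> * (2 * int i * int L) + int L \<le> \<tau> * nm ?u" using that(7) u(2)
        by blast
    \<comment> \<open>An end of another path has another number; the remaining end of
      \<open>p\<close> itself points the other way.\<close>
    show "nm t \<noteq> nm ?u \<or> \<tau> \<noteq> \<sigma>" using that(2,3) u inj by (auto simp: inj_on_def)
  qed
  have o': "oriented L cr (V - S') nm' lm' wt' dg' (room V dg' P' e) \<sigma> (p @ q)"
    unfolding oriented_def p_q(2-4)
  proof (intro conjI impI)
    show "\<sigma> = 1 \<or> \<sigma> = - 1" by (rule sg)
    show "chain nm' lm' wt' \<sigma> (inner p @ ws)"
      using o chain_join[OF nm' lm' wt' vs _ ch] by (simp add: oriented_def)
    show "open_end L cr (V - S') nm' (room V dg' P' e) \<sigma> (nm' (last (inner p @ ws)))" if "dg'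
        (last q) = 1"
      unfolding open_end_def
    proof (intro bexI[of _ j] conjI ballI)
      have l: "last (inner p @ ws) = last ws" "last ws \<in> set ws" by auto
      show "\<bar>nm' (last (inner p @ ws)) - 2 * int j * int L\<bar> < int L"
        using w[OF l(2)] unfolding l(1) c_def by blast
      show "\<sigma> * nm' v \<le> \<sigma> * nm' (last (inner p @ ws)) \<or> \<sigma> * (2 * int j * int L) + int L \<le> \<sigma> * nm' v"
        if "v \<in> V - S'" for v
      proof (cases "v \<in> set ws")
        case True
        have "\<sigma> * (nm ?u + \<sigma> * ?n) = \<sigma> * nm ?u + ?n" using sg by auto
        then show ?thesis using w[OF True] unfolding l(1) last_ws by linarith
      next
        case False
        have "\<sigma> * nm ?u \<le> \<sigma> * nm' (last ws)" using w[OF l(2)] by linarith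
        then show ?thesis using old[OF that False] unfolding l(1) c_def[symmetric] by linarith
      qed
      have "\<sigma> * (nm' (last ws) - c) = \<sigma> * (nm ?u - c) + ?n" using sg unfolding last_ws by auto
      then show "\<sigma> * (nm' (last (inner p @ ws)) - 2 * int j * int L) < int (room V dg' P' e)"
        using j(4) room'_e[OF \<open>dg' (last q) = 1\<close>] unfolding l(1) c_def by linarith
      show "j \<in> {1..cr}" by (rule j(1))
    qed
    show "open_end L cr (V - S') nm' (room V dg' P' e) (- \<sigma>) (nm' (hd (inner p @ ws)))" if "dg'
        (hd p) = 1"
    proof -
      have h: "hd (inner p @ ws) = hd (inner p)" using vs by simp
      have hN: "hd (inner p) \<in> V - S" "nm' (hd (inner p)) = nm (hd (inner p))"
        using inner_subset[OF path[OF Pe]] hd_in_set[OF vs] nm' ws_subset(2) by blast+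
      have "open_end L cr (V - S) nm (room V dg P e) (- \<sigma>) (nm (hd (inner p)))"
        using o that unfolding dg'_hd oriented_def by blast
      then obtain i where i: "i \<in> {1..cr}" "\<bar>nm (hd (inner p)) - 2 * int i * int L\<bar> < int L"
        "\<forall>v \<in> V - S. - \<sigma> * nm v \<le> - \<sigma> * nm (hd (inner p)) \<or> - \<sigma> * (2 * int i * int L) + int L \<le> -
            \<sigma> * nm v"
        "- \<sigma> * (nm (hd (inner p)) - 2 * int i * int L) < int (room V dg P e)"
        unfolding open_end_def by blast
      have neg: "- \<sigma> = 1 \<or> - \<sigma> = - 1" "- \<sigma> \<noteq> \<sigma>" using sg by auto
      show ?thesis unfolding open_end_def h hN(2)
      proof (intro bexI[of _ i] conjI ballI)
        show "\<bar>nm (hd (inner p)) - 2 * int i * int L\<bar> < int L" by (rule i(2))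
        show "- \<sigma> * (nm (hd (inner p)) - 2 * int i * int L) < int (room V dg' P' e)"
          using i(4) room'[of e] P'_e by fastforce
        show "- \<sigma> * nm' v \<le> - \<sigma> * nm (hd (inner p)) \<or> - \<sigma> * (2 * int i * int L) + int L \<le> - \<sigma> *
            nm' v"
          if "v \<in> V - S'" for v
        proof (cases "v \<in> set ws")
          case True
          from new[OF True hN(1) disjI2[OF neg(2)] neg(1) i(1,2,3)] show ?thesis .
        next
          case False
          then show ?thesis using i(3) nm'[OF False] that N' by auto
        qed
      qed (rule i(1))
    qed
  qed (use vs in auto)
  show ?thesis
    by (rule numbering_ok_join[OF nok nm' lm' wt' order.refl inj' bound _ o' dc1])
      (use new vs dc3 in auto)
qed

text \<open>All numbers in the memory, stale ones included, lie below the window of the new centre,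
  so both directions are free initially.\<close>

lemma numbering_ok_fresh:
  assumes nok: "numbering_ok L V S P wt dg nm lm cr dc"
    and vs: "inner p = []"
    and nm': "\<And>v. v \<notin> set ws \<Longrightarrow> nm' v = nm v" and lm': "\<And>v. v \<notin> set ws \<Longrightarrow> lm' v = lm v"
    and wt': "\<And>ed. ed \<in> E \<Longrightarrow> wt' ed = wt ed"
    and x: "nm' x = 2 * int (Suc cr) * int L" and ch: "chain nm' lm' wt' 1 ws"
    and L: "2 * card {v \<in> V. 2 \<le> dg' v} \<le> L"
    and dc1: "dc1 = (if F \<noteq> {} \<and> inner q \<noteq> [] then dc(nm (low nm (inner q)) := None) else dc)"
    and dc3: "dc3 = dc1(nm' x \<mapsto> (e, length ws, x))"
  shows "numbering_ok L V S' P' wt' dg' nm' lm' (Suc cr) dc3"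
proof -
  define c where "c = 2 * int (Suc cr) * int L"
  have inj: "inj_on nm (V - S)" and bnd: "\<And>v. nm v < 2 * int cr * int L + int L"
    using nok by (auto simp: numbering_ok_def)
  have bnd': "nm v < c - int L" for v using bnd[of v] unfolding c_def by (simp add: algebra_simps)
  have n: "int (length ws) < int L" using length_ws L by simp
  have w: "c \<le> nm' v \<and> nm' v \<le> c + int (length ws) - 1" if v: "v \<in> set ws" for v
  proof -
    obtain i where "i < length ws" "v = ws ! i" using v unfolding in_set_conv_nth by blast
    then show ?thesis using chain_nth[OF ch, of i] x unfolding c_def by auto
  qed
  have old: "nm' v < c - int L" if "v \<notin> set ws" for v using bnd' nm'[OF that] by simp
  have inj': "inj_on nm' (V - S')"
    unfolding N'
  proof (rule inj_on_update[OF inj nm'])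
    show "inj_on nm' (set ws)" using chain_inj_on[OF ch] by simp
    show "nm' v \<noteq> nm' v'" if "v \<in> set ws" "v' \<in> V - S" "v' \<notin> set ws" for v v'
      using w[OF that(1)] old[OF that(3)] by linarith
  qed
  have bound: "nm' v < 2 * int (Suc cr) * int L + int L" for v
    using w[of v] old[of v] n unfolding c_def[symmetric] by (cases "v \<in> set ws") auto
  have new: "\<tau> * nm' v \<le> \<tau> * nm t \<or> \<tau> * (2 * int i * int L) + int L \<le> \<tau> * nm' v"
    if "v \<in> set ws" "t \<in> V - S" "\<tau> = 1 \<or> \<tau> = - 1" "i \<in> {1..cr}" for v t \<tau> i
  proof -
    have "2 * int i * int L + 2 * int L \<le> c" unfolding c_def using that(4) by (intro centre_mono)
        auto
    then show ?thesis using w[OF that(1)] bnd'[of t] that(3) by auto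
  qed
  have len: "length ws \<le> room V dg' P' e" using room'_pos[OF _ P'_e] vs unfolding p_q(2) by simp
  have lastws: "nm' (last ws) = c + int (length ws) - 1"
    using chain_last[OF ch] x unfolding c_def by simp
  have up: "open_end L (Suc cr) (V - S') nm' (room V dg' P' e) 1 (nm' (last ws))"
    unfolding open_end_def
  proof (intro bexI[of _ "Suc cr"] conjI ballI, unfold c_def[symmetric] lastws)
    show "1 * nm' v \<le> 1 * (c + int (length ws) - 1) \<or> 1 * c + int L \<le> 1 * nm' v" for v
      using w[of v] old[of v] by (cases "v \<in> set ws") auto
  qed (use n len in auto)
  have down: "open_end L (Suc cr) (V - S') nm' (room V dg' P' e) (- 1) (nm' x)"
    unfolding open_end_def
  proof (intro bexI[of _ "Suc cr"] conjI ballI, unfold c_def[symmetric] x)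
    show "- 1 * nm' v \<le> - 1 * c \<or> - 1 * c + int L \<le> - 1 * nm' v" for v
      using w[of v] old[of v] by (cases "v \<in> set ws") auto
  qed (use n len in auto)
  have ends: "nm' (hd p) \<noteq> nm' x + 1" "nm' (last q) \<noteq> nm' x + 1"
  proof -
    have "hd p \<notin> set ws" "last q \<notin> set ws" using ends_S'[OF P'_e] p_q(3,4) by auto
    then show "nm' (hd p) \<noteq> nm' x + 1" "nm' (last q) \<noteq> nm' x + 1"
      using old[of "hd p"] old[of "last q"] unfolding x c_def[symmetric] by auto
  qed
  \<comment> \<open>For a single vertex with a closed last end, \<open>- 1\<close> makes the end at
    \<open>hd p\<close> point upwards, where \<open>grow\<close> continues unless the slot above is
    marked by its other neighbour.\<close>
  define \<sigma> :: int where "\<sigma> = (if length ws = 1 \<and> dg' (last q) \<noteq> 1 then - 1 else 1)"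
  have o': "oriented L (Suc cr) (V - S') nm' lm' wt' dg' (room V dg' P' e) \<sigma> (p @ q)"
  proof (cases "length ws = 1")
    case True
    then have "butlast q = []" by (cases q) auto
    then show ?thesis using up down ends unfolding oriented_def p_q(2-4) vs \<sigma>_def
      by (auto simp del: fun_upd_apply)
  next
    case False
    then show ?thesis using up down ch unfolding oriented_def p_q(2-4) vs \<sigma>_def
      by (auto simp del: fun_upd_apply)
  qed
  have "low nm' ws = x" using low_up[OF ch] by simp
  then show ?thesis
    by (intro numbering_ok_join[OF nok nm' lm' wt' _ inj' bound _ o' dc1 refl])
      (use new vs dc3 in auto)
qed

end

text \<open>The condition equivalent to \<open>\<sigma> = 1\<close> is the test made by
  \<open>grow\<close>. With several regular vertices, being at the top of the interval decides; with
  one, the stale number at \<open>hd p\<close> does.\<close>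

lemma (in decomposition) growth_direction:
  assumes nok: "numbering_ok L V S P wt dg nm lm cr dc" and P: "P e = Some p" "inner p \<noteq> []" "dg
      (last p) = 1"
  defines "k \<equiv> nm (last (inner p))"
  shows "\<exists>\<sigma>. oriented L cr (V - S) nm lm wt dg (room V dg P e) \<sigma> p \<and>
    (\<sigma> = 1 \<longleftrightarrow> k = nm (low nm (inner p)) + int (length (inner p)) - 1 \<and> (1 < length (inner p) \<or> nm
        (hd p) \<noteq> k + 1))"
proof -
  obtain \<sigma> where o: "oriented L cr (V - S) nm lm wt dg (room V dg P e) \<sigma> p"
    using nok P(1,2) unfolding numbering_ok_def by blast
  have sg: "\<sigma> = 1 \<or> \<sigma> = - 1" using o by (simp add: oriented_def)
  have ch: "chain nm lm wt \<sigma> (inner p)" using o by (simp add: oriented_def)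
  show ?thesis
  proof (cases "length (inner p) = 1")
    case True
    then obtain v where v: "inner p = [v]" by (auto simp: length_Suc_conv)
    have k: "k = nm v" "nm (low nm (inner p)) = nm v" by (auto simp: k_def v low_def)
    show ?thesis
    proof (cases "dg (hd p) = 1")
      case True
      have ne: "nm (hd p) \<noteq> k + 1" using o P(3) True unfolding oriented_def k v by auto
      \<comment> \<open>Both directions are open at the single vertex, so either orientation is
        valid and the one taken by \<open>grow\<close> may be assumed.\<close>
      have "oriented L cr (V - S) nm lm wt dg (room V dg P e) 1 p"
        using o sg P(3) True unfolding oriented_def v by auto
      then show ?thesis using ne unfolding k v by (intro exI[of _ 1]) (auto simp: low_def)
    next
      case False
      have "nm (hd p) = k + 1 \<longleftrightarrow> \<sigma> = - 1" using o P(3) False unfolding oriented_def k v by auto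
      then show ?thesis using o sg unfolding k v by (intro exI[of _ \<sigma>]) (auto simp: low_def)
    qed
  next
    case False
    then have l: "1 < length (inner p)" using P(2) by (cases "inner p") auto
    have "k = nm (hd (inner p)) + \<sigma> * int (length (inner p) - 1)" using chain_last[OF ch P(2)] by
        (simp add: k_def)
    moreover have "\<sigma> = 1 \<Longrightarrow> low nm (inner p) = hd (inner p)" "\<sigma> = - 1 \<Longrightarrow> low nm (inner p) = last
        (inner p)"
      using low_up low_down ch P(2) by blast+
    ultimately have "\<sigma> = 1 \<longleftrightarrow> k = nm (low nm (inner p)) + int (length (inner p)) - 1"
      using sg l by (auto simp: k_def of_nat_diff)
    then show ?thesis using o l by (intro exI[of _ \<sigma>]) auto
  qed
qed

text \<open>The new path has no regular vertex, and no end of an old path gains or loses degree one: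
  such an end at \<open>x\<close> or \<open>y\<close> already has degree at least two.\<close>

lemma (in decomposition) numbering_ok_add:
  assumes nok: "numbering_ok L V S P wt dg nm lm cr dc"
    and dg: "\<And>v. dg v = card {ed \<in> E. v \<in> ed}" and xy: "dg x \<noteq> 1" "dg y \<noteq> 1" "x \<noteq> y"
    and e: "e \<notin> dom P" and wt': "\<And>ed. ed \<in> E \<Longrightarrow> wt' ed = wt ed"
  defines "dg' \<equiv> dg(x := dg x + 1, y := dg y + 1)"
  shows "numbering_ok L V S (P(e \<mapsto> [x, y])) wt' dg' nm lm cr dc"
proof -
  have Pe: "P e = None" using e by auto
  have end1: "dg' (hd r) = 1 \<longleftrightarrow> dg (hd r) = 1" "dg' (last r) = 1 \<longleftrightarrow> dg (last r) = 1" if "P g = Some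
      r" for g r
    using end_degree[OF that] xy unfolding dg[symmetric] dg'_def by auto
  have "free_inner dg' (P(e \<mapsto> [x, y])) g \<subseteq> free_inner dg P g" for g
    unfolding subset_iff free_inner_iff using end1 by (auto split: if_splits)
  then have room: "room V dg P g \<le> room V dg' (P(e \<mapsto> [x, y])) g" for g
    using finite_V by (intro room_mono) (auto simp: dg'_def)
  show ?thesis
    unfolding numbering_ok_def
  proof (intro conjI allI impI ballI)
    show "inj_on nm (V - S)" "nm v < 2 * int cr * int L + int L" for v
      using nok by (auto simp: numbering_ok_def)
    fix g r assume g: "(P(e \<mapsto> [x, y])) g = Some r \<and> inner r \<noteq> []"
    then have "g \<noteq> e" by auto
    then have gr: "P g = Some r" "inner r \<noteq> []" using g by auto
    then obtain \<sigma> where "oriented L cr (V - S) nm lm wt dg (room V dg P g) \<sigma> r"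
      using nok unfolding numbering_ok_def by blast
    from oriented_mono[OF this order.refl room]
    have o: "oriented L cr (V - S) nm lm wt dg (room V dg' (P(e \<mapsto> [x, y])) g) \<sigma> r" .
    have "set (path_edges (inner r)) \<subseteq> E" using path_edges_inner[of r] path[OF gr(1)] by (auto
        simp: rpath_def)
    then have "chain nm lm wt' \<sigma> (inner r) \<longleftrightarrow> chain nm lm wt \<sigma> (inner r)"
      using wt' by (intro chain_cong) blast+
    then have "oriented L cr (V - S) nm lm wt' dg' (room V dg' (P(e \<mapsto> [x, y])) g) \<sigma> r"
      using o end1[OF gr(1)] unfolding oriented_def by presburger
    then show "\<exists>\<sigma>. oriented L cr (V - S) nm lm wt' dg' (room V dg' (P(e \<mapsto> [x, y])) g) \<sigma> r" by blast
    show "dc (nm (low nm (inner r))) = Some (g, length (inner r), low nm (inner r))"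
      using nok gr unfolding numbering_ok_def by blast
  next
    fix k assume "k \<in> dom dc"
    then obtain g r where "P g = Some r" "inner r \<noteq> []" "k = nm (low nm (inner r))"
      using nok unfolding numbering_ok_def by blast
    then show "\<exists>g r. (P(e \<mapsto> [x, y])) g = Some r \<and> inner r \<noteq> [] \<and> k = nm (low nm (inner r))"
      using Pe by (intro exI[of _ g] exI[of _ r]) auto
  qed
qed

section \<open>The invariant\<close>

text \<open>The set \<open>S\<close> is read off the flags, not the degrees, so that the state
  between a split and the edge insertion is included. The agreement of flags and degrees is tracked
  separately.\<close>

definition state_ok ::
    "nat \<Rightarrow> 'v set \<Rightarrow> 'v set set \<Rightarrow> ('v set \<Rightarrow> real) \<Rightarrow> 'v mem \<Rightarrow> (nat \<Rightarrow> 'v list option) \<Rightarrow> bool" where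
  "state_ok L V E wt m P \<longleftrightarrow>
     decomposition V E {v. sing m v} P \<and> adj_ok E wt (deg m) (adj m) \<and> (\<forall>ed \<in> E. 0 < wt ed) \<and>
     tedges_ok wt (deg m) P (tedge m) (tinc m) (next_id m) \<and>
     numbering_ok L V {v. sing m v} P wt (deg m) (num m) (lam m) (created m) (dict m)"

text \<open>
  The potential pays for renumbering. A path with two ends of degree one stems from merges only,
  so that its vertices are charged as in union by size. Afterwards a vertex pays one unit whenever
  an end of degree one of its path disappears.
\<close>

definition pot :: "real \<Rightarrow> ('v \<Rightarrow> nat) \<Rightarrow> 'v list \<Rightarrow> real" where
  "pot A dg p =
     (if dg (hd p) = 1 \<and> dg (last p) = 1 then real (length (inner p)) * (A - log 2 (real (length
         (inner p))))
      else if dg (hd p) = 1 \<or> dg (last p) = 1 then real (length (inner p)) else 0)"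

definition potential :: "real \<Rightarrow> ('v \<Rightarrow> nat) \<Rightarrow> (nat \<Rightarrow> 'v list option) \<Rightarrow> real" where
  "potential A dg P = (\<Sum>e \<in> dom P. pot A dg (the (P e)))"

lemma pot_rev [simp]: "p \<noteq> [] \<Longrightarrow> pot A dg (rev p) = pot A dg p"
  by (auto simp: pot_def hd_rev last_rev)

lemma potential_flip:
  assumes "P e = Some p" "p \<noteq> []"
  shows "potential A dg (P(e \<mapsto> rev p)) = potential A dg P"
proof -
  have "dom (P(e \<mapsto> rev p)) = dom P" using assms by auto
  then show ?thesis unfolding potential_def using assms by (auto intro!: sum.cong)
qed

lemma state_ok_flip:
  assumes "state_ok L V E wt m P" "P e = Some p"
  shows "state_ok L V E wt m (P(e \<mapsto> rev p))"
proof -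
  interpret decomposition V E "{v. sing m v}" P using assms(1) by (simp add: state_ok_def)
  have "p \<noteq> []" using length_path[OF path[OF assms(2)]] by auto
  then show ?thesis
    using assms flip[OF assms(2)] tedges_ok_flip[of wt "deg m" P "tedge m" "tinc m" "next_id m" e
        p] numbering_ok_flip[OF _ assms(2)]
    by (simp add: state_ok_def)
qed

lemma card_dom_update:
  assumes "finite (dom f)"
  shows "card (dom (f(k \<mapsto> i))) \<le> Suc (card (dom f))" "card (dom (f(k := None))) \<le> card (dom f)"
  using assms by (auto simp: card_insert_if card_Diff_singleton_if)

lemma dict_pred_exec:
  assumes "Max {k \<in> dom (dict m). k \<le> q} = k" "dict m k = Some i"
  shows "dict_pred D q m = ((k, i), m, D (dict_size m))"
  using assms by (simp add: dict_pred_def Let_def)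

section \<open>Splitting\<close>

text \<open>The list is turned so that the numbers ascend and \<open>hd p\<close> is the end that
  \<open>split\<close> finds next to the minimal vertex. With a single regular vertex both
  neighbours are flagged and slot 0 is taken, which then fixes the direction.\<close>

lemma split_orientation:
  assumes s: "state_ok L V E wt m P" and x: "x \<in> V" "\<not> sing m x"
  shows "\<exists>P' e p. state_ok L V E wt m P' \<and> (\<forall>A. potential A (deg m) P' = potential A (deg m) P) \<and>
      P' e = Some p \<and>
    x \<in> set (inner p) \<and> chain (num m) (lam m) wt 1 (inner p) \<and>
    (1 < length (inner p) \<longrightarrow> oriented L (created m) (V - {v. sing m v}) (num m) (lam m) wt (deg m)
       (room V (deg m) P' e) 1 p) \<and>
    (if sing m (fst (adj m (hd (inner p)) 0)) then adj m (hd (inner p)) 0 else adj m (hd (inner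
        p)) 1)
      = (hd p, wt {hd p, hd (inner p)})"
proof -
  interpret decomposition V E "{v. sing m v}" P using s by (simp add: state_ok_def)
  have nok: "numbering_ok L V {v. sing m v} P wt (deg m) (num m) (lam m) (created m) (dict m)"
    and adj: "adj_ok E wt (deg m) (adj m)" using s by (auto simp: state_ok_def)
  obtain e p where p: "P e = Some p" "x \<in> set (inner p)" using inner_cover[of x] x by auto
  have ne: "inner p \<noteq> []" using p(2) by auto
  have p2: "2 \<le> length p" using length_path[OF path[OF p(1)]] .
  obtain P2 where P2: "state_ok L V E wt m P2" "P2 e = Some (rev p)"
    "\<forall>A. potential A (deg m) P2 = potential A (deg m) P" "room V (deg m) P2 e = room V (deg m) P e"
    using state_ok_flip[OF s p(1)] potential_flip[of P e p, OF p(1)] room_flip[of P e p, OF p(1)] p2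
    by (metis fun_upd_same list.size(3) not_numeral_le_zero)
  obtain \<sigma> where o: "oriented L (created m) (V - {v. sing m v}) (num m) (lam m) wt (deg m) (room V
      (deg m) P e) \<sigma> p"
    using nok p(1) ne unfolding numbering_ok_def by blast
  have pn: "p \<noteq> []" using p2 by auto
  show ?thesis
  proof (cases "length (inner p) = 1")
    case True
    then have v: "inner p = [x]" using p(2) by (auto simp: length_Suc_conv)
    then have pp: "p = [hd p, x, last p]" using path_ends[OF p2] by simp
    have "linked (adj m) wt p" using linked_path[OF adj path[OF p(1)]] .
    then have nb: "nbrs (adj m) wt x (hd p) (last p)" using pp linkedD by metis
    have sg: "sing m (hd p)" "sing m (last p)" using path[OF p(1)] by (auto simp: rpath_def)
    show ?thesis
    proof (cases "fst (adj m x 0) = hd p")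
      case True
      then show ?thesis using s p v nb sg
        by (intro exI[of _ P] exI[of _ e] exI[of _ p]) (auto simp: nbrs_def)
    next
      case False
      have "inner (rev p) = [x]" "hd (rev p) = last p" using v by (auto simp: hd_rev)
      then show ?thesis using P2 nb sg False
        by (intro exI[of _ P2] exI[of _ e] exI[of _ "rev p"]) (auto simp: nbrs_def insert_commute)
    qed
  next
    case False
    then have l: "1 < length (inner p)" using ne by (cases "inner p") auto
    have adj_low: "(if sing m (fst (adj m (hd (inner r)) 0)) then adj m (hd (inner r)) 0 else adj
        m (hd (inner r)) 1)
      = (hd r, wt {hd r, hd (inner r)})" if r: "rpath E {v. sing m v} r" "1 < length (inner r)"
          for r
    proof -
      obtain v b vs where v: "inner r = v # b # vs" using r(2) by (cases "inner r"; cases "tl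
          (inner r)") auto
      then have "r = hd r # v # b # vs @ [last r]" using path_ends[of r] r(1) by (simp add:
          rpath_def)
      moreover have "linked (adj m) wt r" using linked_path[OF adj r(1)] .
      ultimately have "nbrs (adj m) wt v (hd r) b" using linkedD by metis
      moreover have "sing m (hd r)" "\<not> sing m b" using r(1) v by (auto simp: rpath_def)
      ultimately show ?thesis by (auto simp: nbrs_def v)
    qed
    show ?thesis
    proof (cases "\<sigma> = 1")
      case True
      then show ?thesis using s p o adj_low[OF path[OF p(1)] l]
        by (intro exI[of _ P] exI[of _ e] exI[of _ p]) (simp add: oriented_def)
    next
      case False
      then have "\<sigma> = - 1" using o by (auto simp: oriented_def)
      then have o2: "oriented L (created m) (V - {v. sing m v}) (num m) (lam m) wt (deg m) (room V
          (deg m) P2 e) 1 (rev p)"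
        using oriented_flip[OF o pn ne] P2(4) by simp
      have "rpath E {v. sing m v} (rev p)" using path[OF p(1)] by simp
      note adj_low[OF this]
      moreover have "chain (num m) (lam m) wt 1 (inner (rev p))" using o2 by (simp add:
          oriented_def)
      ultimately show ?thesis using P2 p(2) l o2
        by (intro exI[of _ P2] exI[of _ e] exI[of _ "rev p"]) simp
    qed
  qed
qed

text \<open>The summand 2 in \<open>A\<close> leaves every vertex of a path with two ends of degree
  one at least two units, one for each end that may disappear.\<close>

lemma pot_nonneg:
  assumes "log 2 (real n) + 2 \<le> A" "length (inner p) \<le> n"
  shows "0 \<le> pot A dg p" "dg (hd p) = 1 \<Longrightarrow> dg (last p) = 1 \<Longrightarrow> 2 * real (length (inner p)) \<le> pot A dg
      p"
proof -
  let ?s = "real (length (inner p))"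
  have "2 * ?s \<le> ?s * (A - log 2 ?s)"
  proof (cases "inner p = []")
    case False
    then have "log 2 ?s \<le> log 2 (real n)" using assms(2) by (intro log_mono) (auto simp: Suc_le_eq)
    then have "?s * 2 \<le> ?s * (A - log 2 ?s)" using assms(1) by (intro mult_left_mono) auto
    then show ?thesis by simp
  qed simp
  then show "0 \<le> pot A dg p" "dg (hd p) = 1 \<Longrightarrow> dg (last p) = 1 \<Longrightarrow> 2 * ?s \<le> pot A dg p"
    by (auto simp: pot_def)
qed

lemma (in decomposition) length_inner:
  assumes "rpath E S p"
  shows "length (inner p) \<le> card V"
proof -
  have "length (inner p) = card (set (inner p))" using assms by (simp add: rpath_def distinct_card)
  also have "\<dots> \<le> card V" using inner_subset[OF assms] finite_V by (intro card_mono) auto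
  finally show ?thesis .
qed

text \<open>Each part keeps at most one end of degree one and needs one unit per vertex; a path with
  two such ends holds two per vertex.\<close>

lemma (in decomposition) potential_split:
  assumes P: "P e = Some (a @ x # b)" "a \<noteq> []" "b \<noteq> []" "e' \<notin> dom P" "dg x \<noteq> 1"
    and A: "log 2 (real (card V)) + 2 \<le> A"
  shows "potential A dg (P(e \<mapsto> a @ [x], e' \<mapsto> x # b)) \<le> potential A dg P"
proof -
  let ?P = "P(e \<mapsto> a @ [x], e' \<mapsto> x # b)"
  have i: "inner (a @ x # b) = inner (a @ [x]) @ x # inner (x # b)"
    using P(2,3) by (cases a) (auto simp: inner_def butlast_append)
  have ee: "e \<noteq> e'" using P by auto
  have d: "dom ?P = insert e (insert e' (dom P - {e}))" "e \<in> dom P" using P by auto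
  have "potential A dg ?P = pot A dg (a @ [x]) + pot A dg (x # b) + (\<Sum>g \<in> dom P - {e}. pot A dg
      (the (?P g)))"
    unfolding potential_def d(1) using finite_dom ee P(4) by simp
  also have "(\<Sum>g \<in> dom P - {e}. pot A dg (the (?P g))) = (\<Sum>g \<in> dom P - {e}. pot A dg (the (P g)))"
    using P(4) by (intro sum.cong) auto
  also have "pot A dg (a @ [x]) + pot A dg (x # b) \<le> pot A dg (a @ x # b)"
  proof -
    have "pot A dg (a @ [x]) = (if dg (hd a) = 1 then real (length (inner (a @ [x]))) else 0)"
      "pot A dg (x # b) = (if dg (last b) = 1 then real (length (inner (x # b))) else 0)"
      using P(2,3,5) by (auto simp: pot_def)
    moreover have "hd (a @ x # b) = hd a" "last (a @ x # b) = last b" using P(2,3) by auto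
    moreover have "2 * real (length (inner (a @ x # b))) \<le> pot A dg (a @ x # b)" if "dg (hd a) =
        1" "dg (last b) = 1"
      using pot_nonneg(2)[OF A length_inner[OF path[OF P(1)]], of dg] that calculation by simp
    moreover have "real (length (inner (a @ x # b))) = real (length (inner (a @ [x]))) + 1 + real
        (length (inner (x # b)))"
      unfolding i by simp
    moreover have "pot A dg (a @ x # b) = (if dg (hd a) = 1 \<or> dg (last b) = 1 then real (length
        (inner (a @ x # b))) else 0)"
      if "\<not> (dg (hd a) = 1 \<and> dg (last b) = 1)"
      using that unfolding pot_def calculation(3,4) by simp
    ultimately show ?thesis
      by (cases "dg (hd a) = 1"; cases "dg (last b) = 1") auto
  qed
  also have "pot A dg (a @ x # b) + (\<Sum>g \<in> dom P - {e}. pot A dg (the (P g))) = potential A dg P"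
    unfolding potential_def using sum.remove[OF finite_dom d(2), of "\<lambda>g. pot A dg (the (P g))"]
        P(1) by simp
  finally show ?thesis by (simp del: fun_upd_apply)
qed

lemma path_weight_nonneg: "set es \<subseteq> E \<Longrightarrow> \<forall>ed \<in> E. 0 < wt ed \<Longrightarrow> 0 \<le> sum_list (map wt es)" for wt ::
    "'v set \<Rightarrow> real"
  by (induction es) (auto intro: add_nonneg_nonneg less_imp_le)

text \<open>\<open>3 * K\<close> stands for one predecessor query and at most two changes of the
  dictionary.\<close>

lemma split_ok:
  assumes s: "state_ok L V E wt m P" and x: "x \<in> V" "\<not> sing m x"
    and D: "\<forall>N \<le> card V + 4. D N \<le> K" and A: "log 2 (real (card V)) + 2 \<le> A"
  shows "\<exists>m' P' c. Defs.split D x m = ((), m', c) \<and> state_ok L V E wt m' P' \<and> deg m' = deg m \<and>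
    sing m' = (sing m)(x := True) \<and> c \<le> 25 + 3 * K \<and>
    potential A (deg m) P' \<le> potential A (deg m) P"
proof -
  obtain P1 e p where P1: "state_ok L V E wt m P1" "\<forall>A. potential A (deg m) P1 = potential A (deg
      m) P"
    "P1 e = Some p" "x \<in> set (inner p)" "chain (num m) (lam m) wt 1 (inner p)"
    "1 < length (inner p) \<longrightarrow> oriented L (created m) (V - {v. sing m v}) (num m) (lam m) wt (deg m)
       (room V (deg m) P1 e) 1 p"
    "(if sing m (fst (adj m (hd (inner p)) 0)) then adj m (hd (inner p)) 0 else adj m (hd (inner
        p)) 1)
      = (hd p, wt {hd p, hd (inner p)})"
    using split_orientation[OF s x] by blast
  let ?S = "{v. sing m v}"
  interpret decomposition V E ?S P1 using P1(1) by (simp add: state_ok_def)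
  have nok: "numbering_ok L V ?S P1 wt (deg m) (num m) (lam m) (created m) (dict m)"
    and adj: "adj_ok E wt (deg m) (adj m)" and pos: "\<forall>ed \<in> E. 0 < wt ed"
    and tok: "tedges_ok wt (deg m) P1 (tedge m) (tinc m) (next_id m)"
    using P1(1) by (auto simp: state_ok_def)
  have rp: "rpath E ?S p" using path[OF P1(3)] .
  obtain as bs where i: "inner p = as @ x # bs" using P1(4) by (meson split_list)
  define a b where "a = hd p # as" and "b = bs @ [last p]"
  have p: "p = a @ x # b" using path_ends[OF length_path[OF rp]] i by (simp add: a_def b_def)
  have ab: "a \<noteq> []" "b \<noteq> []" "inner (a @ [x]) = as" "inner (x # b) = bs" "hd a = hd p" "last b =
      last p"
    by (auto simp: a_def b_def)
  have dist: "distinct (as @ x # bs)" using rp i by (simp add: rpath_def)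
  have nsing: "\<And>v. v \<in> set (as @ x # bs) \<Longrightarrow> \<not> sing m v" using rp i by (auto simp: rpath_def)
  have dx: "deg m x = 2" using two_edges[of x] adj_ok_degree[OF adj] x by simp
  define e' where "e' = next_id m"
  have e': "e' \<notin> dom P1" using tok by (auto simp: tedges_ok_def e'_def)
  have ee: "e \<noteq> e'" using e' P1(3) by auto
  let ?v = "hd (inner p)" and ?W = "sum_list (map wt (path_edges p))"
  let ?Wl = "sum_list (map wt (path_edges (a @ [x])))"
  have ca: "chain (num m) (lam m) wt 1 (as @ [x])" and cb: "chain (num m) (lam m) wt 1 (x # bs)"
    using P1(5) chain_append[of "num m" "lam m" wt 1 as x bs] i by auto
  have v: "?v = hd (as @ [x])" using i by (cases as) auto
  have low: "low (num m) (inner p) = ?v" using low_up[OF P1(5)] i by simp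
  have k: "num m x = num m ?v + int (length as)" using chain_last[OF ca] unfolding v by simp
  have pe: "path_edges p = path_edges (a @ [x]) @ path_edges (x # b)"
    unfolding p using path_edges_append[of a "[x]"] path_edges_append[of a "x # b"] ab(1) by simp
  have W: "?W - ?Wl = sum_list (map wt (path_edges (x # b)))" unfolding pe by simp
  \<comment> \<open>Vertex weights ascend with the numbers and edge weights are positive, so the
    absolute value is the length of the stretch from \<open>?v\<close> to \<open>x\<close>.\<close>
  have Wl: "wt {hd p, ?v} + \<bar>lam m x - lam m ?v\<bar> = ?Wl"
  proof -
    have pa: "path_edges (a @ [x]) = {hd p, ?v} # path_edges (as @ [x])"
      unfolding a_def v by (cases as) auto
    then have "set (path_edges (as @ [x])) \<subseteq> E" using rp pe by (auto simp: rpath_def)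
    then have "0 \<le> sum_list (map wt (path_edges (as @ [x])))" using path_weight_nonneg pos by blast
    then show ?thesis using chain_lam[OF ca] unfolding pa v by simp
  qed
  have te: "tedge m e = Some (hd p, last p, ?W) \<or> tedge m e = Some (last p, hd p, ?W)"
    using tedges_okD(1)[OF tok P1(3)] .
  have other: "other_end (the (tedge m e)) (hd p) = last p" "snd (snd (the (tedge m e))) = ?W"
    using te by (auto simp: other_end_def)
  have look: "dict_pred D (num m x) m = ((num m ?v, e, length (inner p), ?v), m, D (dict_size m))"
    using dict_lookup[OF nok P1(3,4)] unfolding low by (intro dict_pred_exec) auto
  define dc1 where "dc1 = (if as \<noteq> [] then (dict m)(num m (hd as) \<mapsto> (e, length as, hd as)) else
      (dict m)(num m x := None))"
  define dc2 where "dc2 = (if bs \<noteq> [] then dc1(num m (hd bs) \<mapsto> (e', length bs, hd bs)) else dc1)"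
  define m1 where "m1 = m\<lparr>next_id := Suc e', tedge := (tedge m)(e \<mapsto> (hd p, x, ?Wl), e' \<mapsto> (x, last
      p, ?W - ?Wl)),
    tinc := (tinc m)(last p := e'), sing := (sing m)(x := True)\<rparr>"
  have fin: "finite (dom (dict m))" "card (dom (dict m)) \<le> card V" using dict_bounds[OF nok] by auto
  have "card (dom dc1) \<le> Suc (card (dom (dict m)))"
    unfolding dc1_def using card_dom_update[OF fin(1)] by (simp add: le_SucI del: dom_fun_upd)
  then have sz: "D (dict_size m) \<le> K" "D (card (dom dc1)) \<le> K"
    using fin by (auto intro!: D[rule_format] simp: dict_size_def)
  have bs: "num m x < num m ?v + int (length (inner p)) - 1 \<longleftrightarrow> bs \<noteq> []" using k i by auto
  have next_bs: "(if \<not> sing m1 (fst (adj m x 0)) \<and> num m (fst (adj m x 0)) = num m x + 1 then fst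
      (adj m x 0) else fst (adj m x 1)) = hd bs"
    "num m (hd bs) = num m x + 1" "nat (num m ?v + int (length (inner p)) - 1 - num m x) = length
        bs"
    if b1: "bs \<noteq> []"
  proof -
    obtain y ys where y: "bs = y # ys" using b1 by (cases bs) auto
    obtain zs z where z: "a = zs @ [z]" using ab(1) by (metis rev_exhaust)
    have "p = zs @ z # x # y # ys @ [last p]" using p y z by (simp add: b_def)
    then have nb: "nbrs (adj m) wt x z y" using linked_path[OF adj rp] unfolding linked_def by blast
    have ny: "num m y = num m x + 1" using cb y by simp
    show "num m (hd bs) = num m x + 1" using ny y by simp
    show "nat (num m ?v + int (length (inner p)) - 1 - num m x) = length bs" using k i by simp
    have yy: "\<not> sing m1 y" using nsing[of y] y dist by (auto simp: m1_def)
    \<comment> \<open>The lower neighbour of \<open>x\<close> cannot be mistaken for the start of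
      the upper part: it is flagged or has a smaller number.\<close>
    have zz: "sing m1 z \<or> num m z \<noteq> num m x + 1"
    proof (cases as rule: rev_cases)
      case Nil
      then have "z = hd p" using z by (simp add: a_def)
      then show ?thesis using rp by (auto simp: m1_def rpath_def)
    next
      case (snoc as' t)
      then have "z = t" using z by (simp add: a_def)
      then have "num m x = num m z + 1" using ca chain_append[of "num m" "lam m" wt 1 as' t "[x]"]
          snoc by simp
      then show ?thesis by simp
    qed
    show "(if \<not> sing m1 (fst (adj m x 0)) \<and> num m (fst (adj m x 0)) = num m x + 1 then fst (adj m
        x 0) else fst (adj m x 1)) = hd bs"
      using nb yy zz ny unfolding nbrs_def y by auto
  qed
  define m2 where "m2 = m1\<lparr>dict := dc2\<rparr>"
  obtain u0 w0 u1 w1 where u: "adj m ?v 0 = (u0, w0)" "adj m ?v 1 = (u1, w1)" by fastforce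
  have u': "(if sing m u0 then (u0, w0) else (u1, w1)) = (hd p, wt {hd p, ?v})" using P1(7)
      unfolding u by simp
  obtain s' t' where st: "the (tedge m e) = (s', t', ?W)" using other(2) by (metis prod.collapse)
  have oth: "other_end (s', t', ?W) (hd p) = last p" using other(1) st by simp
  have cond: "num m ?v < num m x \<longleftrightarrow> as \<noteq> []" "nat (num m x - num m ?v) = length as" using k by auto
  obtain y0 z0 y1 z1 where y: "adj m x 0 = (y0, z0)" "adj m x 1 = (y1, z1)" by fastforce
  have dc1: "dc1 = (if as = [] then (dict m)(num m ?v := None) else (dict m)(num m ?v \<mapsto> (e, length
      as, ?v)))"
    using v by (simp add: dc1_def)
  have "\<exists>c. Defs.split D x m = ((), m2, c) \<and> c \<le> 25 + 3 * K"
  proof -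
    obtain v where v: "v = ?v" by simp
    obtain W where W: "W = ?W" by simp
    obtain Wl where Wl': "Wl = ?Wl" by simp
    note rules = Defs.split_def bind_ram_def look get_num_def get_tedge_def get_adj_def get_sing_def
      get_lam_def new_tedge_def set_tedge_def set_tinc_def set_sing_def return_def Let_def
      dict_insert_def dict_delete_def dict_size_def u st oth Wl bs cond y m2_def m1_def e'_def
          dc2_def dc1
    note rules' = rules[folded v W Wl']
    have sz': "D (card (dom (dict m))) \<le> K" using sz by (simp add: dict_size_def)
    have uT: "u0 = hd p \<and> w0 = wt {hd p, v}" if "sing m u0" using u' that unfolding v by simp
    have uF: "u1 = hd p \<and> w1 = wt {hd p, v}" if "\<not> sing m u0" using u' that unfolding v by simp
    show ?thesis
    proof (cases "bs = []")
      case True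
      show ?thesis
        using sz' uT uF by (cases "as = []"; cases "sing m u0") (simp_all add: rules' True del:
            One_nat_def)
    next
      case False
      obtain h where h: "h = hd bs" by simp
      note nb = next_bs(2,3)[OF False, folded v h]
      have ysel: "(if \<not> ((sing m)(x := True)) y0 \<and> num m y0 = num m x + 1 then y0 else y1) = h"
        using next_bs(1)[OF False] unfolding y m1_def h by (auto simp del: fun_upd_apply split:
            if_splits)
      have dc2: "dc2 = (if as = [] then (dict m)(num m v := None) else (dict m)(num m v \<mapsto> (e,
          length as, v)))
        (num m x + 1 \<mapsto> (e', length bs, h))"
        using False by (simp add: dc2_def dc1 v h[symmetric] nb(1) del: fun_upd_apply)
      have sz2: "D (card (dom (if as = [] then (dict m)(num m v := None) else (dict m)(num m v \<mapsto>
          (e, length as, v))))) \<le> K"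
        using sz(2) unfolding dc1 v .
      note r = Defs.split_def bind_ram_def look get_num_def get_tedge_def get_adj_def get_sing_def
        get_lam_def new_tedge_def set_tedge_def set_tinc_def set_sing_def return_def Let_def
        dict_insert_def dict_delete_def dict_size_def u st oth Wl bs cond y m2_def m1_def e'_def
            dc2 nb(2) ysel
      have "\<exists>c. Defs.split D x m = ((), m2, c) \<and> c \<le> 25 + 3 * K" if uu: "sing m u0 \<Longrightarrow> u0 = hd p"
          "sing m u0 \<Longrightarrow> w0 = wt {hd p, v}"
        "\<not> sing m u0 \<Longrightarrow> u1 = hd p" "\<not> sing m u0 \<Longrightarrow> w1 = wt {hd p, v}"
        using sz' sz2 uu
        by (cases "as = []"; cases "sing m u0") (simp_all add: r[folded v W Wl'] False del:
            One_nat_def dom_fun_upd fun_upd_apply)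
      then show ?thesis using uT uF by blast
    qed
  qed
  then obtain c where c: "Defs.split D x m = ((), m2, c)" "c \<le> 25 + 3 * K" by blast
  let ?P = "P1(e \<mapsto> a @ [x], e' \<mapsto> x # b)"
  have sing2: "{v. sing m2 v} = insert x ?S" by (auto simp: m2_def m1_def)
  have P1e: "P1 e = Some (a @ x # b)" using P1(3) p by simp
  have dx1: "deg m x \<noteq> 1" using dx by simp
  have "decomposition V E {v. sing m2 v} ?P"
    unfolding sing2 using split_at[OF P1e ab(1,2) e'] .
  moreover have "numbering_ok L V {v. sing m2 v} ?P wt (deg m) (num m) (lam m) (created m) dc2"
    unfolding sing2 dc2_def dc1_def
    using numbering_ok_split[OF nok P1e ab(1,2) e' dx1] P1(5,6) unfolding p ab(3,4) by blast
  moreover have "tedges_ok wt (deg m) ?P (tedge m2) (tinc m2) (next_id m2)"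
    unfolding tedges_ok_def
  proof (intro conjI allI impI ballI)
    have dte: "dom (tedge m) = dom P1" using tok by (simp add: tedges_ok_def)
    then show "dom (tedge m2) = dom ?P" by (auto simp: m2_def m1_def)
    show "g < next_id m2" if "g \<in> dom ?P" for g
      using that tok P1(3) by (auto simp: m2_def m1_def tedges_ok_def e'_def less_Suc_eq split:
          if_splits)
    fix g r assume g: "?P g = Some r"
    have lastp: "deg m (last p) = 1 \<Longrightarrow> tinc m (last p) = e" using tedges_okD(3)[OF tok P1(3)] .
    have hdp: "deg m (hd p) = 1 \<Longrightarrow> tinc m (hd p) = e" using tedges_okD(2)[OF tok P1(3)] .
    \<comment> \<open>Redirecting \<open>tinc\<close> at \<open>last p\<close> leaves
      \<open>hd p\<close> alone, because a path does not return to an end of degree one.\<close>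
    have hl: "deg m (last p) = 1 \<Longrightarrow> hd p \<noteq> last p" using ends_distinct[OF rp] adj_ok_degree[OF adj]
        by simp
    consider "g = e" "r = a @ [x]" | "g = e'" "r = x # b" | "g \<noteq> e" "g \<noteq> e'" "P1 g = Some r"
      using g ee by (auto split: if_splits)
    note cs = this
    show "tedge m2 g = Some (hd r, last r, sum_list (map wt (path_edges r))) \<or>
        tedge m2 g = Some (last r, hd r, sum_list (map wt (path_edges r)))"
    proof (cases rule: cs)
      case 1
      then show ?thesis using ee ab by (simp add: m2_def m1_def)
    next
      case 2
      then show ?thesis using ee ab W by (simp add: m2_def m1_def)
    next
      case 3
      then show ?thesis using tedges_okD(1)[OF tok 3(3)] by (simp add: m2_def m1_def)
    qed
    show "tinc m2 (hd r) = g" if "deg m (hd r) = 1"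
    proof (cases rule: cs)
      case 1
      then show ?thesis using that ab hdp hl by (auto simp: m2_def m1_def)
    next
      case 2
      then show ?thesis using that dx by simp
    next
      case 3
      then show ?thesis using that tedges_okD(2)[OF tok 3(3)] lastp by (auto simp: m2_def m1_def)
    qed
    show "tinc m2 (last r) = g" if "deg m (last r) = 1"
    proof (cases rule: cs)
      case 1
      then show ?thesis using that dx by simp
    next
      case 2
      then show ?thesis using ab by (simp add: m2_def m1_def)
    next
      case 3
      then show ?thesis using that tedges_okD(3)[OF tok 3(3)] lastp by (auto simp: m2_def m1_def)
    qed
  qed
  ultimately have "state_ok L V E wt m2 ?P"
    using adj pos unfolding state_ok_def by (simp add: m2_def m1_def del: fun_upd_apply)
  moreover have "potential A (deg m) ?P \<le> potential A (deg m) P"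
    using potential_split[where dg = "deg m", OF P1e ab(1,2) e' dx1 A] P1(2) by simp
  ultimately show ?thesis
    using c by (intro exI[of _ m2] exI[of _ ?P] exI[of _ c]) (simp add: m2_def m1_def del:
        fun_upd_apply)
qed

section \<open>Growing, extending and merging\<close>

text \<open>\<open>last (hd p # inner p)\<close> names the neighbour of \<open>x\<close> on the path
  even if there is no regular vertex.\<close>

lemma (in decomposition) penultimate:
  assumes "rpath E S p" "last p = x"
  obtains zs where "p = zs @ [last (hd p # inner p), x]" "{x, last (hd p # inner p)} \<in> E"
proof -
  let ?u = "last (hd p # inner p)"
  have "p = (hd p # inner p) @ [x]" using path_ends[OF length_path[OF assms(1)]] assms(2) by simp
  then have p: "p = butlast (hd p # inner p) @ [?u, x]"
    by (metis append_butlast_last_id append.assoc append_Cons append_Nil list.distinct(1))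
  have "path_edges (butlast (hd p # inner p) @ [?u, x]) = path_edges (butlast (hd p # inner p) @
      [?u]) @ [{?u, x}]"
    using path_edges_append[of "butlast (hd p # inner p) @ [?u]" "[x]"] by simp
  then have "{?u, x} \<in> set (path_edges p)" using p by (metis in_set_conv_decomp)
  then have "{x, ?u} \<in> E" using assms(1) by (auto simp: rpath_def insert_commute)
  with p that show ?thesis by blast
qed

context joining
begin

text \<open>\<open>m\<close> already holds the new edge, the new flags and no key for
  \<open>q\<close>, while its numbers are still the old ones; \<open>dc\<close> is the dictionary
  before that key was removed. Three dictionary operations occur in downward growth, where the key
  of the path changes.\<close>

lemma grow_exec:
  assumes nok: "numbering_ok L V S P wt dg (num m) (lam m) (created m) dc"
    and adj: "adj_ok E' wt' dg' (adj m)" and sing: "sing m = (\<lambda>v. v \<in> S')"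
    and wt': "\<And>ed. ed \<in> E \<Longrightarrow> wt' ed = wt ed"
    and L: "2 * card {v \<in> V. 2 \<le> dg' v} \<le> L"
    and dc1: "dict m = (if F \<noteq> {} \<and> inner q \<noteq> [] then dc(num m (low (num m) (inner q)) := None)
        else dc)"
    and D: "\<forall>N \<le> card V + 4. D N \<le> K"
    and u: "u = last (hd p # inner p)" and n: "n = length ws"
  shows "\<exists>nm lm cr dc' c. grow D L e x u n m = ((), m\<lparr>num := nm, lam := lm, created := cr, dict :=
      dc'\<rparr>, c) \<and>
    numbering_ok L V S' P' wt' dg' nm lm cr dc' \<and> c \<le> 7 * n + 10 + 3 * K"
proof -
  obtain zs where zs: "p = zs @ [u, x]" using penultimate[OF path[OF Pe] last_p] u by metis
  have pq: "p @ q = zs @ u # ws @ [last q]" using zs props(1) by simp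
  have linked: "linked (adj m) wt' (u # ws @ [last q])"
    using j.linked_path[OF adj j.path[OF P'_e]] linked_append unfolding pq by blast
  have hq: "hd (butlast q @ [last q]) = hd q" using props(1) by simp
  have fin: "finite (dom dc)" "card (dom dc) \<le> card V" using dict_bounds[OF nok] by auto
  have fin1: "finite (dom (dict m))" "card (dom (dict m)) \<le> card V"
  proof -
    show "finite (dom (dict m))" unfolding dc1 using fin by simp
    show "card (dom (dict m)) \<le> card V"
      unfolding dc1 using fin card_dom_update(2)[OF fin(1)] by (auto intro: order_trans simp del:
          dom_fun_upd)
  qed
  have sz: "D (card (dom (dict m))) \<le> K" using fin1 by (intro D[rule_format]) simp
  show ?thesis
  proof (cases "inner p = []")
    case True
    then have "u = hd p" using u by simp
    then have su: "sing m u" using ends_S'(1)[OF P'_e] p_q(3) sing by auto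
    define a where "a = 2 * int (Suc (created m)) * int L"
    define m1 where "m1 = m\<lparr>created := Suc (created m), num := (num m)(x := a), lam := (lam m)(x
        := 0)\<rparr>"
    have "nbrs (adj m) wt' x u (hd q)"
      using linkedD[of "adj m" wt' u x "hd q" "tl (butlast q @ [last q])"] linked props(1) by simp
    then have lk: "link x u m1 = ((wt' {u, x}, hd q), m1, 3)" by (intro link_exec) (simp add:
        m1_def)
    have "linked (adj m1) wt' (x # butlast q @ [last q])" "distinct (x # butlast q)"
      using linked_Cons[OF linked] props(7) by (auto simp: m1_def)
    from walk_exec[OF this, of 1] obtain nm lm where wk:
      "walk (length (butlast q)) 1 x (hd q) m1 = (last ws, m1\<lparr>num := nm, lam := lm\<rparr>, 7 * length
          (butlast q) + 1)"
      "\<forall>v. v \<notin> set (butlast q) \<longrightarrow> nm v = num m1 v \<and> lm v = lam m1 v" "chain nm lm wt' 1 ws"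
      unfolding hq by blast
    have ag: "nm v = num m v" "lm v = lam m v" if "v \<notin> set ws" for v
      using wk(2) that by (auto simp: m1_def)
    have nx: "nm x = a" using wk(2) props(7) by (auto simp: m1_def)
    define dc' where "dc' = (dict m)(a \<mapsto> (e, n, x))"
    have aa: "(2 + 2 * int (created m)) * int L = a" by (simp add: a_def)
    have n1: "n - 1 = length (butlast q)" using n by simp
    have "numbering_ok L V S' P' wt' dg' nm lm (Suc (created m)) dc'"
      using numbering_ok_fresh[OF nok True ag wt' nx[unfolded a_def] wk(3) L dc1, of dc'] nx n
      by (simp add: dc'_def del: fun_upd_apply)
    moreover have "grow D L e x u n m = ((), m\<lparr>num := nm, lam := lm, created := Suc (created m),
        dict := dc'\<rparr>,
      1 + (1 + (1 + (1 + (3 + (7 * length (butlast q) + 1 + D (card (dom (dict m)))))))))"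
      using su lk wk(1) n1
      by (simp add: grow_def bind_ram_def get_sing_def new_created_def set_num_def set_lam_def
          dict_insert_def
          aa Let_def m1_def dc'_def dict_size_def del: fun_upd_apply length_butlast)
    moreover have "1 + (1 + (1 + (1 + (3 + (7 * length (butlast q) + 1 + D (card (dom (dict
        m)))))))) \<le> 7 * n + 10 + 3 * K"
      using sz n by simp
    ultimately show ?thesis by blast
  next
    case False
    let ?A = "num m (low (num m) (inner p))" and ?i = "length (inner p)"
    have ul: "u = last (inner p)" using u False by simp
    have uin: "u \<in> set (inner p)" using ul False by simp
    have uN: "u \<notin> S" "u \<notin> set ws" using inner_subset[OF path[OF Pe]] uin ws_subset(2) by blast+
    have su: "\<not> sing m u" using uN sing by auto
    obtain \<sigma> where \<sigma>: "oriented L (created m) (V - S) (num m) (lam m) wt dg (room V dg P e) \<sigma> p"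
      "\<sigma> = 1 \<longleftrightarrow> num m u = ?A + int ?i - 1 \<and> (1 < ?i \<or> num m (hd p) \<noteq> num m u + 1)"
      using growth_direction[OF nok Pe False] dg_x last_p ul by auto
    have sg: "\<sigma> = 1 \<or> \<sigma> = - 1" and ch: "chain (num m) (lam m) wt \<sigma> (inner p)"
      using \<sigma>(1) by (auto simp: oriented_def)
    have inj: "inj_on (num m) (V - S)" using nok by (simp add: numbering_ok_def)
    have look0: "Max {k \<in> dom dc. k \<le> num m u} = ?A" "dc ?A = Some (e, ?i, low (num m) (inner p))"
      using dict_lookup[OF nok Pe uin] by auto
    have dA: "dict m ?A = Some (e, ?i, low (num m) (inner p))"
    proof (cases "F \<noteq> {} \<and> inner q \<noteq> []")
      case True
      then obtain f where f: "f \<in> F" by blast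
      have qf: "P f = Some q" using props(12)[OF f] by blast
      have l: "low (num m) (inner p) \<in> set (inner p)" "low (num m) (inner q) \<in> set (inner q)"
        using low_in False True by blast+
      have "low (num m) (inner p) \<noteq> low (num m) (inner q)"
        using inner_unique[OF Pe qf] l e_F f by metis
      then have "?A \<noteq> num m (low (num m) (inner q))"
        using inj l inner_subset[OF path[OF Pe]] inner_subset[OF path[OF qf]] by (metis inj_on_def
            subsetD)
      then show ?thesis using look0(2) unfolding dc1 by simp
    next
      case False
      then show ?thesis using look0(2) unfolding dc1 by auto
    qed
    \<comment> \<open>Removing the key of \<open>q\<close> leaves that of \<open>p\<close> in place,
      so the predecessor found in \<open>dc\<close> is still the right one.\<close>
    have "Max {k \<in> dom (dict m). k \<le> num m u} = ?A"
    proof (rule Max_eqI)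
      show "finite {k \<in> dom (dict m). k \<le> num m u}" using fin1 by simp
      have "?A \<in> {k \<in> dom dc. k \<le> num m u}"
        unfolding look0(1)[symmetric]
      proof (rule Max_in)
        show "finite {k \<in> dom dc. k \<le> num m u}" using fin by simp
        have "?A \<le> num m u" unfolding ul low_def by simp
        then show "{k \<in> dom dc. k \<le> num m u} \<noteq> {}" using look0(2) by blast
      qed
      then show "?A \<in> {k \<in> dom (dict m). k \<le> num m u}" using dA by auto
      fix k assume "k \<in> {k \<in> dom (dict m). k \<le> num m u}"
      then have "k \<in> {k \<in> dom dc. k \<le> num m u}" unfolding dc1 by (auto split: if_splits)
      then show "k \<le> ?A" unfolding look0(1)[symmetric] using fin by (intro Max_ge) auto
    qed
    then have look: "dict_pred D (num m u) m = ((?A, e, ?i, low (num m) (inner p)), m, D (card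
        (dom (dict m))))"
      using dict_pred_exec[OF _ dA] by (simp add: dict_size_def)
    \<comment> \<open>For a path with one regular vertex, the neighbour \<open>z\<close> inspected
      by \<open>grow\<close> is the end \<open>hd p\<close> to which \<open>oriented\<close>
      refers.\<close>
    obtain z where z: "nbrs (adj m) wt' u z x" "?i = 1 \<Longrightarrow> z = hd p"
    proof (cases "butlast (inner p)" rule: rev_cases)
      case Nil
      then have "inner p = [u]" using ul False by (metis append_Nil append_butlast_last_id)
      then have "p @ q = [] @ hd p # u # x # q" using path_ends[OF p_q(1)] last_p by (metis
          append.assoc append_Cons append_Nil)
      then have "nbrs (adj m) wt' u (hd p) x"
        using j.linked_path[OF adj j.path[OF P'_e]] unfolding linked_def by metis
      then show ?thesis using that by blast
    next
      case (snoc ys z)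
      then have "inner p = ys @ [z, u]" using ul False by (metis append.assoc append_Cons
          append_Nil append_butlast_last_id)
      then have "p @ q = (hd p # ys) @ z # u # x # q" "?i \<noteq> 1"
        using path_ends[OF p_q(1)] last_p by (metis append.assoc append_Cons append_Nil, simp)
      then have "nbrs (adj m) wt' u z x"
        using j.linked_path[OF adj j.path[OF P'_e]] unfolding linked_def by metis
      then show ?thesis using that \<open>?i \<noteq> 1\<close> by blast
    qed
    have lk: "link u x m = ((wt' {x, u}, z), m, 3)" using link_exec[OF nbrs_sym[OF z(1)]] .
    have i1: "1 \<le> ?i" using False by (cases "inner p") auto
    have dir: "num m u = ?A + int ?i - 1 \<and> (1 < ?i \<or> num m z \<noteq> num m u + 1) \<longleftrightarrow> \<sigma> = 1"
      using \<sigma>(2) z(2) i1 by (cases "?i = 1") auto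
    have "distinct (u # ws)" using uN props(7) by simp
    from walk_exec[OF linked this, of \<sigma>] obtain nm lm where wk:
      "walk n \<sigma> u x m = (last ws, m\<lparr>num := nm, lam := lm\<rparr>, 7 * n + 1)"
      "\<forall>v. v \<notin> set ws \<longrightarrow> nm v = num m v \<and> lm v = lam m v" "chain nm lm wt' \<sigma> (u # ws)"
      unfolding n by auto
    have ag: "nm v = num m v" "lm v = lam m v" if "v \<notin> set ws" for v using wk(2) that by auto
    have ch': "chain nm lm wt' \<sigma> (inner p @ ws)"
      using chain_join[OF ag wt' False ch] wk(3) ul by simp
    define dc' where "dc' = ((dict m)(?A := None))
      (nm (low nm (inner p @ ws)) \<mapsto> (e, length (inner p @ ws), low nm (inner p @ ws)))"
    have num: "numbering_ok L V S' P' wt' dg' nm lm (created m) dc'"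
      using numbering_ok_grow[OF nok False \<sigma>(1) ag wt' _ L dc1 dc'_def] wk(3) ul by simp
    have len: "length (inner p @ ws) = ?i + n" using n by simp
    note defs = grow_def bind_ram_def get_sing_def get_num_def dict_insert_def dict_delete_def
        dict_size_def
    show ?thesis
    proof (cases "\<sigma> = 1")
      case True
      have lw: "low nm (inner p @ ws) = hd (inner p)" "low (num m) (inner p) = hd (inner p)"
        using low_up ch ch' True False by (metis Nil_is_append_conv hd_append2)+
      have "nm (hd (inner p)) = num m (hd (inner p))" using ag ws_subset(2) hd_in_set[OF False] by
          blast
      then have dc'_eq: "dc' = (dict m)(?A \<mapsto> (e, ?i + n, low (num m) (inner p)))"
        unfolding dc'_def len lw by (simp del: fun_upd_apply)
      have cT: "num m u = ?A + int ?i - 1" "1 < ?i \<or> num m z \<noteq> num m u + 1" using dir True by auto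
      have "grow D L e x u n m = ((), m\<lparr>num := nm, lam := lm, created := created m, dict := dc'\<rparr>,
        1 + (1 + (D (card (dom (dict m))) + (3 + (1 + (7 * n + 1 + D (card (dom (dict m)))))))))"
        using su look lk wk(1)[unfolded True] cT unfolding dc'_eq
        by (simp add: defs del: fun_upd_apply dom_fun_upd)
      moreover have "1 + (1 + (D (card (dom (dict m))) + (3 + (1 + (7 * n + 1 + D (card (dom (dict
          m)))))))) \<le> 7 * n + 10 + 3 * K"
        using sz by simp
      ultimately show ?thesis using num by blast
    next
      case F: False
      then have s: "\<sigma> = - 1" using sg by blast
      have lw: "low nm (inner p @ ws) = last ws" "low (num m) (inner p) = u"
        using low_down[of nm lm wt' "inner p @ ws"] low_down[of "num m" "lam m" wt "inner p"] ch
            ch' s False ul by auto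
      have "nm (last ws) = ?A - int n"
        using chain_last[OF wk(3)] ag(1)[OF uN(2)] unfolding lw s n by simp
      then have dc'_eq: "dc' = ((dict m)(?A := None))(?A - int n \<mapsto> (e, ?i + n, last ws))"
        unfolding dc'_def len lw by (simp del: fun_upd_apply)
      have cF: "\<not> (num m u = ?A + int ?i - 1 \<and> (1 < ?i \<or> num m z \<noteq> num m u + 1))" using dir F by
          blast
      have "grow D L e x u n m = ((), m\<lparr>num := nm, lam := lm, created := created m, dict := dc'\<rparr>,
        1 + (1 + (D (card (dom (dict m))) + (3 + (1 + (7 * n + 1 + (D (card (dom (dict m))) + D
            (card (dom ((dict m)(?A := None)))))))))))"
        unfolding dc'_eq
        by (simp only: defs Let_def prod.case su if_False look lk if_not_P[OF cF] wk(1)[unfolded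
            s] mem.simps)
          (simp del: fun_upd_apply dom_fun_upd)
      moreover have "D (card (dom ((dict m)(?A := None)))) \<le> K"
        using card_dom_update(2)[OF fin1(1)] fin1(2) by (intro D[rule_format]) (meson le_add1
            order_trans)
      then have "1 + (1 + (D (card (dom (dict m))) + (3 + (1 + (7 * n + 1 + (D (card (dom (dict
          m))) + D (card (dom ((dict m)(?A := None))))))))))
        \<le> 7 * n + 10 + 3 * K" using sz by simp
      ultimately show ?thesis using num by blast
    qed
  qed
qed

lemma tedges_ok_join:
  assumes tok: "tedges_ok wt dg P te ti nid" and wt': "\<And>ed. ed \<in> E \<Longrightarrow> wt' ed = wt ed" "wt' {x, y} =
      w"
    and te': "te' = (te |` (- F))(e \<mapsto> (hd p, last q,
      sum_list (map wt (path_edges p)) + w + sum_list (map wt (path_edges q))))"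
  shows "tedges_ok wt' dg' P' te' (ti(last q := e)) nid"
  unfolding tedges_ok_def
proof (intro conjI allI impI ballI)
  have "dom te = dom P" using tok by (simp add: tedges_ok_def)
  then show "dom te' = dom P'" by (simp add: te')
  show "g < nid" if "g \<in> dom P'" for g
    using that tok Pe by (auto simp: tedges_ok_def restrict_map_def split: if_splits)
  fix g r assume g: "P' g = Some r"
  have cong: "map wt' es = map wt es" if "set es \<subseteq> E" for es using wt'(1) that by auto
  have pE: "set (path_edges p) \<subseteq> E" using path[OF Pe] by (simp add: rpath_def)
  have pe: "path_edges (p @ q) = path_edges p @ {x, y} # path_edges q"
    using path_edges_append[of p q] props(1,2) last_p p_q(1) by fastforce
  \<comment> \<open>A far end \<open>last q\<close> of degree one belonged to the absorbed path
    alone, so redirecting its \<open>tinc\<close> harms no other path.\<close>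
  have lq: "ti (last q) \<noteq> g" if "g \<noteq> e" "dg (last q) = 1"
  proof -
    have F: "F \<noteq> {}" using that(2) props(11,13) dg by auto
    then obtain f where f: "f \<in> F" by blast
    have "ti (last q) = f" using tedges_okD(3)[OF tok, of f q] props(12)[OF f] that(2) by blast
    then show ?thesis using other[OF g that(1)] f by blast
  qed
  show "te' g = Some (hd r, last r, sum_list (map wt' (path_edges r))) \<or>
      te' g = Some (last r, hd r, sum_list (map wt' (path_edges r)))"
  proof (cases "g = e")
    case True
    then have r: "r = p @ q" using g by simp
    have "sum_list (map wt' (path_edges (p @ q)))
      = sum_list (map wt (path_edges p)) + w + sum_list (map wt (path_edges q))"
      unfolding pe map_append list.map cong[OF pE] cong[OF props(3)] wt'(2) by simp
    then show ?thesis unfolding r p_q(3,4) using True by (simp add: te')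
  next
    case False
    have "set (path_edges r) \<subseteq> E" using path other[OF g False] by (auto simp: rpath_def)
    then have eq: "map wt' (path_edges r) = map wt (path_edges r)" by (rule cong)
    show ?thesis unfolding eq using tedges_okD(1)[OF tok, of g r] other[OF g False] False by (simp
        add: te')
  qed
  show "(ti(last q := e)) (hd r) = g" if d: "dg' (hd r) = 1"
  proof (cases "g = e")
    case True
    then have "hd r = hd p" using g p_q(3) by auto
    then show ?thesis using tedges_okD(2)[OF tok Pe] d True unfolding \<open>hd r = hd p\<close> dg'_hd by auto
  next
    case False
    have "dg (hd r) = 1" using d unfolding dg'_other(1)[OF g False] .
    then have "ti (hd r) = g" using tedges_okD(2)[OF tok, of g r] other[OF g False] by blast
    then show ?thesis using lq False \<open>dg (hd r) = 1\<close> by auto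
  qed
  show "(ti(last q := e)) (last r) = g" if d: "dg' (last r) = 1"
  proof (cases "g = e")
    case True
    then have "last r = last q" using g p_q(4) by auto
    then show ?thesis using True by simp
  next
    case False
    have "dg (last r) = 1" using d unfolding dg'_other(2)[OF g False] .
    then have "ti (last r) = g" using tedges_okD(3)[OF tok, of g r] other[OF g False] by blast
    then show ?thesis using lq False \<open>dg (last r) = 1\<close> by auto
  qed
qed

end

section \<open>Amortised accounting for extensions and merges\<close>

lemma log_nat_nonneg: "0 < n \<Longrightarrow> 0 \<le> log 2 (real n)"
  by simp

text \<open>For the shorter side the new size is at least twice the old one, so each of its vertices
  releases one unit as the logarithm grows by one. The longer side needs no more than before, and
  the two new vertices bring at most \<open>A\<close> each.\<close>

lemma union_by_size:
  fixes a b :: nat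
  assumes "0 \<le> A"
  shows "real (a + b + 2) * (A - log 2 (real (a + b + 2))) + real (min a b)
    \<le> real a * (A - log 2 (real a)) + real b * (A - log 2 (real b)) + 2 * A"
proof -
  define l where "l = log 2 (real (a + b + 2))"
  have l0: "0 \<le> l" unfolding l_def by (rule log_nat_nonneg) simp
  have le: "real c * (A - l) \<le> real c * (A - log 2 (real c))" if "c \<le> a + b + 2" for c
  proof (cases "c = 0")
    case False
    then have "log 2 (real c) \<le> l" unfolding l_def using that by (intro log_mono) auto
    then show ?thesis by (intro mult_left_mono) auto
  qed simp
  have strict: "real c * (A - l) + real c \<le> real c * (A - log 2 (real c))" if "2 * c \<le> a + b + 2"
      for c
  proof (cases "c = 0")
    case False
    then have "log 2 (2 * real c) \<le> l" unfolding l_def using that by (intro log_mono) auto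
    moreover have "log 2 (2 * real c) = 1 + log 2 (real c)" using False by (simp add: log_mult)
    ultimately have "real c * (A - l + 1) \<le> real c * (A - log 2 (real c))" by (intro
        mult_left_mono) auto
    then show ?thesis by (simp add: algebra_simps)
  qed simp
  have "real (a + b + 2) * (A - l) = real a * (A - l) + real b * (A - l) + 2 * (A - l)"
    by (simp add: algebra_simps)
  moreover have "2 * (A - l) \<le> 2 * A" using l0 by simp
  moreover have "real a * (A - l) + real b * (A - l) + real (min a b)
    \<le> real a * (A - log 2 (real a)) + real b * (A - log 2 (real b))"
  proof (cases "a \<le> b")
    case True
    then have "real (min a b) = real a" by simp
    then show ?thesis using le[of b] strict[of a] True by linarith
  next
    case False
    then have "real (min a b) = real b" by simp
    then show ?thesis using le[of a] strict[of b] False by linarith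
  qed
  ultimately show ?thesis unfolding l_def by linarith
qed

lemma extend_by_one:
  fixes a :: nat
  shows "real (a + 1) * (A - log 2 (real (a + 1))) \<le> real a * (A - log 2 (real a)) + A"
proof -
  have "real a * (A - log 2 (real (a + 1))) \<le> real a * (A - log 2 (real a))"
  proof (cases "a = 0")
    case False
    then have "log 2 (real a) \<le> log 2 (real (a + 1))" by (intro log_mono) auto
    then show ?thesis by (intro mult_left_mono) auto
  qed simp
  moreover have "0 \<le> log 2 (real (a + 1))" by (rule log_nat_nonneg) simp
  moreover have "real (a + 1) * (A - log 2 (real (a + 1)))
    = real a * (A - log 2 (real (a + 1))) + A - log 2 (real (a + 1))" by (simp add: algebra_simps)
  ultimately show ?thesis by linarith
qed

context joining
begin

text \<open>The minimum is the renumbering work of a merge. If both far ends have degree one,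
  \<open>union_by_size\<close> pays for it. If only one has, its path drops from at least two units
  per vertex to one; if none has, all units of both paths are released. Either amount covers the
  minimum.\<close>

lemma potential_join:
  assumes A: "log 2 (real (card V)) + 2 \<le> A"
  shows "potential A dg' P' + (if F = {} then 0 else real (min (length (inner p)) (length (inner
      q))))
    \<le> potential A dg P + 2 * A + 2"
proof -
  have "0 < card V" using x_S S_subset finite_V by (auto simp: card_gt_0_iff)
  then have A2: "2 \<le> A" using A log_nat_nonneg[of "card V"] by linarith
  define n k where "n = length (inner p)" and "k = length (inner q)"
  have np: "n \<le> card V" using length_inner[OF path[OF Pe]] by (simp add: n_def)
  have pot_p: "pot A dg p = (if dg (hd p) = 1 then real n * (A - log 2 (real n)) else real n)"
    using last_p dg_x by (simp add: pot_def n_def)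
  have pp: "dg (hd p) = 1 \<Longrightarrow> 2 * real n \<le> pot A dg p"
    using pot_nonneg(2)[OF A, of p dg] np last_p dg_x by (simp add: n_def)
  have rest: "(\<Sum>g \<in> dom P - F - {e}. pot A dg' (the (P' g))) = (\<Sum>g \<in> dom P - F - {e}. pot A dg
      (the (P g)))"
  proof (rule sum.cong[OF refl])
    fix g assume g: "g \<in> dom P - F - {e}"
    then obtain r where r: "P g = Some r" by blast
    then have P'g: "P' g = Some r" "g \<noteq> e" using g by auto
    show "pot A dg' (the (P' g)) = pot A dg (the (P g))"
      unfolding P'g(1) r pot_def option.sel dg'_other[OF P'g] by (rule refl)
  qed
  have dom: "dom P' = insert e (dom P - F - {e})" using e_F Pe by auto
  have new: "potential A dg' P' = pot A dg' (p @ q) + (\<Sum>g \<in> dom P - F - {e}. pot A dg (the (P g)))"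
    unfolding potential_def dom
    using finite_dom rest by (subst sum.insert) (auto simp: P'_e simp del: fun_upd_apply
        insert_Diff_single)
  have pot_new: "pot A dg' (p @ q) =
    (if dg (hd p) = 1 \<and> dg' (last q) = 1 then real (n + length ws) * (A - log 2 (real (n + length
        ws)))
     else if dg (hd p) = 1 \<or> dg' (last q) = 1 then real (n + length ws) else 0)"
    unfolding pot_def p_q(2-4) dg'_hd length_append n_def[symmetric] by (rule refl)
  show ?thesis
  proof (cases "F = {}")
    case True
    then have q: "length ws = 1" using props(11) by simp
    have old: "potential A dg P = pot A dg p + (\<Sum>g \<in> dom P - F - {e}. pot A dg (the (P g)))"
      unfolding potential_def using sum.remove[OF finite_dom, of e "\<lambda>g. pot A dg (the (P g))"] Pe
          True by auto
    have "pot A dg' (p @ q) \<le> pot A dg p + A + 1"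
      unfolding pot_new q using extend_by_one[of n A] pot_p pp A2
      by (cases "dg (hd p) = 1"; cases "dg' (last q) = 1") (auto simp del: fun_upd_apply)
    then show ?thesis using new old True A2 by simp
  next
    case False
    then obtain f where f: "f \<in> F" by blast
    have qf: "P f = Some q" "F = {f}" "q = y # inner q @ [last q]" using props(12)[OF f] by auto
    have fe: "f \<noteq> e" using e_F f by auto
    have "butlast q = y # inner q" using arg_cong[OF qf(3), of butlast] by simp
    then have q: "length ws = k + 2" by (simp add: k_def)
    have hq: "dg (hd q) = 1" using props(2) dg_y[OF False] by simp
    have lq: "dg' (last q) = 1 \<longleftrightarrow> dg (last q) = 1" using dg'_last[OF False] .
    have kq: "k \<le> card V" using length_inner[OF path[OF qf(1)]] by (simp add: k_def)
    have pot_q: "pot A dg q = (if dg (last q) = 1 then real k * (A - log 2 (real k)) else real k)"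
      using hq by (simp add: pot_def k_def)
    have qq: "dg (last q) = 1 \<Longrightarrow> 2 * real k \<le> pot A dg q"
      using pot_nonneg(2)[OF A, of q dg] kq hq by (simp add: k_def)
    have "potential A dg P = pot A dg p + (\<Sum>g \<in> dom P - {e}. pot A dg (the (P g)))"
      unfolding potential_def using sum.remove[OF finite_dom, of e "\<lambda>g. pot A dg (the (P g))"] Pe
          by auto
    also have "(\<Sum>g \<in> dom P - {e}. pot A dg (the (P g))) = pot A dg q + (\<Sum>g \<in> dom P - F - {e}. pot
        A dg (the (P g)))"
    proof -
      have "f \<in> dom P - {e}" "finite (dom P - {e})" using qf(1) fe finite_dom by auto
      moreover have "dom P - F - {e} = dom P - {e} - {f}" using qf(2) by auto
      ultimately show ?thesis using sum.remove[of "dom P - {e}" f "\<lambda>g. pot A dg (the (P g))"]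
          qf(1) by simp
    qed
    finally have old: "potential A dg P = pot A dg p + (pot A dg q + (\<Sum>g \<in> dom P - F - {e}. pot A
        dg (the (P g))))" .
    have "pot A dg' (p @ q) + real (min n k) \<le> pot A dg p + pot A dg q + 2 * A + 2"
    proof -
      have m: "real (min n k) \<le> real n" "real (min n k) \<le> real k" by auto
      have len: "n + length ws = n + k + 2" using q by simp
      have un: "real (n + k + 2) * (A - log 2 (real (n + k + 2))) + real (min n k)
        \<le> real n * (A - log 2 (real n)) + real k * (A - log 2 (real k)) + 2 * A"
        using union_by_size[of A n k] A2 by simp
      have s: "real (n + k + 2) = real n + real k + 2" by simp
      show ?thesis
      proof (cases "dg (hd p) = 1"; cases "dg (last q) = 1")
        assume "dg (hd p) = 1" "dg (last q) = 1"
        then have "pot A dg' (p @ q) = real (n + k + 2) * (A - log 2 (real (n + k + 2)))"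
          "pot A dg p = real n * (A - log 2 (real n))" "pot A dg q = real k * (A - log 2 (real k))"
          unfolding pot_new len lq pot_p pot_q by auto
        then show ?thesis using un by linarith
      next
        assume a: "dg (hd p) = 1" "dg (last q) \<noteq> 1"
        then have "pot A dg' (p @ q) = real (n + k + 2)" "pot A dg q = real k"
          unfolding pot_new len lq pot_q by auto
        then show ?thesis using pp[OF a(1)] m s A2 by linarith
      next
        assume a: "dg (hd p) \<noteq> 1" "dg (last q) = 1"
        then have "pot A dg' (p @ q) = real (n + k + 2)" "pot A dg p = real n"
          unfolding pot_new len lq pot_p by auto
        then show ?thesis using qq[OF a(2)] m s A2 by linarith
      next
        assume a: "dg (hd p) \<noteq> 1" "dg (last q) \<noteq> 1"
        then have "pot A dg' (p @ q) = 0" "pot A dg p = real n" "pot A dg q = real k"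
          unfolding pot_new len lq pot_p pot_q by auto
        then show ?thesis using m A2 by linarith
      qed
    qed
    then show ?thesis using new old False unfolding n_def k_def by simp
  qed
qed

end

lemma (in decomposition) potential_add:
  assumes dg: "\<And>v. dg v = card {ed \<in> E. v \<in> ed}" and xy: "dg x \<noteq> 1" "dg y \<noteq> 1" "x \<noteq> y" and e: "e \<notin>
      dom P"
  shows "potential A (dg(x := dg x + 1, y := dg y + 1)) (P(e \<mapsto> [x, y])) = potential A dg P"
proof -
  let ?dg = "dg(x := dg x + 1, y := dg y + 1)"
  have "pot A ?dg (the ((P(e \<mapsto> [x, y])) g)) = pot A dg (the (P g))" if g: "g \<in> dom P" for g
  proof -
    obtain r where r: "P g = Some r" using g by blast
    have "?dg (hd r) = 1 \<longleftrightarrow> dg (hd r) = 1" "?dg (last r) = 1 \<longleftrightarrow> dg (last r) = 1"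
      using end_degree[OF r] xy unfolding dg[symmetric] by auto
    moreover have "g \<noteq> e" using g e by auto
    ultimately show ?thesis using r by (simp add: pot_def del: fun_upd_apply) (simp add:
        fun_upd_def)
  qed
  then have "(\<Sum>g \<in> dom P. pot A ?dg (the ((P(e \<mapsto> [x, y])) g))) = potential A dg P"
    unfolding potential_def by (rule sum.cong[OF refl])
  moreover have "pot A ?dg [x, y] = 0" by (simp add: pot_def)
  ultimately show ?thesis
    unfolding potential_def using finite_dom e by (simp del: fun_upd_apply) simp
qed

section \<open>Edge insertions\<close>

text \<open>The intermediate memory in which adjacency and degrees are updated and the new edge is
  still missing from the simplification.\<close>

definition add_edge :: "'v \<Rightarrow> 'v \<Rightarrow> real \<Rightarrow> 'v mem \<Rightarrow> 'v mem" where
  "add_edge x y w m = m\<lparr>adj := (adj m)(x := (adj m x)(deg m x := (y, w)), y := (adj m y)(deg m y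
      := (x, w))),
     deg := (deg m)(x := deg m x + 1, y := deg m y + 1)\<rparr>"

lemma add_edge_simps [simp]:
  "deg (add_edge x y w m) = (deg m)(x := deg m x + 1, y := deg m y + 1)"
  "sing (add_edge x y w m) = sing m" "tedge (add_edge x y w m) = tedge m" "tinc (add_edge x y w m)
      = tinc m"
  "next_id (add_edge x y w m) = next_id m" "num (add_edge x y w m) = num m" "lam (add_edge x y w
      m) = lam m"
  "created (add_edge x y w m) = created m" "dict (add_edge x y w m) = dict m"
  by (simp_all add: add_edge_def)

lemma add_edge_commute: "x \<noteq> y \<Longrightarrow> add_edge x y w m = add_edge y x w m"
  by (simp add: add_edge_def fun_upd_twist[of x y])

text \<open>Only the list at \<open>x\<close> is turned. In a merge, this keeps the list chosen for
  the first end valid while the second one is turned.\<close>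

lemma end_path:
  assumes s: "state_ok L V E wt m P" and x: "deg m x = 1" "sing m x"
  shows "\<exists>P' e p. state_ok L V E wt m P' \<and> P' e = Some p \<and> last p = x \<and> (\<forall>g. g \<noteq> e \<longrightarrow> P' g = P g) \<and>
    (\<forall>A. potential A (deg m) P' = potential A (deg m) P)"
proof -
  interpret decomposition V E "{v. sing m v}" P using s by (simp add: state_ok_def)
  have adj: "adj_ok E wt (deg m) (adj m)" using s by (simp add: state_ok_def)
  have "card {ed \<in> E. x \<in> ed} = 1" using adj_ok_degree[OF adj] x by simp
  then obtain ed where ed: "ed \<in> E" "x \<in> ed" by (metis (no_types, lifting) card_1_singletonE
      insertI1 mem_Collect_eq)
  obtain e p where p: "P e = Some p" "ed \<in> set (path_edges p)" using cover[OF ed(1)] by blast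
  have pn: "p \<noteq> []" using length_path[OF path[OF p(1)]] by auto
  have "x = hd p \<or> x = last p" using path_edge_end[OF path[OF p(1)] p(2) ed(2)] x by simp
  then show ?thesis
  proof
    assume "x = last p"
    then show ?thesis using s p by blast
  next
    assume h: "x = hd p"
    show ?thesis
      using state_ok_flip[OF s p(1)] potential_flip[of P e p, OF p(1) pn] h pn
      by (intro exI[of _ "P(e \<mapsto> rev p)"] exI[of _ e] exI[of _ "rev p"]) (auto simp: last_rev)
  qed
qed

text \<open>At a vertex of degree one the new neighbour goes to slot 1, so slot 0 keeps the old one.
  Two versions are given because the fact is applied to both end points of the new edge.\<close>

lemma (in decomposition) end_neighbour:
  assumes "adj_ok E wt (deg m) (adj m)" "rpath E S p" "last p = x" "deg m x = 1" "x \<noteq> y"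
  shows "adj (add_edge x y w m) x 0 = (last (hd p # inner p), wt {x, last (hd p # inner p)})"
    "adj (add_edge y x w m) x 0 = (last (hd p # inner p), wt {x, last (hd p # inner p)})"
proof -
  have "{x, last (hd p # inner p)} \<in> E" using penultimate[OF assms(2,3)] by metis
  from single_neighbour[OF assms(1,4) this]
  show "adj (add_edge x y w m) x 0 = (last (hd p # inner p), wt {x, last (hd p # inner p)})"
    "adj (add_edge y x w m) x 0 = (last (hd p # inner p), wt {x, last (hd p # inner p)})"
    using assms(4,5) by (auto simp: add_edge_def)
qed

lemma other_end_last:
  assumes "tedges_ok wt dg P te ti nid" "P e = Some p" "hd p \<noteq> last p"
  shows "\<exists>s t. te e = Some (s, t, sum_list (map wt (path_edges p))) \<and>
    other_end (s, t, sum_list (map wt (path_edges p))) (last p) = hd p \<and>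
    other_end (s, t, sum_list (map wt (path_edges p))) (hd p) = last p"
  using tedges_okD(1)[OF assms(1,2)] assms(3) by (auto simp: other_end_def)

lemma (in joining) state_ok_join:
  assumes s: "state_ok L V E wt m P" and S: "S = {v. sing m v}" and dgm: "dg = deg m" and w: "0 < w"
    and m': "adj m' = adj (add_edge x y w m)" "deg m' = deg (add_edge x y w m)" "sing m' = (\<lambda>v. v
        \<in> S')"
      "next_id m' = next_id m" "tinc m' = (tinc m)(last q := e)"
      "tedge m' = (tedge m |` (- F))(e \<mapsto> (hd p, last q,
        sum_list (map wt (path_edges p)) + w + sum_list (map wt (path_edges q))))"
    and num: "numbering_ok L V S' P' (wt({x, y} := w)) dg' (num m') (lam m') (created m') (dict m')"
  shows "state_ok L V E' (wt({x, y} := w)) m' P'"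
proof -
  have adj: "adj_ok E wt dg (adj m)" and pos: "\<forall>ed \<in> E. 0 < wt ed"
    and tok: "tedges_ok wt dg P (tedge m) (tinc m) (next_id m)"
    using s dgm by (auto simp: state_ok_def)
  have dg'm: "deg m' = dg'" using m'(2) dgm by simp
  have sS: "{v. sing m' v} = S'" unfolding m'(3) by (rule Collect_mem_eq)
  have "decomposition V E' {v. sing m' v} P'" unfolding sS by (rule j.decomposition_axioms)
  moreover have "adj_ok E' (wt({x, y} := w)) (deg m') (adj m')"
    using adj_ok_insert[OF adj xy new_edge, of w] unfolding m'(1) dg'm by (simp add: add_edge_def
        dgm)
  moreover have "\<forall>ed \<in> E'. 0 < (wt({x, y} := w)) ed" using pos w by auto
  moreover have "tedges_ok (wt({x, y} := w)) (deg m') P' (tedge m') (tinc m') (next_id m')"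
    unfolding dg'm m'(4,5) using new_edge by (intro tedges_ok_join[OF tok _ _ m'(6)]) auto
  moreover have "numbering_ok L V {v. sing m' v} P' (wt({x, y} := w)) (deg m') (num m') (lam m')
      (created m') (dict m')"
    using num unfolding dg'm sS .
  ultimately show ?thesis unfolding state_ok_def by blast
qed

lemma extend_ok:
  fixes x y :: 'v
  assumes s: "state_ok L V E wt m P" and x: "sing m x" "deg m x = 1" and y: "sing m y" "deg m y \<noteq> 1"
    and xy: "x \<noteq> y" "{x, y} \<notin> E" and w: "0 < w"
    and L: "2 * card {v \<in> V. 2 \<le> deg (add_edge x y w m) v} \<le> L"
    and D: "\<forall>N \<le> card V + 4. D N \<le> K" and A: "log 2 (real (card V)) + 2 \<le> A"
  shows "\<exists>m' P' c. extend D L x y w (add_edge x y w m) = ((), m', c) \<and>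
    state_ok L V (insert {x, y} E) (wt({x, y} := w)) m' P' \<and>
    deg m' = deg (add_edge x y w m) \<and> sing m' = (sing m)(x := False) \<and> c \<le> 23 + 3 * K \<and>
    potential A (deg m') P' \<le> potential A (deg m) P + 2 * A + 2"
proof -
  obtain P1 e p where P1: "state_ok L V E wt m P1" "P1 e = Some p" "last p = x"
    "\<forall>A. potential A (deg m) P1 = potential A (deg m) P"
    using end_path[OF s x(2,1)] by blast
  let ?S = "{v. sing m v}"
  interpret decomposition V E ?S P1 using P1(1) by (simp add: state_ok_def)
  have nok: "numbering_ok L V ?S P1 wt (deg m) (num m) (lam m) (created m) (dict m)"
    and adj: "adj_ok E wt (deg m) (adj m)"
    and tok: "tedges_ok wt (deg m) P1 (tedge m) (tinc m) (next_id m)"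
    using P1(1) by (auto simp: state_ok_def)
  have dg: "deg m v = card {ed \<in> E. v \<in> ed}" for v using adj_ok_degree[OF adj] by simp
  have "continuation {} y [y]" using y unfolding continuation_def dg by simp
  then interpret J: joining V E ?S P1 "deg m" e p x y "{}" "[y]"
    using P1(2,3) x xy dg by unfold_locales auto
  let ?W = "sum_list (map wt (path_edges p))" and ?u = "last (hd p # inner p)"
  define m0 where "m0 = add_edge x y w m"
  define m1 where "m1 = m0\<lparr>tedge := (tedge m)(e \<mapsto> (hd p, y, ?W + w)), tinc := (tinc m)(y := e),
    sing := (sing m)(x := False)\<rparr>"
  have hl: "hd p \<noteq> last p" using ends_distinct[OF path[OF P1(2)]] P1(3) x(2) dg by simp
  obtain a b where ab: "tedge m e = Some (a, b, ?W)" "other_end (a, b, ?W) x = hd p"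
    using other_end_last[OF tok P1(2) hl] P1(3) by blast
  have ti: "tinc m x = e" using tedges_okD(3)[OF tok P1(2)] x P1(3) by simp
  have u: "adj m0 x 0 = (?u, wt {x, ?u})"
    using end_neighbour(1)[OF adj path[OF P1(2)] P1(3) x(2) xy(1)] by (simp add: m0_def)
  have m0: "sing m0 = sing m" "tedge m0 = tedge m" "tinc m0 = tinc m" by (simp_all add: m0_def)
  have adj1: "adj_ok J.E' (wt({x, y} := w)) J.dg' (adj m1)"
    using adj_ok_insert[OF adj xy] by (simp add: m1_def m0_def add_edge_def)
  have sing1: "sing m1 = (\<lambda>v. v \<in> J.S')" by (auto simp: m1_def fun_eq_iff)
  have nok1: "numbering_ok L V ?S P1 wt (deg m) (num m1) (lam m1) (created m1) (dict m)"
    using nok by (simp add: m1_def m0_def)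
  have wt': "\<And>ed. ed \<in> E \<Longrightarrow> (wt({x, y} := w)) ed = wt ed" using xy(2) by auto
  have L1: "2 * card {v \<in> V. 2 \<le> J.dg' v} \<le> L" using L by simp
  have "\<exists>nm lm cr dc' c. grow D L e x ?u 1 m1 = ((), m1\<lparr>num := nm, lam := lm, created := cr, dict
      := dc'\<rparr>, c) \<and>
    numbering_ok L V J.S' J.P' (wt({x, y} := w)) J.dg' nm lm cr dc' \<and> c \<le> 7 * 1 + 10 + 3 * K"
  proof (rule J.grow_exec[where D = D and K = K, OF nok1 adj1 sing1 _ L1 _ _ refl])
    show "(wt({x, y} := w)) ed = wt ed" if "ed \<in> E" for ed using wt'[OF that] .
    show "\<forall>N \<le> card V + 4. D N \<le> K" by (rule D)
  qed (simp_all add: m1_def m0_def)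
  then obtain nm lm cr dc c where g: "grow D L e x ?u 1 m1 = ((), m1\<lparr>num := nm, lam := lm, created
      := cr, dict := dc\<rparr>, c)"
    "numbering_ok L V J.S' J.P' (wt({x, y} := w)) J.dg' nm lm cr dc" "c \<le> 7 * 1 + 10 + 3 * K"
    by blast
  define m2 where "m2 = m1\<lparr>num := nm, lam := lm, created := cr, dict := dc\<rparr>"
  have ex: "extend D L x y w m0 = ((), m2, 6 + c)"
    using g(1) u ti ab m0
    by (simp add: extend_def bind_ram_def get_adj_def get_tinc_def get_tedge_def set_tedge_def
        set_tinc_def set_sing_def
        m1_def m2_def del: fun_upd_apply)
  have restrict: "f |` UNIV = f" for f :: "nat \<Rightarrow> ('v \<times> 'v \<times> real) option" by (simp add:
      restrict_map_def)
  have "state_ok L V J.E' (wt({x, y} := w)) m2 J.P'"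
    by (rule J.state_ok_join[OF P1(1) refl refl w])
      (use g(2) sing1 in \<open>simp_all add: m2_def m1_def m0_def restrict del: fun_upd_apply\<close>)
  moreover have "deg m2 = deg (add_edge x y w m)" "sing m2 = (sing m)(x := False)"
    by (simp_all add: m2_def m1_def m0_def)
  moreover have "potential A (deg m2) J.P' \<le> potential A (deg m) P + 2 * A + 2"
    using J.potential_join[OF A] P1(4) unfolding calculation(2) by (simp del: fun_upd_apply)
  ultimately show ?thesis using ex g(3) unfolding m0_def
    by (intro exI[of _ m2] exI[of _ J.P'] exI[of _ "6 + c"]) (simp del: fun_upd_apply)
qed

lemma path_size_ok:
  assumes s: "state_ok L V E wt m P" and P: "P e = Some p" "last p = x" "deg m x = 1" "x \<noteq> y"
    and D: "\<forall>N \<le> card V + 4. D N \<le> K"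
  shows "\<exists>c. path_size D x (add_edge x y w m) = (length (inner p), add_edge x y w m, c) \<and> c \<le> 4 + K"
    "\<exists>c. path_size D x (add_edge y x w m) = (length (inner p), add_edge y x w m, c) \<and> c \<le> 4 + K"
proof -
  interpret decomposition V E "{v. sing m v}" P using s by (simp add: state_ok_def)
  have nok: "numbering_ok L V {v. sing m v} P wt (deg m) (num m) (lam m) (created m) (dict m)"
    and adj: "adj_ok E wt (deg m) (adj m)" using s by (auto simp: state_ok_def)
  let ?u = "last (hd p # inner p)"
  have sz: "D (card (dom (dict m))) \<le> K" using dict_bounds[OF nok] by (intro D[rule_format]) simp
  have "\<exists>c. path_size D x m0 = (length (inner p), m0, c) \<and> c \<le> 4 + K"
    if m0: "adj m0 x 0 = (?u, wt {x, ?u})" "sing m0 = sing m" "num m0 = num m" "dict m0 = dict m"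
        for m0
  proof (cases "inner p = []")
    case True
    then have "sing m ?u" using path[OF P(1)] by (auto simp: rpath_def)
    then show ?thesis using m0 True
      by (simp add: path_size_def bind_ram_def get_adj_def get_sing_def return_def)
  next
    case False
    then have u: "?u \<in> set (inner p)" by simp
    then have ns: "\<not> sing m ?u" using path[OF P(1)] by (auto simp: rpath_def)
    have "dict_pred D (num m ?u) m0 = ((num m (low (num m) (inner p)), e, length (inner p), low
        (num m) (inner p)), m0, D (card (dom (dict m))))"
      using dict_pred_exec[of m0 "num m ?u" _ _ D] dict_lookup[OF nok P(1) u] m0(4) by (simp add:
          dict_size_def)
    then show ?thesis using m0 ns sz
      by (simp add: path_size_def bind_ram_def get_adj_def get_sing_def get_num_def return_def)
  qed
  then show "\<exists>c. path_size D x (add_edge x y w m) = (length (inner p), add_edge x y w m, c) \<and> c \<le>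
      4 + K"
    "\<exists>c. path_size D x (add_edge y x w m) = (length (inner p), add_edge y x w m, c) \<and> c \<le> 4 + K"
    using end_neighbour[OF adj path[OF P(1)] P(2-4)] by auto
qed

text \<open>The path at \<open>y\<close> is reversed so that it starts in \<open>y\<close> and can
  be appended to \<open>p\<close>. The minimum equals \<open>length (inner r)\<close> once
  \<open>merge\<close> has chosen the shorter side.\<close>

lemma absorb_ok:
  fixes x y :: 'v
  assumes s: "state_ok L V E wt m P" and x: "deg m x = 1" and y: "deg m y = 1"
    and P: "P e = Some p" "last p = x" "P f = Some r" "last r = y" "e \<noteq> f"
    and xy: "x \<noteq> y" "{x, y} \<notin> E" and w: "0 < w"
    and L: "2 * card {v \<in> V. 2 \<le> deg (add_edge x y w m) v} \<le> L"
    and D: "\<forall>N \<le> card V + 4. D N \<le> K" and A: "log 2 (real (card V)) + 2 \<le> A"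
  shows "\<exists>m' P' c. absorb D L x y w (length (inner r)) (add_edge x y w m) = ((), m', c) \<and>
    state_ok L V (insert {x, y} E) (wt({x, y} := w)) m' P' \<and>
    deg m' = deg (add_edge x y w m) \<and> sing m' = (sing m)(x := False, y := False) \<and>
    c \<le> 7 * length (inner r) + 40 + 5 * K \<and>
    potential A (deg m') P' + real (min (length (inner p)) (length (inner r)))
      \<le> potential A (deg m) P + 2 * A + 2"
proof -
  let ?S = "{v. sing m v}"
  define q where "q = rev r"
  define P1 where "P1 = P(f \<mapsto> q)"
  have s1: "state_ok L V E wt m P1" unfolding P1_def q_def by (rule state_ok_flip[OF s P(3)])
  interpret d: decomposition V E ?S P using s by (simp add: state_ok_def)
  interpret decomposition V E ?S P1 using s1 by (simp add: state_ok_def)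
  have rn: "r \<noteq> []" using d.length_path[OF d.path[OF P(3)]] by auto
  have P1: "P1 e = Some p" "P1 f = Some q" "hd q = y" "length (inner q) = length (inner r)"
    using P rn by (auto simp: P1_def q_def hd_rev)
  have pot1: "potential A (deg m) P1 = potential A (deg m) P"
    unfolding P1_def q_def using potential_flip[of P f r, OF P(3) rn] .
  have nok: "numbering_ok L V ?S P1 wt (deg m) (num m) (lam m) (created m) (dict m)"
    and adj: "adj_ok E wt (deg m) (adj m)"
    and tok: "tedges_ok wt (deg m) P1 (tedge m) (tinc m) (next_id m)"
    using s1 by (auto simp: state_ok_def)
  have dg: "deg m v = card {ed \<in> E. v \<in> ed}" for v using adj_ok_degree[OF adj] by simp
  have "continuation {f} y q" using y P1 unfolding continuation_def dg by simp
  then interpret J: joining V E ?S P1 "deg m" e p x y "{f}" q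
    using P1(1) P(2,5) x xy dg by unfold_locales auto
  let ?W = "sum_list (map wt (path_edges p))" and ?W' = "sum_list (map wt (path_edges q))"
    and ?u = "last (hd p # inner p)"
  define v where "v = last (hd r # inner r)"
  define m0 where "m0 = add_edge x y w m"
  define dc1 where "dc1 = (if inner q \<noteq> [] then (dict m)(num m (low (num m) (inner q)) := None)
      else dict m)"
  define m1 where "m1 = m0\<lparr>tedge := (tedge m)(e \<mapsto> (hd p, last q, ?W + w + ?W'), f := None),
    tinc := (tinc m)(last q := e), sing := (sing m)(x := False, y := False)\<rparr>"
  define m2 where "m2 = m1\<lparr>dict := dc1\<rparr>"
  have bq: "butlast q = y # inner q" using J.props(12)[of f] by (metis insertI1 butlast.simps(2)
      butlast_snoc append_is_Nil_conv list.distinct(1))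
  have hp: "hd p \<noteq> last p" using ends_distinct[OF path[OF P1(1)]] P(2) x dg by simp
  have hq: "hd q \<noteq> last q" using J.props(6) P1(3) bq by auto
  obtain a b where ab: "tedge m e = Some (a, b, ?W)" "other_end (a, b, ?W) x = hd p"
    using other_end_last[OF tok P1(1) hp] P(2) by blast
  obtain a' b' where ab': "tedge m f = Some (a', b', ?W')" "other_end (a', b', ?W') y = last q"
    using other_end_last[OF tok P1(2) hq] P1(3) by blast
  have ti: "tinc m x = e" using tedges_okD(3)[OF tok P1(1)] x P(2) by simp
  have ti': "tinc m y = f" using tedges_okD(2)[OF tok P1(2)] y P1(3) by simp
  have u: "adj m0 x 0 = (?u, wt {x, ?u})"
    using end_neighbour(1)[OF adj path[OF P1(1)] P(2) x xy(1)] by (simp add: m0_def)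
  have v: "adj m0 y 0 = (v, wt {y, v})"
    using d.end_neighbour(2)[OF adj d.path[OF P(3)] P(4) y xy(1)[symmetric]] by (simp add: m0_def
        v_def)
  have m0: "sing m0 = sing m" "tedge m0 = tedge m" "tinc m0 = tinc m" "num m0 = num m" "dict m0 =
      dict m"
    by (simp_all add: m0_def)
  have xS: "x \<in> ?S" "y \<in> ?S" using J.x_S J.props(9) by auto
  have S': "J.S' = ?S - {x, y}" using J.props(10) bq by auto
  have adj2: "adj_ok J.E' (wt({x, y} := w)) J.dg' (adj m2)"
    using adj_ok_insert[OF adj xy] by (simp add: m2_def m1_def m0_def add_edge_def)
  have sing2: "sing m2 = (\<lambda>v. v \<in> J.S')" unfolding S' by (auto simp: m2_def m1_def fun_eq_iff)
  have nok2: "numbering_ok L V ?S P1 wt (deg m) (num m2) (lam m2) (created m2) (dict m)"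
    using nok by (simp add: m2_def m1_def m0_def)
  have wt': "\<And>ed. ed \<in> E \<Longrightarrow> (wt({x, y} := w)) ed = wt ed" using xy(2) by auto
  have L1: "2 * card {v \<in> V. 2 \<le> J.dg' v} \<le> L" using L by simp
  have dc1: "dict m2 = (if {f} \<noteq> {} \<and> inner q \<noteq> [] then (dict m)(num m2 (low (num m2) (inner q))
      := None) else dict m)"
    by (simp add: m2_def m1_def m0_def dc1_def)
  have n: "length (inner r) + 2 = length (x # butlast q)" using P1(4) bq by simp
  have "\<exists>nm lm cr dc' c. grow D L e x ?u (length (inner r) + 2) m2 = ((), m2\<lparr>num := nm, lam := lm,
      created := cr, dict := dc'\<rparr>, c) \<and>
    numbering_ok L V J.S' J.P' (wt({x, y} := w)) J.dg' nm lm cr dc' \<and> c \<le> 7 * (length (inner r) +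
        2) + 10 + 3 * K"
  proof (rule J.grow_exec[where D = D and K = K, OF nok2 adj2 sing2 _ L1 dc1 _ refl n])
    show "(wt({x, y} := w)) ed = wt ed" if "ed \<in> E" for ed using wt'[OF that] .
    show "\<forall>N \<le> card V + 4. D N \<le> K" by (rule D)
  qed
  then obtain nm lm cr dc c where g: "grow D L e x ?u (length (inner r) + 2) m2 = ((), m2\<lparr>num :=
      nm, lam := lm, created := cr, dict := dc\<rparr>, c)"
    "numbering_ok L V J.S' J.P' (wt({x, y} := w)) J.dg' nm lm cr dc" "c \<le> 7 * (length (inner r) +
        2) + 10 + 3 * K"
    by blast
  define m3 where "m3 = m2\<lparr>num := nm, lam := lm, created := cr, dict := dc\<rparr>"
  have sz: "D (card (dom (dict m))) \<le> K" using dict_bounds[OF nok] by (intro D[rule_format]) simp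
  define B where "B v = (if 0 < length (inner r) then do {
       k \<leftarrow> get_num v;
       (a, _) \<leftarrow> dict_pred D k;
       dict_delete D a
     } else return ())" for v :: 'v
  have "\<exists>c. B v m1 = ((), m2, c) \<and> c \<le> 1 + 2 * K"
  proof (cases "inner r = []")
    case True
    then show ?thesis using P1(4) by (simp add: B_def return_def m2_def dc1_def m1_def m0)
  next
    case False
    then have qn: "inner q \<noteq> []" using P1(4) by auto
    have vq: "v \<in> set (inner q)" using False by (simp add: v_def q_def)
    have "dict_pred D (num m v) m1 = ((num m (low (num m) (inner q)), f, length (inner q), low
        (num m) (inner q)), m1, D (card (dom (dict m))))"
      using dict_pred_exec[of m1 "num m v" _ _ D] dict_lookup[OF nok P1(2) vq] by (simp add:
          dict_size_def m1_def m0)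
    moreover have "num m1 = num m" "dict m1 = dict m" by (simp_all add: m1_def m0)
    ultimately show ?thesis using False qn sz
      by (simp add: B_def bind_ram_def get_num_def dict_delete_def m2_def dc1_def dict_size_def)
  qed
  then obtain c1 where c1: "B v m1 = ((), m2, c1)" "c1 \<le> 1 + 2 * K" by blast
  have absorb: "absorb D L x y w (length (inner r)) = do {
     (u, _) \<leftarrow> get_adj x 0;
     (v, _) \<leftarrow> get_adj y 0;
     e \<leftarrow> get_tinc x;
     f \<leftarrow> get_tinc y;
     (s, t, W) \<leftarrow> get_tedge e;
     (s', t', W') \<leftarrow> get_tedge f;
     let q = other_end (s', t', W') y;
     set_tedge e (other_end (s, t, W) x) q (W + w + W');
     del_tedge f;
     set_tinc q e;
     set_sing x False;
     set_sing y False;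
     B v;
     grow D L e x u (length (inner r) + 2) }"
    unfolding absorb_def B_def by (rule refl)
  have "((m0\<lparr>tedge := (tedge m)(e \<mapsto> (hd p, last q, ?W + w + ?W'), f := None),
      tinc := (tinc m)(last q := e), sing := (sing m)(x := False, y := False)\<rparr>)) = m1"
    by (simp add: m1_def)
  then have ex: "absorb D L x y w (length (inner r)) m0 = ((), m3, 11 + (c1 + c))"
    using ab ab' ti ti' u v m0 c1(1) g(1) unfolding absorb
    by (simp add: bind_ram_def get_adj_def get_tinc_def get_tedge_def set_tedge_def del_tedge_def
        set_tinc_def set_sing_def
      m3_def[symmetric] Let_def del: fun_upd_apply)
  have te: "(tedge m)(e \<mapsto> T, f := None) = (tedge m |` (- {f}))(e \<mapsto> T)" for T
    using P(5) by (auto simp: fun_eq_iff restrict_map_def)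
  have "state_ok L V J.E' (wt({x, y} := w)) m3 J.P'"
    by (rule J.state_ok_join[OF s1 refl refl w])
      (use g(2) sing2 te in \<open>simp_all add: m3_def m2_def m1_def m0_def del: fun_upd_apply\<close>)
  moreover have "deg m3 = deg (add_edge x y w m)" "sing m3 = (sing m)(x := False, y := False)"
    by (simp_all add: m3_def m2_def m1_def m0_def)
  moreover have "potential A (deg m3) J.P' + real (min (length (inner p)) (length (inner r)))
      \<le> potential A (deg m) P + 2 * A + 2"
    using J.potential_join[OF A] pot1 P1(4) unfolding calculation(2) by (simp del: fun_upd_apply)
  moreover have "11 + (c1 + c) \<le> 7 * length (inner r) + 40 + 5 * K" using c1(2) g(3) by simp
  ultimately show ?thesis using ex unfolding m0_def by blast
qed

text \<open>\<open>no_loop\<close> ranges over all valid ghost decompositions, because the one used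
  below arises by reversals. With the factor 7, the potential released by a merge pays for the steps
  of \<open>walk\<close>, and \<open>14 * A\<close> is the sevenfold deposit of two new inner
  vertices.\<close>

lemma merge_ok:
  fixes x y :: 'v
  assumes s: "state_ok L V E wt m P" and x: "sing m x" "deg m x = 1" and y: "sing m y" "deg m y = 1"
    and no_loop: "\<forall>P e p. state_ok L V E wt m P \<and> P e = Some p \<and> hd p = x \<longrightarrow> last p \<noteq> y"
    and xy: "x \<noteq> y" "{x, y} \<notin> E" and w: "0 < w"
    and L: "2 * card {v \<in> V. 2 \<le> deg (add_edge x y w m) v} \<le> L"
    and D: "\<forall>N \<le> card V + 4. D N \<le> K" and A: "log 2 (real (card V)) + 2 \<le> A"
  shows "\<exists>m' P' c. merge D L x y w (add_edge x y w m) = ((), m', c) \<and>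
    state_ok L V (insert {x, y} E) (wt({x, y} := w)) m' P' \<and>
    deg m' = deg (add_edge x y w m) \<and> sing m' = (sing m)(x := False, y := False) \<and>
    real c + 7 * potential A (deg m') P' \<le> 7 * potential A (deg m) P + 14 * A + 70 + 10 * real K"
proof -
  obtain P1 e p where P1: "state_ok L V E wt m P1" "P1 e = Some p" "last p = x"
    "\<forall>A. potential A (deg m) P1 = potential A (deg m) P"
    using end_path[OF s x(2,1)] by blast
  obtain P2 f r where P2: "state_ok L V E wt m P2" "P2 f = Some r" "last r = y" "\<forall>g. g \<noteq> f \<longrightarrow> P2 g
      = P1 g"
    "\<forall>A. potential A (deg m) P2 = potential A (deg m) P1"
    using end_path[OF P1(1) y(2,1)] by blast
  \<comment> \<open>If the paths coincided, the stored ends of \<open>e\<close> would be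
    \<open>x\<close> and \<open>y\<close>, contrary to \<open>no_loop\<close>.\<close>
  have ef: "e \<noteq> f"
  proof
    assume "e = f"
    have "tedge m e = Some (hd p, x, sum_list (map wt (path_edges p))) \<or>
      tedge m e = Some (x, hd p, sum_list (map wt (path_edges p)))"
      using tedges_okD(1)[of wt "deg m" P1 "tedge m" "tinc m" "next_id m"] P1(1-3) by (auto simp:
          state_ok_def)
    moreover have "tedge m e = Some (hd r, y, sum_list (map wt (path_edges r))) \<or>
      tedge m e = Some (y, hd r, sum_list (map wt (path_edges r)))"
      using tedges_okD(1)[of wt "deg m" P2 "tedge m" "tinc m" "next_id m"] P2(1-3) \<open>e = f\<close> by
          (auto simp: state_ok_def)
    ultimately have "hd r = x" using xy(1) by auto
    then show False using no_loop P2(1-3) by blast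
  qed
  have P2e: "P2 e = Some p" using P1(2) P2(4) ef by simp
  have pot2: "potential A (deg m) P2 = potential A (deg m) P" using P1(4) P2(5) by simp
  let ?m = "add_edge x y w m"
  obtain c1 where c1: "path_size D x ?m = (length (inner p), ?m, c1)" "c1 \<le> 4 + K"
    using path_size_ok(1)[OF P2(1) P2e P1(3) x(2) xy(1) D] by blast
  obtain c2 where c2: "path_size D y ?m = (length (inner r), ?m, c2)" "c2 \<le> 4 + K"
    using path_size_ok(2)[OF P2(1,2,3) y(2) xy(1)[symmetric] D] by blast
  show ?thesis
  proof (cases "length (inner r) \<le> length (inner p)")
    case True
    obtain m' P' c where a: "absorb D L x y w (length (inner r)) ?m = ((), m', c)"
      "state_ok L V (insert {x, y} E) (wt({x, y} := w)) m' P'" "deg m' = deg ?m"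
      "sing m' = (sing m)(x := False, y := False)" "c \<le> 7 * length (inner r) + 40 + 5 * K"
      "potential A (deg m') P' + real (min (length (inner p)) (length (inner r))) \<le> potential A
          (deg m) P2 + 2 * A + 2"
      using absorb_ok[OF P2(1) x(2) y(2) P2e P1(3) P2(2,3) ef xy w L D A] by blast
    have "merge D L x y w ?m = ((), m', c1 + (c2 + c))"
      using True c1(1) c2(1) a(1) by (simp add: merge_def bind_ram_def)
    moreover have "real (c1 + (c2 + c)) \<le> 7 * real (length (inner r)) + 48 + 7 * real K"
      using c1(2) c2(2) a(5) by linarith
    moreover have "real (min (length (inner p)) (length (inner r))) = real (length (inner r))"
        using True by simp
    ultimately have "merge D L x y w ?m = ((), m', c1 + (c2 + c)) \<and> real (c1 + (c2 + c)) + 7 *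
        potential A (deg m') P'
      \<le> 7 * potential A (deg m) P + 14 * A + 70 + 10 * real K" using a(6) pot2 by linarith
    then show ?thesis using a(2,3,4) by blast
  next
    case False
    have yx: "y \<noteq> x" "{y, x} \<notin> E" "{y, x} = {x, y}" "add_edge y x w m = ?m"
      using xy add_edge_commute[of y x w m] by (auto simp: insert_commute)
    have L': "2 * card {v \<in> V. 2 \<le> deg (add_edge y x w m) v} \<le> L" using L unfolding yx .
    obtain m' P' c where a: "absorb D L y x w (length (inner p)) ?m = ((), m', c)"
      "state_ok L V (insert {x, y} E) (wt({x, y} := w)) m' P'" "deg m' = deg ?m"
      "sing m' = (sing m)(y := False, x := False)" "c \<le> 7 * length (inner p) + 40 + 5 * K"
      "potential A (deg m') P' + real (min (length (inner r)) (length (inner p))) \<le> potential A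
          (deg m) P2 + 2 * A + 2"
      using absorb_ok[OF P2(1) y(2) x(2) P2(2,3) P2e P1(3) ef[symmetric] yx(1,2) w L' D A]
          unfolding yx by blast
    have "merge D L x y w ?m = ((), m', c1 + (c2 + c))"
      using False c1(1) c2(1) a(1) by (simp add: merge_def bind_ram_def)
    moreover have "real (c1 + (c2 + c)) \<le> 7 * real (length (inner p)) + 48 + 7 * real K"
      using c1(2) c2(2) a(5) by linarith
    moreover have "real (min (length (inner r)) (length (inner p))) = real (length (inner p))"
        using False by simp
    ultimately have "merge D L x y w ?m = ((), m', c1 + (c2 + c)) \<and> real (c1 + (c2 + c)) + 7 *
        potential A (deg m') P'
      \<le> 7 * potential A (deg m) P + 14 * A + 70 + 10 * real K" using a(6) pot2 by linarith
    moreover have "sing m' = (sing m)(x := False, y := False)" using a(4) xy(1) by (simp add: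
        fun_upd_twist)
    ultimately show ?thesis using a(2,3) by blast
  qed
qed

lemma insert_tedge_ok:
  fixes x y :: 'v
  assumes s: "state_ok L V E wt m P" and x: "sing m x" "deg m x \<noteq> 1" and y: "sing m y" "deg m y \<noteq> 1"
    and xy: "x \<noteq> y" "{x, y} \<notin> E" and w: "0 < w"
  shows "\<exists>m' P'. insert_tedge x y w (add_edge x y w m) = ((), m', 4) \<and>
    state_ok L V (insert {x, y} E) (wt({x, y} := w)) m' P' \<and>
    deg m' = deg (add_edge x y w m) \<and> sing m' = sing m \<and>
    potential A (deg m') P' = potential A (deg m) P"
proof -
  let ?S = "{v. sing m v}"
  interpret decomposition V E ?S P using s by (simp add: state_ok_def)
  have nok: "numbering_ok L V ?S P wt (deg m) (num m) (lam m) (created m) (dict m)"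
    and adj: "adj_ok E wt (deg m) (adj m)" and pos: "\<forall>ed \<in> E. 0 < wt ed"
    and tok: "tedges_ok wt (deg m) P (tedge m) (tinc m) (next_id m)"
    using s by (auto simp: state_ok_def)
  have dg: "deg m v = card {ed \<in> E. v \<in> ed}" for v using adj_ok_degree[OF adj] by simp
  define e where "e = next_id m"
  have e: "e \<notin> dom P" "P e = None" using tok by (auto simp: tedges_ok_def e_def)
  let ?dg = "(deg m)(x := deg m x + 1, y := deg m y + 1)" and ?P = "P(e \<mapsto> [x, y])" and ?wt =
      "wt({x, y} := w)"
  define m' where "m' = (add_edge x y w m)\<lparr>next_id := Suc e, tedge := (tedge m)(e \<mapsto> (x, y, w)),
      tinc := (tinc m)(x := e, y := e)\<rparr>"
  have ex: "insert_tedge x y w (add_edge x y w m) = ((), m', 4)"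
    by (simp add: insert_tedge_def bind_ram_def new_tedge_def set_tedge_def set_tinc_def m'_def
        e_def)
  have "decomposition V (insert {x, y} E) ?S ?P" using add_path[of x y e] x y xy e by simp
  moreover have "adj_ok (insert {x, y} E) ?wt ?dg (adj m')"
    using adj_ok_insert[OF adj xy] by (simp add: m'_def add_edge_def)
  moreover have "\<forall>ed \<in> insert {x, y} E. 0 < ?wt ed" using pos w by auto
  moreover have "tedges_ok ?wt ?dg ?P (tedge m') (tinc m') (next_id m')"
    unfolding tedges_ok_def
  proof (intro conjI allI impI ballI)
    have "dom (tedge m) = dom P" using tok by (simp add: tedges_ok_def)
    then show "dom (tedge m') = dom ?P" by (simp add: m'_def)
    show "g < next_id m'" if "g \<in> dom ?P" for g
      using that tok by (auto simp: m'_def tedges_ok_def e_def less_Suc_eq split: if_splits)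
    fix g r assume g: "?P g = Some r"
    have old: "P g = Some r" "(?dg (hd r) = 1 \<longleftrightarrow> deg m (hd r) = 1)" "(?dg (last r) = 1 \<longleftrightarrow> deg m
        (last r) = 1)" if "g \<noteq> e"
    proof -
      show Pg: "P g = Some r" using g that by simp
      show "(?dg (hd r) = 1 \<longleftrightarrow> deg m (hd r) = 1)" "(?dg (last r) = 1 \<longleftrightarrow> deg m (last r) = 1)"
        using end_degree[OF Pg] x(2) y(2) unfolding dg[symmetric] by auto
    qed
    show "tedge m' g = Some (hd r, last r, sum_list (map ?wt (path_edges r))) \<or>
      tedge m' g = Some (last r, hd r, sum_list (map ?wt (path_edges r)))"
    proof (cases "g = e")
      case True
      then show ?thesis using g by (auto simp: m'_def)
    next
      case False
      have "set (path_edges r) \<subseteq> E" using path[OF old(1)[OF False]] by (simp add: rpath_def)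
      then have eq: "map ?wt (path_edges r) = map wt (path_edges r)" using xy(2) by auto
      show ?thesis unfolding eq using tedges_okD(1)[OF tok old(1)[OF False]] False by (simp add:
          m'_def)
    qed
    show "tinc m' (hd r) = g" if "?dg (hd r) = 1"
    proof (cases "g = e")
      case True
      then show ?thesis using g xy(1) by (auto simp: m'_def)
    next
      case False
      have d: "deg m (hd r) = 1" using that unfolding old(2)[OF False] .
      then show ?thesis using tedges_okD(2)[OF tok old(1)[OF False] d] x(2) y(2) by (auto simp:
          m'_def)
    qed
    show "tinc m' (last r) = g" if "?dg (last r) = 1"
    proof (cases "g = e")
      case True
      then show ?thesis using g xy(1) by (auto simp: m'_def)
    next
      case False
      have d: "deg m (last r) = 1" using that unfolding old(3)[OF False] .
      then show ?thesis using tedges_okD(3)[OF tok old(1)[OF False] d] x(2) y(2) by (auto simp: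
          m'_def)
    qed
  qed
  moreover have "numbering_ok L V ?S ?P ?wt ?dg (num m) (lam m) (created m) (dict m)"
    using xy(2) by (intro numbering_ok_add[OF nok dg x(2) y(2) xy(1) e(1)]) auto
  ultimately have "state_ok L V (insert {x, y} E) ?wt m' ?P"
    unfolding state_ok_def by (simp add: m'_def del: fun_upd_apply)
  moreover have "potential A ?dg ?P = potential A (deg m) P"
    using potential_add[OF dg x(2) y(2) xy(1) e(1)] .
  ultimately show ?thesis using ex
    by (intro exI[of _ m'] exI[of _ ?P]) (simp add: m'_def del: fun_upd_apply)
qed

lemma handshake:
  assumes "finite V" "finite E" "\<And>ed. ed \<in> E \<Longrightarrow> \<exists>u v. ed = {u, v} \<and> u \<noteq> v \<and> u \<in> V \<and> v \<in> V"
  shows "(\<Sum>v \<in> V. card {ed \<in> E. v \<in> ed}) = 2 * card E"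
proof -
  have "card {v \<in> V. v \<in> ed} = 2" if ed: "ed \<in> E" for ed
  proof -
    obtain u v where "ed = {u, v}" "u \<noteq> v" "u \<in> V" "v \<in> V" using assms(3)[OF ed] by blast
    moreover from this have "{a \<in> V. a \<in> ed} = {u, v}" by auto
    ultimately show ?thesis by simp
  qed
  then have "(\<Sum>v \<in> V. card {ed \<in> E. v \<in> ed}) = (\<Sum>ed \<in> E. 2)"
    using assms(1,2) by (intro sum_multicount_gen) auto
  then show ?thesis by simp
qed

text \<open>The agreement between \<open>sing\<close> and the degrees breaks when an end point is
  split and is restored by the change of degree. \<open>acyclic\<close> excludes merging a path with
  itself.\<close>

lemma insert_edge_ok:
  fixes x y :: 'v
  assumes s: "state_ok L V E wt m P" and sing: "\<And>v. sing m v \<longleftrightarrow> v \<in> V \<and> deg m v \<noteq> 2"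
    and V: "x \<in> V" "y \<in> V" and xy: "x \<noteq> y" "{x, y} \<notin> E" and w: "0 < w"
    and acyclic: "\<And>c. \<not> regular_cycle \<lparr>verts = V, edges = insert {x, y} E, weight = wt({x, y} :=
        w)\<rparr> c"
    and L: "card V + card (insert {x, y} E) \<le> L"
    and D: "\<forall>N \<le> card V + 4. D N \<le> K" and A: "log 2 (real (card V)) + 2 \<le> A"
  shows "\<exists>m' P' c. insert_edge D L x y w m = ((), m', c) \<and>
    state_ok L V (insert {x, y} E) (wt({x, y} := w)) m' P' \<and> (\<forall>v. sing m' v \<longleftrightarrow> v \<in> V \<and> deg m' v \<noteq>
        2) \<and>
    real c + 7 * potential A (deg m') P' \<le> 7 * potential A (deg m) P + 14 * A + 200 + 20 * real K"
proof -
  have split: "\<exists>m1 P1 c. (if deg m v = 2 then Defs.split D v else return ()) m0 = ((), m1, c) \<and>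
      state_ok L V E wt m1 P1 \<and> deg m1 = deg m \<and> sing m1 = (sing m0)(v := True) \<and> c \<le> 25 + 3 * K \<and>
      potential A (deg m) P1 \<le> potential A (deg m) P0"
    if m0: "state_ok L V E wt m0 P0" "deg m0 = deg m" and v: "v \<in> V" "sing m0 v \<longleftrightarrow> deg m v \<noteq> 2" for
        m0 P0 v
  proof (cases "deg m v = 2")
    case True
    then show ?thesis using split_ok[OF m0(1) v(1) _ D A] m0(2) v(2) by auto
  next
    case False
    then have "sing m0 = (sing m0)(v := True)" using v(2) by (auto simp: fun_eq_iff)
    then show ?thesis using False m0 by (intro exI[of _ m0] exI[of _ P0]) (simp add: return_def)
  qed
  obtain m1 P1 c1 where m1: "(if deg m x = 2 then Defs.split D x else return ()) m = ((), m1, c1)"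
    "state_ok L V E wt m1 P1" "deg m1 = deg m" "sing m1 = (sing m)(x := True)" "c1 \<le> 25 + 3 * K"
    "potential A (deg m) P1 \<le> potential A (deg m) P"
    using split[OF s refl V(1)] sing V(1) by blast
  have "sing m1 y \<longleftrightarrow> deg m y \<noteq> 2" using m1(4) sing V(2) xy(1) by auto
  then obtain m2 P2 c2 where m2: "(if deg m y = 2 then Defs.split D y else return ()) m1 = ((),
      m2, c2)"
    "state_ok L V E wt m2 P2" "deg m2 = deg m" "sing m2 = (sing m)(x := True, y := True)" "c2 \<le> 25
        + 3 * K"
    "potential A (deg m) P2 \<le> potential A (deg m) P1"
    using split[OF m1(2,3) V(2)] unfolding m1(4) by blast
  interpret d: decomposition V E "{v. sing m2 v}" P2 using m2(2) by (simp add: state_ok_def)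
  have adj: "adj_ok E wt (deg m2) (adj m2)" using m2(2) by (simp add: state_ok_def)
  have dg: "card {ed \<in> E. v \<in> ed} = deg m v" for v using d.adj_ok_degree[OF adj] m2(3) by simp
  let ?m = "add_edge x y w m2" and ?E = "insert {x, y} E" and ?wt = "wt({x, y} := w)"
  have dg': "card {ed \<in> ?E. v \<in> ed} = deg ?m v" for v
    using card_edges_insert[OF d.finite_E xy(2), of v] dg m2(3) xy(1) by auto
  \<comment> \<open>Two bounds on the number of vertices of degree at least two are added: it is at
    most \<open>card ?E\<close> by counting incidences, and at most \<open>card V\<close>.\<close>
  have Lr: "2 * card {v \<in> V. 2 \<le> deg ?m v} \<le> L"
  proof -
    have "(\<Sum>v \<in> V. deg ?m v) = 2 * card ?E"
      unfolding dg'[symmetric] by (rule handshake[OF d.finite_V]) (use d.finite_E d.edge V xy(1)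
          in auto)
    moreover have "2 * card {v \<in> V. 2 \<le> deg ?m v} \<le> (\<Sum>v \<in> {v \<in> V. 2 \<le> deg ?m v}. deg ?m v)"
      using sum_bounded_below[of "{v \<in> V. 2 \<le> deg ?m v}" 2 "deg ?m"] by (simp add: mult.commute
          del: add_edge_simps)
    moreover have "\<dots> \<le> (\<Sum>v \<in> V. deg ?m v)" using d.finite_V by (intro sum_mono2) auto
    moreover have "card {v \<in> V. 2 \<le> deg ?m v} \<le> card V" using d.finite_V by (intro card_mono) auto
    ultimately show ?thesis using L by linarith
  qed
  have sx: "sing m2 x" "sing m2 y" using m2(4) by auto
  have ie: "insert_edge D L x y w m = (case (if deg m x = 1 \<and> deg m y = 1 then merge D L x y w
     else if deg m x = 1 then extend D L x y w
     else if deg m y = 1 then extend D L y x w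
     else insert_tedge x y w) ?m of (b, m', c) \<Rightarrow> (b, m', 2 + (c1 + (c2 + (4 + c)))))"
    using m1(1,3) m2(1,3) xy(1) unfolding insert_edge_def
    by (simp add: bind_ram_def get_deg_def set_adj_def set_deg_def add_edge_def split: prod.split)
  have boundary: "sing m' v \<longleftrightarrow> v \<in> V \<and> deg m' v \<noteq> 2"
    if "deg m' = deg ?m" "sing m' = (sing m2)(x := deg m x \<noteq> 1, y := deg m y \<noteq> 1)" for m' v
    using that sing m2(3,4) xy(1) V by auto
  \<comment> \<open>Two splits and the elementary steps raise the fixed cost to at most
    \<open>126 + 16 * K\<close>, within the bound.\<close>
  have A': "real c + 7 * X \<le> 7 * potential A (deg m) P + 14 * A + 200 + 20 * real K"
    if "c = 2 + (c1 + (c2 + (4 + c')))" "real c' + 7 * X \<le> 7 * potential A (deg m) P2 + 14 * A +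
        70 + 10 * real K" for c c' X
    using that m1(5,6) m2(5,6) by simp
  have ge0: "0 \<le> A"
  proof -
    have "0 < card V" using V d.finite_V by (auto simp: card_gt_0_iff)
    then show ?thesis using A log_nat_nonneg[of "card V"] by linarith
  qed
  consider "deg m x = 1" "deg m y = 1" | "deg m x = 1" "deg m y \<noteq> 1" | "deg m x \<noteq> 1" "deg m y = 1"
    | "deg m x \<noteq> 1" "deg m y \<noteq> 1" by blast
  then show ?thesis
  proof cases
    case 1
    \<comment> \<open>A path from \<open>x\<close> to \<open>y\<close> together with the new edge
      would be a cycle on which \<open>x\<close> and \<open>y\<close>, too, now have degree
      two.\<close>
    have no_loop: False if p: "state_ok L V E wt m2 P'" "P' e = Some p" "hd p = x" "last p = y"
        for P' e p
    proof -
      interpret d': decomposition V E "{v. sing m2 v}" P' using p(1) by (simp add: state_ok_def)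
      have rp: "rpath E {v. sing m2 v} p" using d'.path[OF p(2)] .
      have p2: "2 \<le> length p" using d'.length_path[OF rp] .
      have pp: "p = x # inner p @ [y]" using path_ends[OF p2] p(3,4) by simp
      have "inner p \<noteq> []"
      proof
        assume "inner p = []"
        then have "p = [x, y]" using pp by simp
        then have "{x, y} \<in> E" using rp by (simp add: rpath_def)
        then show False using xy(2) by blast
      qed
      then have "3 \<le> length p" using pp by (metis One_nat_def Suc_eq_plus1 Suc_le_mono
          add_Suc_right length_Cons length_append length_greater_0_conv list.size(3)
          numeral_3_eq_3 Suc_leI)
      moreover have "set (inner p) \<inter> {v. sing m2 v} = {}" "distinct (inner p)" using rp by (auto
          simp: rpath_def)
      then have "distinct (x # inner p @ [y])" using sx xy(1) by auto
      then have "distinct p" using pp by simp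
      moreover have "path_edges (p @ [hd p]) = path_edges p @ [{x, y}]"
        using path_edges_append[of p "[hd p]"] p(3,4) pp by (auto simp: insert_commute)
      then have "set (path_edges (p @ [hd p])) \<subseteq> ?E" using rp by (auto simp: rpath_def)
      moreover have "regular \<lparr>verts = V, edges = ?E, weight = ?wt\<rparr> v" if v: "v \<in> set p" for v
      proof -
        have "v \<in> V" using d'.path_subset[OF rp] v by blast
        moreover have "deg ?m v = 2"
        proof (cases "v = x \<or> v = y")
          case True
          then show ?thesis using 1 m2(3) xy(1) by auto
        next
          case False
          then have "v \<in> set (inner p)" using v set_path[OF p2] p(3,4) by auto
          then have "v \<in> V - {v. sing m2 v}" using d'.inner_subset[OF rp] by blast
          then have "deg m v = 2" using d'.two_edges[of v] dg by simp
          then show ?thesis using False m2(3) by simp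
        qed
        ultimately show ?thesis unfolding regular_def degree_def using dg' by simp
      qed
      ultimately show False using acyclic[of p] unfolding regular_cycle_def by auto
    qed
    have nl: "\<forall>P e p. state_ok L V E wt m2 P \<and> P e = Some p \<and> hd p = x \<longrightarrow> last p \<noteq> y" using no_loop
        by blast
    have d1: "deg m2 x = 1" "deg m2 y = 1" using 1 m2(3) by auto
    obtain m' P' c where m': "merge D L x y w ?m = ((), m', c)"
      "state_ok L V ?E ?wt m' P'" "deg m' = deg ?m" "sing m' = (sing m2)(x := False, y := False)"
      "real c + 7 * potential A (deg m') P' \<le> 7 * potential A (deg m2) P2 + 14 * A + 70 + 10 *
          real K"
      using merge_ok[OF m2(2) sx(1) d1(1) sx(2) d1(2) nl xy w Lr D A] by blast
    have "insert_edge D L x y w m = ((), m', 2 + (c1 + (c2 + (4 + c))))" using ie 1 m'(1) by simp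
    then show ?thesis using m'(2) A'[OF refl m'(5)[unfolded m2(3)]] boundary[OF m'(3)] m'(4) 1 by
        auto
  next
    case 2
    obtain m' P' c where m': "extend D L x y w ?m = ((), m', c)"
      "state_ok L V ?E ?wt m' P'" "deg m' = deg ?m" "sing m' = (sing m2)(x := False)" "c \<le> 23 + 3
          * K"
      "potential A (deg m') P' \<le> potential A (deg m2) P2 + 2 * A + 2"
      using extend_ok[OF m2(2) sx(1) _ sx(2) _ xy w Lr D A] 2 m2(3) by auto
    have "insert_edge D L x y w m = ((), m', 2 + (c1 + (c2 + (4 + c))))" using ie 2 m'(1) by simp
    moreover have "real c + 7 * potential A (deg m') P' \<le> 7 * potential A (deg m) P2 + 14 * A + 70
        + 10 * real K"
      using m'(5,6) m2(3) by simp
    moreover have "sing m' = (sing m2)(x := deg m x \<noteq> 1, y := deg m y \<noteq> 1)" using m'(4) 2 sx xy(1)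
        by (auto simp: fun_eq_iff)
    ultimately show ?thesis using m'(2) A'[OF refl, of c] boundary[OF m'(3)] by blast
  next
    case 3
    have yx: "y \<noteq> x" "{y, x} \<notin> E" "{y, x} = {x, y}" "add_edge y x w m2 = ?m"
      using xy add_edge_commute[of y x w m2] by (auto simp: insert_commute)
    have L': "2 * card {v \<in> V. 2 \<le> deg (add_edge y x w m2) v} \<le> L" using Lr unfolding yx .
    obtain m' P' c where m': "extend D L y x w ?m = ((), m', c)"
      "state_ok L V ?E ?wt m' P'" "deg m' = deg ?m" "sing m' = (sing m2)(y := False)" "c \<le> 23 + 3
          * K"
      "potential A (deg m') P' \<le> potential A (deg m2) P2 + 2 * A + 2"
      using extend_ok[OF m2(2) sx(2) _ sx(1) _ yx(1,2) w L' D A] 3 m2(3) unfolding yx by auto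
    have "insert_edge D L x y w m = ((), m', 2 + (c1 + (c2 + (4 + c))))" using ie 3 m'(1) by simp
    moreover have "real c + 7 * potential A (deg m') P' \<le> 7 * potential A (deg m) P2 + 14 * A + 70
        + 10 * real K"
      using m'(5,6) m2(3) by simp
    moreover have "sing m' = (sing m2)(x := deg m x \<noteq> 1, y := deg m y \<noteq> 1)" using m'(4) 3 sx xy(1)
        by (auto simp: fun_eq_iff)
    ultimately show ?thesis using m'(2) A'[OF refl, of c] boundary[OF m'(3)] by blast
  next
    case 4
    obtain m' P' where m': "insert_tedge x y w ?m = ((), m', 4)"
      "state_ok L V ?E ?wt m' P'" "deg m' = deg ?m" "sing m' = sing m2"
      "potential A (deg m') P' = potential A (deg m2) P2"
      using insert_tedge_ok[OF m2(2) sx(1) _ sx(2) _ xy w, of A] 4 m2(3) by auto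
    have "insert_edge D L x y w m = ((), m', 2 + (c1 + (c2 + (4 + 4))))" using ie 4 m'(1) by simp
    moreover have "real 4 + 7 * potential A (deg m') P' \<le> 7 * potential A (deg m) P2 + 14 * A + 70
        + 10 * real K"
      using m'(5) m2(3) ge0 by simp
    moreover have "sing m' = (sing m2)(x := deg m x \<noteq> 1, y := deg m y \<noteq> 1)" using m'(4) 4 sx xy(1)
        by (auto simp: fun_eq_iff)
    ultimately show ?thesis using m'(2) A'[OF refl, of 4] boundary[OF m'(3)] by blast
  qed
qed

section \<open>Update sequences\<close>

text \<open>\<open>0 < L\<close> enters through the strict upper bound on the numbers, all of which
  are 0.\<close>

lemma state_ok_init: "0 < L \<Longrightarrow> state_ok L {} {} wt init_mem (\<lambda>_. None)"
  unfolding state_ok_def decomposition_def adj_ok_def tedges_ok_def numbering_ok_def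
  by (auto simp: init_mem_def bij_betw_def)

text \<open>The new vertex is flagged and has degree zero, so neither the set of regular vertices
  nor \<open>room\<close> changes.\<close>

lemma state_ok_add_vertex:
  assumes s: "state_ok L V E wt m P" and v: "v \<notin> V"
  shows "state_ok L (insert v V) E wt (m\<lparr>sing := (sing m)(v := True)\<rparr>) P"
proof -
  let ?S = "{v. sing m v}"
  interpret decomposition V E ?S P using s by (simp add: state_ok_def)
  have nok: "numbering_ok L V ?S P wt (deg m) (num m) (lam m) (created m) (dict m)"
    and adj: "adj_ok E wt (deg m) (adj m)" using s by (auto simp: state_ok_def)
  have S: "{u. sing (m\<lparr>sing := (sing m)(v := True)\<rparr>) u} = insert v ?S" by auto
  have "{ed \<in> E. v \<in> ed} = {}" using edge v by blast
  then have "deg m v = 0" using adj_ok_degree[OF adj, of v] by (metis card.empty)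
  then have R: "{u \<in> insert v V. 2 \<le> deg m u} = {u \<in> V. 2 \<le> deg m u}" by auto
  have N: "insert v V - insert v ?S = V - ?S" using v S_subset by blast
  have rp: "rpath E (insert v ?S) p" if "rpath E ?S p" for p
    using that inner_subset[OF that] v by (auto simp: rpath_def)
  have "decomposition (insert v V) E (insert v ?S) P"
  proof
    show "card {ed \<in> E. u \<in> ed} = 2" if "u \<in> insert v V - insert v ?S" for u
      using two_edges[of u] that unfolding N by blast
    show "finite (insert v V)" "insert v ?S \<subseteq> insert v V" "finite (dom P)"
      using finite_V S_subset finite_dom by auto
    show "\<exists>a b. ed = {a, b} \<and> a \<noteq> b \<and> a \<in> insert v V \<and> b \<in> insert v V" if "ed \<in> E" for ed
      using edge[OF that] by blast
    show "rpath E (insert v ?S) p" if "P e = Some p" for e p using rp path that by blast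
    show "set (path_edges p) \<inter> set (path_edges q) = {}" if "P e = Some p" "P f = Some q" "e \<noteq> f"
        for e f p q
      using disjoint that .
    show "\<exists>e p. P e = Some p \<and> ed \<in> set (path_edges p)" if "ed \<in> E" for ed using cover that .
  qed
  moreover have "numbering_ok L (insert v V) (insert v ?S) P wt (deg m) (num m) (lam m) (created
      m) (dict m)"
    using nok unfolding numbering_ok_def N room_def R .
  ultimately show ?thesis using s unfolding state_ok_def S by simp
qed

lemma run_snoc:
  "run D L (us @ [u]) m =
     (let (m', c) = run D L us m; (_, m'', c') = process D L u m' in (m'', c + c'))"
  by (induction us arbitrary: m) (auto simp: Let_def split: prod.splits)

lemma graph_after_snoc: "graph_after (us @ [u]) = apply_update (graph_after us) u"
  by (simp add: graph_after_def)

text \<open>Time plus seven times the potential grows by at most a fixed amount per update. That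
  vertices and edges together number at most \<open>i\<close> supplies the bound by \<open>L\<close>
  in \<open>insert_edge_ok\<close>.\<close>

lemma run_invariant:
  fixes us :: "'v update list"
  assumes valid: "valid_updates us" and len: "length us = L" and i: "i \<le> L" and L: "0 < L"
    and D: "\<forall>N \<le> L + 4. D N \<le> K"
  defines "A \<equiv> log 2 (real L) + 2"
  defines "G \<equiv> graph_after (take i us)" and "m \<equiv> memory_after D L (take i us)"
  shows "\<exists>P. state_ok L (verts G) (edges G) (weight G) m P \<and> (\<forall>v. sing m v \<longleftrightarrow> v \<in> verts G \<and> deg m v
      \<noteq> 2) \<and>
    card (verts G) + card (edges G) \<le> i \<and>
    real (total_time D L (take i us)) + 7 * potential A (deg m) P \<le> real i * (14 * A + 200 + 20 *
        real K)"
  using i unfolding G_def m_def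
proof (induction i)
  case 0
  have "state_ok L {} {} (\<lambda>_. 0) init_mem (\<lambda>_. None :: 'v list option)" using state_ok_init[OF L] .
  then show ?case
    by (intro exI[of _ "\<lambda>_. None"])
      (auto simp: graph_after_def empty_graph_def memory_after_def total_time_def potential_def
          init_mem_def)
next
  case (Suc i)
  let ?us = "take i us" and ?B = "14 * A + 200 + 20 * real K"
  let ?G = "graph_after ?us" and ?m = "memory_after D L ?us"
  obtain P where P: "state_ok L (verts ?G) (edges ?G) (weight ?G) ?m P"
    "\<forall>v. sing ?m v \<longleftrightarrow> v \<in> verts ?G \<and> deg ?m v \<noteq> 2" "card (verts ?G) + card (edges ?G) \<le> i"
    "real (total_time D L ?us) + 7 * potential A (deg ?m) P \<le> real i * ?B"
    using Suc by auto
  have il: "i < length us" using Suc.prems len by simp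
  then have take: "take (Suc i) us = ?us @ [us ! i]" by (rule take_Suc_conv_app_nth)
  have adm: "admissible ?G (us ! i)" and acyc: "\<nexists>c. regular_cycle (graph_after (take (Suc i) us)) c"
    using valid il unfolding valid_updates_def by auto
  obtain mm cc where run: "run D L ?us init_mem = (mm, cc)" by fastforce
  have mm: "?m = mm" "total_time D L ?us = cc" using run by (auto simp: memory_after_def
      total_time_def)
  interpret decomposition "verts ?G" "edges ?G" "{v. sing ?m v}" P using P(1) by (simp add:
      state_ok_def)
  have A0: "0 \<le> A" unfolding A_def using L log_nat_nonneg[of L] by linarith
  have sB: "real (Suc i) * ?B = real i * ?B + ?B" by (simp add: algebra_simps)
  show ?case
  proof (cases "us ! i")
    case (Ins_Vertex v)
    let ?m' = "mm\<lparr>sing := (sing mm)(v := True)\<rparr>"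
    have G': "graph_after (take (Suc i) us) = ?G\<lparr>verts := insert v (verts ?G)\<rparr>"
      unfolding take graph_after_snoc Ins_Vertex by simp
    have m': "memory_after D L (take (Suc i) us) = ?m'" "total_time D L (take (Suc i) us) = cc"
      unfolding take memory_after_def total_time_def run_snoc run Ins_Vertex by simp_all
    have v: "v \<notin> verts ?G" using adm Ins_Vertex by simp
    have "{ed \<in> edges ?G. v \<in> ed} = {}" using edge v by blast
    moreover have "adj_ok (edges ?G) (weight ?G) (deg ?m) (adj ?m)" using P(1) by (simp add:
        state_ok_def)
    ultimately have "deg mm v = 0" using adj_ok_degree[of "weight ?G" "deg ?m" "adj ?m" v] mm by
        (metis card.empty)
    have "state_ok L (insert v (verts ?G)) (edges ?G) (weight ?G) ?m' P"
      using state_ok_add_vertex[OF P(1) v] mm by simp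
    moreover have "\<forall>u. sing ?m' u \<longleftrightarrow> u \<in> insert v (verts ?G) \<and> deg ?m' u \<noteq> 2"
      using P(2) \<open>deg mm v = 0\<close> unfolding mm by auto
    moreover have "card (insert v (verts ?G)) + card (edges ?G) \<le> Suc i"
      using P(3) v finite_V by simp
    moreover have "real cc + 7 * potential A (deg ?m') P \<le> real (Suc i) * ?B"
      using P(4) A0 unfolding mm sB by simp
    ultimately show ?thesis unfolding G' m' by (intro exI[of _ P]) simp
  next
    case (Ins_Edge x y w)
    let ?E = "insert {x, y} (edges ?G)" and ?wt = "(weight ?G)({x, y} := w)"
    have G': "graph_after (take (Suc i) us) = \<lparr>verts = verts ?G, edges = ?E, weight = ?wt\<rparr>"
      unfolding take graph_after_snoc Ins_Edge by (cases ?G) simp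
    have a: "x \<in> verts ?G" "y \<in> verts ?G" "x \<noteq> y" "{x, y} \<notin> edges ?G" "0 < w" using adm Ins_Edge
        by auto
    have cardE: "card (verts ?G) + card ?E \<le> Suc i" using P(3) a(4) finite_E by simp
    then have cV: "card (verts ?G) \<le> L" "card (verts ?G) + card ?E \<le> L" using Suc.prems by auto
    have Dv: "\<forall>N \<le> card (verts ?G) + 4. D N \<le> K" using D cV(1) by auto
    have "0 < card (verts ?G)" using a(1) finite_V by (auto simp: card_gt_0_iff)
    then have Av: "log 2 (real (card (verts ?G))) + 2 \<le> A" unfolding A_def using cV(1) by simp
    have acyc': "\<not> regular_cycle \<lparr>verts = verts ?G, edges = ?E, weight = ?wt\<rparr> c" for c
      using acyc unfolding G' by blast
    obtain m' P' c where m': "insert_edge D L x y w ?m = ((), m', c)" "state_ok L (verts ?G) ?E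
        ?wt m' P'"
      "\<forall>v. sing m' v \<longleftrightarrow> v \<in> verts ?G \<and> deg m' v \<noteq> 2"
      "real c + 7 * potential A (deg m') P' \<le> 7 * potential A (deg ?m) P + ?B"
      using insert_edge_ok[OF P(1) P(2)[rule_format] a acyc' cV(2) Dv Av] by auto
    have mem: "memory_after D L (take (Suc i) us) = m'" "total_time D L (take (Suc i) us) = cc + c"
      unfolding take memory_after_def total_time_def run_snoc run Ins_Edge using m'(1) mm(1) by
          simp_all
    have "real (cc + c) + 7 * potential A (deg m') P' \<le> real (Suc i) * ?B"
      using m'(4) P(4) unfolding mm(2) sB by simp
    then show ?thesis using m'(2,3) cardE unfolding G' mem
      by (intro exI[of _ P']) (simp del: fun_upd_apply)
  qed
qed

lemma invariant_same_multigraph: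
  assumes s: "state_ok L (verts G) (edges G) (weight G) m P"
    and sing: "\<forall>v. sing m v \<longleftrightarrow> v \<in> verts G \<and> deg m v \<noteq> 2"
  shows "same_multigraph (stored_simplification m) (simplification G)"
proof -
  interpret decomposition "verts G" "edges G" "{v. sing m v}" P using s by (simp add: state_ok_def)
  have "adj_ok (edges G) (weight G) (deg m) (adj m)"
    and tok: "tedges_ok (weight G) (deg m) P (tedge m) (tinc m) (next_id m)" using s by (auto
        simp: state_ok_def)
  then have "{v. sing m v} = {v. singular G v}"
    using adj_ok_degree sing by (auto simp: singular_def degree_def)
  then show ?thesis using same_multigraph[OF refl refl _ refl tok] by simp
qed

lemma potential_nonneg:
  assumes s: "state_ok L V E wt m P" and L: "card V \<le> L" "0 < L"
  shows "0 \<le> potential (log 2 (real L) + 2) dg P"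
proof -
  interpret decomposition V E "{v. sing m v}" P using s by (simp add: state_ok_def)
  have "0 \<le> pot (log 2 (real L) + 2) dg (the (P e))" if e: "e \<in> dom P" for e
  proof -
    obtain p where p: "P e = Some p" using e by blast
    have "length (inner p) \<le> L" using length_inner[OF path[OF p]] L by simp
    then show ?thesis using pot_nonneg(1)[of L "log 2 (real L) + 2" p dg] p by simp
  qed
  then show ?thesis unfolding potential_def by (rule sum_nonneg)
qed

text \<open>\<open>D\<close> need not be monotone, hence the maximum over a range that contains all
  occurring dictionary sizes.\<close>

lemma correct_and_fast:
  fixes us :: "'v update list" and D :: "nat \<Rightarrow> nat"
  assumes "valid_updates us" "length us = l"
  shows "\<forall>i \<le> l. same_multigraph (stored_simplification (memory_after D l (take i us)))
      (simplification (graph_after (take i us)))"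
    "real (total_time D l us) \<le> real l * (14 * (log 2 (real l) + 2) + 200 + 20 * real (Max (D `
        {..l + 4})))"
proof -
  let ?K = "Max (D ` {..l + 4})"
  have D: "\<forall>N \<le> l + 4. D N \<le> ?K" by auto
  show "\<forall>i \<le> l. same_multigraph (stored_simplification (memory_after D l (take i us)))
      (simplification (graph_after (take i us)))"
  proof (intro allI impI)
    fix i assume i: "i \<le> l"
    show "same_multigraph (stored_simplification (memory_after D l (take i us)))
      (simplification (graph_after (take i us)))"
    proof (cases "l = 0")
      case True
      then have "take i us = []" using i by simp
      \<comment> \<open>The initial memory does not depend on the number of updates, so the
        invariant may be taken with 1 in place of \<open>l = 0\<close>.\<close>
      moreover have "state_ok 1 {} {} (\<lambda>_. 0) init_mem (\<lambda>_. None :: 'v list option)" by (rule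
          state_ok_init) simp
      ultimately show ?thesis
        by (intro invariant_same_multigraph[of 1 _ _ "\<lambda>_. None"])
          (auto simp: graph_after_def empty_graph_def memory_after_def init_mem_def)
    next
      case False
      then show ?thesis using run_invariant[OF assms i _ D] invariant_same_multigraph by blast
    qed
  qed
  show "real (total_time D l us) \<le> real l * (14 * (log 2 (real l) + 2) + 200 + 20 * real ?K)"
  proof (cases "l = 0")
    case True
    then show ?thesis using assms(2) by (simp add: total_time_def)
  next
    case False
    have t: "take l us = us" using assms(2) by simp
    obtain P where P: "state_ok l (verts (graph_after us)) (edges (graph_after us)) (weight
        (graph_after us)) (memory_after D l us) P"
      "card (verts (graph_after us)) + card (edges (graph_after us)) \<le> l"
      "real (total_time D l us) + 7 * potential (log 2 (real l) + 2) (deg (memory_after D l us)) P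
        \<le> real l * (14 * (log 2 (real l) + 2) + 200 + 20 * real ?K)"
      using run_invariant[OF assms order.refl _ D] False unfolding t by auto
    have "0 \<le> potential (log 2 (real l) + 2) (deg (memory_after D l us)) P"
      using potential_nonneg[OF P(1)] P(2) False by simp
    then show ?thesis using P(3) by linarith
  qed
qed

section \<open>Asymptotic bounds\<close>

lemma ln_ge_one:
  assumes "4 \<le> l"
  shows "1 \<le> ln (real l)"
proof -
  have "(1::real) = ln (exp 1)" by simp
  also have "\<dots> \<le> ln (real l)" using exp_le assms by (intro ln_mono) auto
  finally show ?thesis .
qed

text \<open>Sizes below the threshold contribute a constant, absorbed by
  \<open>1 \<le> ln l\<close>; for the others \<open>l + 4 \<le> l * l\<close> turns the shift by 4
  into a factor 2.\<close>

lemma Max_bigo_ln: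
  fixes D :: "nat \<Rightarrow> nat"
  assumes "(\<lambda>N. real (D N)) \<in> O(\<lambda>N. ln (real N))"
  shows "(\<lambda>l. real (Max (D ` {..l + 4}))) \<in> O(\<lambda>l. ln (real l))"
proof -
  obtain c where c: "c > 0" "eventually (\<lambda>N. norm (real (D N)) \<le> c * norm (ln (real N))) at_top"
    using landau_o.bigE[OF assms] by blast
  then obtain N0 where N0: "\<And>N. N \<ge> N0 \<Longrightarrow> norm (real (D N)) \<le> c * norm (ln (real N))"
    unfolding eventually_at_top_linorder by blast
  define M where "M = Max (D ` {..N0})"
  have bound: "real (Max (D ` {..l + 4})) \<le> (real M + 2 * c) * ln (real l)" if l: "l \<ge> 4" for l
  proof -
    have ln1: "1 \<le> ln (real l)" using ln_ge_one[OF l] .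
    have "ln (real (l + 4)) \<le> ln (real l * real l)"
    proof (intro ln_mono)
      have "l + 4 \<le> 2 * l" "2 * l \<le> l * l" using l by auto
      then have "l + 4 \<le> l * l" by linarith
      then show "real (l + 4) \<le> real l * real l" by (metis of_nat_le_iff of_nat_mult)
    qed (use l in auto)
    also have "\<dots> = 2 * ln (real l)" using l by (simp add: ln_mult)
    finally have ln2: "ln (real (l + 4)) \<le> 2 * ln (real l)" .
    have "real (D N) \<le> (real M + 2 * c) * ln (real l)" if N: "N \<le> l + 4" for N
    proof (cases "N < N0")
      case True
      then have "D N \<le> M" unfolding M_def by (intro Max_ge) auto
      then have "real (D N) \<le> real M * 1" by simp
      also have "\<dots> \<le> (real M + 2 * c) * ln (real l)" using ln1 c(1) by (intro mult_mono) auto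
      finally show ?thesis .
    next
      case False
      have "real (D N) \<le> c * norm (ln (real N))" using N0[of N] False by simp
      also have "norm (ln (real N)) \<le> 2 * ln (real l)"
      proof (cases "N = 0")
        case True
        then show ?thesis using ln1 by simp
      next
        case False
        then have "ln (real N) \<le> ln (real (l + 4))" "0 \<le> ln (real N)" using N by auto
        then show ?thesis using ln2 by simp
      qed
      then have "c * norm (ln (real N)) \<le> c * (2 * ln (real l))" using c(1) by simp
      also have "\<dots> \<le> (real M + 2 * c) * ln (real l)" using ln1 by (simp add: algebra_simps)
      finally show ?thesis .
    qed
    moreover have "Max (D ` {..l + 4}) \<in> D ` {..l + 4}" by (rule Max_in) auto
    then obtain N where "N \<le> l + 4" "Max (D ` {..l + 4}) = D N" by blast
    ultimately show ?thesis by simp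
  qed
  show ?thesis
  proof (rule landau_o.bigI)
    show "real M + 2 * c > 0" using c(1) by simp
    show "eventually (\<lambda>l. norm (real (Max (D ` {..l + 4}))) \<le> (real M + 2 * c) * norm (ln (real
        l))) at_top"
      using eventually_ge_at_top[of 4]
    proof eventually_elim
      case (elim l)
      have "0 \<le> ln (real l)" using elim by simp
      then show ?case using bound[OF elim] by simp
    qed
  qed
qed

theorem theorem1:
  fixes D :: "nat \<Rightarrow> nat"
  assumes "(\<lambda>N. real (D N)) \<in> O(\<lambda>N. ln (real N))"
  shows "\<exists>T :: nat \<Rightarrow> real.
           T \<in> O(\<lambda>l. real l * ln (real l)) \<and>
           (\<forall>(l :: nat) (us :: 'v update list).
              length us = l \<and> valid_updates us \<longrightarrow>
                (\<forall>i \<le> l. same_multigraph (stored_simplification (memory_after D l (take i us)))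
                                         (simplification (graph_after (take i us)))) \<and>
                real (total_time D l us) \<le> T l)"
proof -
  let ?T = "\<lambda>l. real l * (14 * (log 2 (real l) + 2) + 200 + 20 * real (Max (D ` {..l + 4})))"
  have "(\<lambda>l. 14 * (log 2 (real l) + 2) + 200 :: real) \<in> O(\<lambda>l. ln (real l))"
  proof (rule landau_o.bigI)
    \<comment> \<open>\<open>228 = 14 * 2 + 200\<close>: the constant terms are absorbed by
      \<open>1 \<le> ln l\<close>, and \<open>14 / ln 2\<close> converts the binary
      logarithm.\<close>
    show "14 / ln 2 + 228 > (0 :: real)" by (simp add: add_pos_pos)
    show "eventually (\<lambda>l. norm (14 * (log 2 (real l) + 2) + 200) \<le> (14 / ln 2 + 228) * norm (ln
        (real l))) at_top"
      using eventually_ge_at_top[of 4]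
    proof eventually_elim
      case (elim l)
      have ln1: "1 \<le> ln (real l)" using ln_ge_one[OF elim] .
      then have "14 * (log 2 (real l) + 2) + 200 \<le> (14 / ln 2 + 228) * ln (real l)"
        by (simp add: log_def algebra_simps)
      moreover have "0 \<le> log 2 (real l)" using elim by simp
      ultimately show ?case using ln1 by simp
    qed
  qed
  moreover have "(\<lambda>l. 20 * real (Max (D ` {..l + 4}))) \<in> O(\<lambda>l. ln (real l))"
    using Max_bigo_ln[OF assms] by simp
  ultimately have "(\<lambda>l. 14 * (log 2 (real l) + 2) + 200 + 20 * real (Max (D ` {..l + 4}))) \<in> O(\<lambda>l.
      ln (real l))"
    by (rule sum_in_bigo)
  then have "?T \<in> O(\<lambda>l. real l * ln (real l))"
    by (intro landau_o.big.mult) auto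
  then show ?thesis using correct_and_fast[of _ _ D] by (intro exI[of _ ?T]) blast
qed

end
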